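(* Suppose that $1<q<\infty$ and $\frac{1}{q}=1-\psi$, with $\psi\in(0,1)$. Then $$\big[H^1,BMO\big]_{\psi,q}=L^q.$$
   Context: Let $d\geq 1$ be an integer and $S=\mathbb{R}^d\ltimes\mathbb{R}^+$ the group with product $(x,a)\cdot(x',a')=(x+a\,x',a\,a')$, endowed with the right Haar measure $d\rho(x,a)=a^{-1}\,dx\,da$. Write $L^p=L^p(S,\rho)$ with norm $\|\cdot\|_p$. A Calderón--Zygmund set is a set $R=Q\times[ae^{-r},ae^r]$, where $Q$ is a dyadic cube in $\mathbb{R}^d$ of side $L$, $a\in\mathbb{R}^+$, $r>0$, and $e^2ar\leq L<e^8ar$ if $r<1$, while $ae^{2r}\leq L<ae^{8r}$ if $r\geq1$. $\mathcal{R}$ denotes the family of all Calderón--Zygmund sets. $H^1=H^{1,\infty}$ consists of all $h\in L^1$ such that $h=\sum_j\lambda_ja_j$ with $\sum_j|\lambda_j|<\infty$, $\lambda_j\in\mathbb{C}$, and $a_j$ $(1,\infty)$-atoms, i.e. functions supported in a Calderón--Zygmund set $R$ with $\|a_j\|_\infty\leq\rho(R)^{-1}$ and $\int a_j\,d\rho=0$; $\|h\|_{H^1}$ is the infimum of $\sum_j|\lambda_j|$ over all such decompositions. For $f\in L^1_{\mathrm{loc}}$, $f_R=\frac{1}{\rho(R)}\int_Rf\,d\rho$ and $\|f\|_*=\sup_{R\in\mathcal{R}}\frac{1}{\rho(R)}\int_R|f-f_R|\,d\rho$. $BMO$ is the space of all $f\in L^1_{\mathrm{loc}}$ with $\|f\|_*<\infty$,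 modulo constant functions, regarded as a normed space with norm $\|\cdot\|_*$ (so any two functions $f,g$ with $\|f-g\|_*=0$ are identified). Elements of $H^1$ and of $L^{p}$ spaces are identified with their classes modulo the same functions when forming sums with $BMO$. For two compatible normed spaces $X_0,X_1$, $t>0$ and $x\in X_0+X_1$, let $K(t,x;X_0,X_1)=\inf\{\|x_0\|_{X_0}+t\|x_1\|_{X_1}: x=x_0+x_1,\ x_i\in X_i\}$. For $q\in[1,\infty]$, $\theta\in(0,1)$, the real interpolation space $[X_0,X_1]_{\theta,q}$ is the set of $x\in X_0+X_1$ for which $\|x\|_{\theta,q}<\infty$, where $\|x\|_{\theta,q}=\big(\int_0^\infty[t^{-\theta}K(t,x;X_0,X_1)]^q\frac{dt}{t}\big)^{1/q}$ if $q<\infty$ and $\|x\|_{\theta,\infty}=\sup_{t>0}t^{-\theta}K(t,x;X_0,X_1)$. Equality of interpolation spaces is understood with equivalence of norms. *)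

theory Defs
  imports "HOL-Analysis.Analysis"
begin

text \<open>The group \<open>\<real>\<^sup>d \<ltimes> \<real>\<^sup>+\<close>, with \<open>d = CARD('n)\<close>, is modelled by its underlying set, a subset of
  \<open>\<real>\<^sup>d \<times> \<real>\<close>. The group law \<open>(x, a) \<cdot> (x', a') = (x + a x', a a')\<close> enters the theory only
  through the right Haar measure \<open>a\<^sup>-\<^sup>1 dx da\<close>. Functions on the group are functions on
  \<open>\<real>\<^sup>d \<times> \<real>\<close> whose values at points with \<open>a \<le> 0\<close> are irrelevant.\<close>

definition S_set :: "((real^'n) \<times> real) set" where
  "S_set = UNIV \<times> {0<..}"

definition rho :: "((real^'n) \<times> real) measure" where
  "rho = density (restrict_space lborel S_set) (\<lambda>(x, a). ennreal (1 / a))"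

definition Lp :: "real \<Rightarrow> ((real^'n) \<times> real \<Rightarrow> complex) set" where
  "Lp p = {f \<in> borel_measurable rho. integrable rho (\<lambda>z. cmod (f z) powr p)}"

definition Lp_norm :: "real \<Rightarrow> ((real^'n) \<times> real \<Rightarrow> complex) \<Rightarrow> real" where
  "Lp_norm p f = (LINT z|rho. cmod (f z) powr p) powr (1 / p)"

definition L1_loc :: "((real^'n) \<times> real \<Rightarrow> complex) set" where
  "L1_loc = {f \<in> borel_measurable rho. \<forall>K. compact K \<and> K \<subseteq> S_set \<longrightarrow> set_integrable rho K f}"

text \<open>Dyadic cubes are taken half-open, so that those of a given side partition \<open>\<real>\<^sup>d\<close>.\<close>

definition dyadic_cube :: "(real^'n) set \<Rightarrow> real \<Rightarrow> bool" where
  "dyadic_cube Q L \<longleftrightarrow> (\<exists>(k::int) (m::'n \<Rightarrow> int). L = 2 powi k \<and>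
     Q = {x. \<forall>i. L * of_int (m i) \<le> x $ i \<and> x $ i < L * (of_int (m i) + 1)})"

definition CZ_sets :: "((real^'n) \<times> real) set set" where
  "CZ_sets = {Q \<times> {a * exp (- r)..a * exp r} | Q L a r.
     dyadic_cube Q L \<and> a > 0 \<and> r > 0 \<and>
     (r < 1 \<longrightarrow> exp 2 * a * r \<le> L \<and> L < exp 8 * a * r) \<and>
     (r \<ge> 1 \<longrightarrow> a * exp (2 * r) \<le> L \<and> L < a * exp (8 * r))}"

definition atom :: "((real^'n) \<times> real \<Rightarrow> complex) \<Rightarrow> bool" where
  "atom b \<longleftrightarrow> b \<in> borel_measurable rho \<and>
     (\<exists>R\<in>CZ_sets. (AE z in rho. z \<notin> R \<longrightarrow> b z = 0) \<and>
                  (AE z in rho. cmod (b z) \<le> 1 / measure rho R)) \<and>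
     (LINT z|rho. b z) = 0"

text \<open>The atomic series converges in \<open>L\<^sup>1\<close>; finite sums are covered, since \<open>0\<close> is an atom.\<close>

definition atomic_decomp ::
    "((real^'n) \<times> real \<Rightarrow> complex) \<Rightarrow> (nat \<Rightarrow> complex) \<Rightarrow> (nat \<Rightarrow> (real^'n) \<times> real \<Rightarrow> complex) \<Rightarrow> bool" where
  "atomic_decomp h c b \<longleftrightarrow> integrable rho h \<and> summable (\<lambda>j. cmod (c j)) \<and> (\<forall>j. atom (b j)) \<and>
     (\<lambda>n. LINT z|rho. cmod (h z - (\<Sum>j<n. c j * b j z))) \<longlonglongrightarrow> 0"

definition H1 :: "((real^'n) \<times> real \<Rightarrow> complex) set" where
  "H1 = {h. \<exists>c b. atomic_decomp h c b}"

definition H1_norm :: "((real^'n) \<times> real \<Rightarrow> complex) \<Rightarrow> real" where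
  "H1_norm h = Inf {\<Sum>j. cmod (c j) | c b. atomic_decomp h c b}"

definition avg :: "((real^'n) \<times> real \<Rightarrow> complex) \<Rightarrow> ((real^'n) \<times> real) set \<Rightarrow> complex" where
  "avg f R = (LINT z:R|rho. f z) /\<^sub>R measure rho R"

definition star_norm :: "((real^'n) \<times> real \<Rightarrow> complex) \<Rightarrow> ennreal" where
  "star_norm f =
     (SUP R\<in>CZ_sets. (\<integral>\<^sup>+z\<in>R. ennreal (cmod (f z - avg f R)) \<partial>rho) / emeasure rho R)"

definition BMO :: "((real^'n) \<times> real \<Rightarrow> complex) set" where
  "BMO = {f \<in> L1_loc. star_norm f < \<infinity>}"

definition BMO_norm :: "((real^'n) \<times> real \<Rightarrow> complex) \<Rightarrow> real" where
  "BMO_norm f = enn2real (star_norm f)"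

text \<open>The ambient space of the couple \<open>(H\<^sup>1, BMO)\<close> is the space of locally integrable functions
  modulo those of vanishing \<open>BMO\<close> seminorm. These are not only the constants: no Calderon-Zygmund set meets two
  different orthants of \<open>\<real>\<^sup>d\<close>, so the constant may change from orthant to orthant.\<close>

definition star_rel :: "((real^'n) \<times> real \<Rightarrow> complex) rel" where
  "star_rel = {(f, g). f \<in> L1_loc \<and> g \<in> L1_loc \<and> star_norm (\<lambda>z. f z - g z) = 0}"

lemma CZ_set_compact_hull:
  fixes R :: "((real^'n) \<times> real) set"
  assumes "R \<in> CZ_sets"
  obtains K where "compact K" "K \<subseteq> S_set" "R \<subseteq> K" "R \<in> sets borel"
proof -
  obtain Q :: "(real^'n) set" and L a r k and m :: "'n \<Rightarrow> int" where R: "R = Q \<times> {a * exp (- r)..a * exp r}" "a > 0"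
    and Q: "Q = {x. \<forall>i. L * of_int (m i) \<le> x $ i \<and> x $ i < L * (of_int (m i) + 1)}"
    using assms unfolding CZ_sets_def dyadic_cube_def by blast
  let ?B = "cbox (\<chi> i. L * of_int (m i)) (\<chi> i. L * (of_int (m i) + 1)) :: (real^'n) set"
  let ?K = "?B \<times> {a * exp (- r)..a * exp r}"
  have QB: "Q \<subseteq> ?B" unfolding Q by (auto simp: mem_box_cart less_imp_le)
  have 1: "compact ?K" by (intro compact_Times) auto
  have "0 < a * exp (- r)" using R(2) by simp
  hence 2: "?K \<subseteq> S_set" unfolding S_set_def using less_le_trans by fastforce
  have "{x :: real^'n. c \<le> x $ i \<and> x $ i < d} \<in> sets borel" for c d i
  proof -
    have "{x :: real^'n. c \<le> x $ i \<and> x $ i < d} = {x. c \<le> x $ i} \<inter> {x. x $ i < d}" by auto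
    moreover have "{x :: real^'n. c \<le> x $ i} \<in> sets borel"
      by (intro borel_closed closed_Collect_le continuous_intros)
    moreover have "{x :: real^'n. x $ i < d} \<in> sets borel"
      by (intro borel_open open_Collect_less continuous_intros)
    ultimately show ?thesis by simp
  qed
  moreover have "Q = (\<Inter>i\<in>UNIV. {x. L * of_int (m i) \<le> x $ i \<and> x $ i < L * (of_int (m i) + 1)})"
    unfolding Q by auto
  ultimately have "Q \<in> sets borel"
    by (simp only:) (intro sets.finite_INT finite UNIV_not_empty)
  hence "R \<in> sets (borel \<Otimes>\<^sub>M borel)" unfolding R(1) by (intro pair_measureI) auto
  hence "R \<in> sets borel" by (simp only: borel_prod)
  with 1 2 QB R(1) show ?thesis by (intro that[of ?K]) auto
qed

lemma space_rho: "space rho = S_set"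
  by (simp add: rho_def space_restrict_space)

lemma S_set_borel: "S_set \<in> sets borel"
  unfolding S_set_def by (intro borel_open open_Times) auto

lemma sets_rho: "A \<subseteq> S_set \<Longrightarrow> A \<in> sets borel \<Longrightarrow> A \<in> sets rho"
  by (simp add: rho_def sets_restrict_space_iff S_set_borel)

lemma L1_loc_CZ:
  assumes "f \<in> L1_loc" "R \<in> CZ_sets"
  shows "set_integrable rho R f" "R \<in> sets rho"
proof -
  obtain K where K: "compact K" "K \<subseteq> S_set" "R \<subseteq> K" "R \<in> sets borel"
    using CZ_set_compact_hull[OF assms(2)] .
  show R: "R \<in> sets rho" using K by (intro sets_rho) auto
  have "set_integrable rho K f" using assms(1) K by (auto simp: L1_loc_def)
  thus "set_integrable rho R f" using set_integrable_subset K R by blast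
qed

lemma star_norm_uminus: "star_norm (\<lambda>z. - f z) = star_norm f"
proof -
  have "avg (\<lambda>z. - f z) R = - avg f R" for R
    by (simp add: avg_def set_lebesgue_integral_def)
  hence "cmod (- f z - avg (\<lambda>z. - f z) R) = cmod (f z - avg f R)" for z R
    by (metis minus_diff_minus norm_minus_cancel)
  thus ?thesis by (simp add: star_norm_def)
qed

lemma star_norm_add:
  fixes f g :: "(real^'n) \<times> real \<Rightarrow> complex"
  assumes f: "f \<in> L1_loc" and g: "g \<in> L1_loc"
  shows "star_norm (\<lambda>z. f z + g z) \<le> star_norm f + star_norm g"
  unfolding star_norm_def[of "\<lambda>z. f z + g z"]
proof (rule SUP_least)
  fix R :: "((real^'n) \<times> real) set" assume R: "R \<in> CZ_sets"
  note fi = L1_loc_CZ[OF f R] and gi = L1_loc_CZ[OF g R]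
  have [measurable]: "f \<in> borel_measurable rho" "g \<in> borel_measurable rho" "R \<in> sets rho"
    using f g fi by (auto simp: L1_loc_def)
  have av: "avg (\<lambda>z. f z + g z) R = avg f R + avg g R"
    unfolding avg_def using set_integral_add(2)[OF fi(1) gi(1)] by (simp add: scaleR_add_right)
  have "(\<integral>\<^sup>+z\<in>R. ennreal (cmod (f z + g z - avg (\<lambda>z. f z + g z) R)) \<partial>rho)
      \<le> (\<integral>\<^sup>+z. ennreal (cmod (f z - avg f R)) * indicator R z + ennreal (cmod (g z - avg g R)) * indicator R z \<partial>rho)"
  proof (rule nn_integral_mono)
    fix z
    have "cmod (f z + g z - (avg f R + avg g R)) \<le> cmod (f z - avg f R) + cmod (g z - avg g R)"
      using norm_triangle_ineq[of "f z - avg f R" "g z - avg g R"] by (simp add: algebra_simps)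
    thus "ennreal (cmod (f z + g z - avg (\<lambda>z. f z + g z) R)) * indicator R z
      \<le> ennreal (cmod (f z - avg f R)) * indicator R z + ennreal (cmod (g z - avg g R)) * indicator R z"
      by (auto simp: av indicator_def ennreal_plus[symmetric] simp del: ennreal_plus intro!: ennreal_leI)
  qed
  also have "\<dots> = (\<integral>\<^sup>+z\<in>R. ennreal (cmod (f z - avg f R)) \<partial>rho) + (\<integral>\<^sup>+z\<in>R. ennreal (cmod (g z - avg g R)) \<partial>rho)"
    by (rule nn_integral_add) measurable
  finally have "(\<integral>\<^sup>+z\<in>R. ennreal (cmod (f z + g z - avg (\<lambda>z. f z + g z) R)) \<partial>rho) / emeasure rho R
     \<le> (\<integral>\<^sup>+z\<in>R. ennreal (cmod (f z - avg f R)) \<partial>rho) / emeasure rho R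
       + (\<integral>\<^sup>+z\<in>R. ennreal (cmod (g z - avg g R)) \<partial>rho) / emeasure rho R"
    unfolding divide_ennreal_def distrib_right[symmetric] by (rule mult_right_mono) simp
  also have "\<dots> \<le> star_norm f + star_norm g"
    unfolding star_norm_def by (intro add_mono SUP_upper R)
  finally show "(\<integral>\<^sup>+z\<in>R. ennreal (cmod (f z + g z - avg (\<lambda>z. f z + g z) R)) \<partial>rho) / emeasure rho R
     \<le> star_norm f + star_norm g" .
qed

lemma L1_loc_diff: "f \<in> L1_loc \<Longrightarrow> g \<in> L1_loc \<Longrightarrow> (\<lambda>z. f z - g z) \<in> L1_loc"
  unfolding L1_loc_def by (auto intro: set_integral_diff(1))

lemma equiv_star_rel: "equiv (L1_loc :: ((real^'n) \<times> real \<Rightarrow> complex) set) star_rel"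
proof (rule equivI)
  show "star_rel \<subseteq> L1_loc \<times> (L1_loc :: ((real^'n) \<times> real \<Rightarrow> complex) set)" by (auto simp: star_rel_def)
  have "star_norm (\<lambda>z :: (real^'n) \<times> real. 0) = 0"
    unfolding star_norm_def
    by (intro antisym SUP_least) (simp_all add: avg_def set_lebesgue_integral_def)
  thus "refl_on (L1_loc :: ((real^'n) \<times> real \<Rightarrow> complex) set) star_rel" by (auto simp: star_rel_def refl_on_def)
  show "sym (star_rel :: ((real^'n) \<times> real \<Rightarrow> complex) rel)"
  proof (rule symI)
    fix f g :: "(real^'n) \<times> real \<Rightarrow> complex" assume "(f, g) \<in> star_rel"
    thus "(g, f) \<in> star_rel"
      using star_norm_uminus[of "\<lambda>z. f z - g z"] by (simp add: star_rel_def)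
  qed
  show "trans (star_rel :: ((real^'n) \<times> real \<Rightarrow> complex) rel)"
  proof (rule transI)
    fix f g h :: "(real^'n) \<times> real \<Rightarrow> complex" assume "(f, g) \<in> star_rel" "(g, h) \<in> star_rel"
    thus "(f, h) \<in> star_rel"
      using star_norm_add[of "\<lambda>z. f z - g z" "\<lambda>z. g z - h z"]
      by (simp add: star_rel_def L1_loc_diff)
  qed
qed

section \<open>The real interpolation method\<close>

text \<open>The couple is given by representatives: \<open>E\<close> is the equivalence relation whose classes are
  the elements of the ambient space, and \<open>(X0, n0)\<close>, \<open>(X1, n1)\<close> are the functions
  representing elements of the two spaces, with their norms. Only finite second index \<open>q\<close>.\<close>

definition couple_sum ::
    "('a \<Rightarrow> complex) rel \<Rightarrow> ('a \<Rightarrow> complex) set \<Rightarrow> ('a \<Rightarrow> complex) set \<Rightarrow> ('a \<Rightarrow> complex) set" where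
  "couple_sum E X0 X1 = {x. \<exists>x0\<in>X0. \<exists>x1\<in>X1. (x, (\<lambda>z. x0 z + x1 z)) \<in> E}"

definition K_functional ::
    "('a \<Rightarrow> complex) rel \<Rightarrow> ('a \<Rightarrow> complex) set \<Rightarrow> (('a \<Rightarrow> complex) \<Rightarrow> real) \<Rightarrow>
     ('a \<Rightarrow> complex) set \<Rightarrow> (('a \<Rightarrow> complex) \<Rightarrow> real) \<Rightarrow> real \<Rightarrow> ('a \<Rightarrow> complex) \<Rightarrow> real" where
  "K_functional E X0 n0 X1 n1 t x =
     Inf {n0 x0 + t * n1 x1 | x0 x1. x0 \<in> X0 \<and> x1 \<in> X1 \<and> (x, (\<lambda>z. x0 z + x1 z)) \<in> E}"

definition interp_integral ::
    "('a \<Rightarrow> complex) rel \<Rightarrow> ('a \<Rightarrow> complex) set \<Rightarrow> (('a \<Rightarrow> complex) \<Rightarrow> real) \<Rightarrow>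
     ('a \<Rightarrow> complex) set \<Rightarrow> (('a \<Rightarrow> complex) \<Rightarrow> real) \<Rightarrow> real \<Rightarrow> real \<Rightarrow> ('a \<Rightarrow> complex) \<Rightarrow> ennreal" where
  "interp_integral E X0 n0 X1 n1 \<theta> q x =
     (\<integral>\<^sup>+t\<in>{0<..}. ennreal ((t powr (- \<theta>) * K_functional E X0 n0 X1 n1 t x) powr q / t) \<partial>lborel)"

definition interp_space ::
    "('a \<Rightarrow> complex) rel \<Rightarrow> ('a \<Rightarrow> complex) set \<Rightarrow> (('a \<Rightarrow> complex) \<Rightarrow> real) \<Rightarrow>
     ('a \<Rightarrow> complex) set \<Rightarrow> (('a \<Rightarrow> complex) \<Rightarrow> real) \<Rightarrow> real \<Rightarrow> real \<Rightarrow> ('a \<Rightarrow> complex) set" where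
  "interp_space E X0 n0 X1 n1 \<theta> q =
     {x \<in> couple_sum E X0 X1. interp_integral E X0 n0 X1 n1 \<theta> q x < \<infinity>}"

definition interp_norm ::
    "('a \<Rightarrow> complex) rel \<Rightarrow> ('a \<Rightarrow> complex) set \<Rightarrow> (('a \<Rightarrow> complex) \<Rightarrow> real) \<Rightarrow>
     ('a \<Rightarrow> complex) set \<Rightarrow> (('a \<Rightarrow> complex) \<Rightarrow> real) \<Rightarrow> real \<Rightarrow> real \<Rightarrow> ('a \<Rightarrow> complex) \<Rightarrow> real" where
  "interp_norm E X0 n0 X1 n1 \<theta> q x =
     enn2real (interp_integral E X0 n0 X1 n1 \<theta> q x) powr (1 / q)"

end

theory Submission
  imports Defs
begin

text \<open>Since \<open>\<psi> q = q - 1\<close>, the interpolation integral of \<open>f\<close> is the integral of \<open>(K(t, f) / t)\<^sup>q\<close> over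
\<open>t > 0\<close>. Both inclusions compare \<open>K(t, f) / t\<close> with the distribution function of \<open>f\<close>, one dyadic
height \<open>2\<^sup>k\<close> at a time.

The tool is a splitting of Calderon-Zygmund sets. Either the cube can be halved, giving \<open>2\<^sup>d\<close> sets, or
the interval can be halved on the logarithmic scale, giving two; one of the two moves always leads to
Calderon-Zygmund sets again. Iterating it yields nested partitions in which the measure drops by a
factor of at most \<open>2\<^sup>d\<close> per generation, so that stopping time arguments work as for dyadic cubes in
Euclidean space. The locale \<open>dyadic_filtration\<close> contains these arguments. It is used
with a partition of the whole group into large cells, and with a single cell at the top.

\<^emph>\<open>From \<open>L\<^sup>q\<close> to the interpolation space.\<close> Let \<open>g\<^sub>k\<close> be \<open>f\<close>, replaced by its mean on the maximal cells on
which the mean of \<open>|f|\<close> exceeds \<open>\<lambda> 2\<^sup>k\<close>. Then \<open>f - g\<^sub>0\<close> is the sum of the differences \<open>g\<^sub>k\<^sub>+\<^sub>1 - g\<^sub>k\<close>, and these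
are sums of multiples of atoms, living on the maximal cells of level \<open>k\<close>; the function \<open>g\<^sub>0\<close> is bounded by
a multiple of \<open>\<lambda>\<close> (\<open>calderon_zygmund_telescoping\<close>). For \<open>\<lambda> = 2\<^sup>j\<^sup>+\<^sup>1\<close> this bounds \<open>K(t, f)\<close> by a multiple
of \<open>\<Phi>\<^sub>j + 2\<^sup>j t\<close>, where \<open>\<Phi>\<^sub>j\<close> is the sum over \<open>i \<ge> 0\<close> of the integrals of \<open>|f|\<close> over \<open>|f| > 2\<^sup>j\<^sup>+\<^sup>i\<close>
(\<open>K_le_upper_masses\<close>). Choosing \<open>j\<close> for each \<open>t\<close> and summing geometric series gives the estimate
(\<open>interp_integral_le_Lp\<close>).

\<^emph>\<open>From the interpolation space to \<open>L\<^sup>q\<close>.\<close> If \<open>f = h + g\<close>, the mean oscillation of \<open>f\<close> over a cell is at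
most twice the mean of \<open>|h|\<close> plus the norm of \<open>g\<close> in \<open>BMO\<close>. By the weak type estimate for \<open>h\<close>, the set
where the sharp maximal function of \<open>f\<close> exceeds \<open>\<gamma> 2\<^sup>k\<close> has measure greater than \<open>2 t\<close> only if
\<open>K(t, f) / t\<close> is of order at least \<open>2\<^sup>k\<close>. A good-lambda inequality inside one cell then bounds the
\<open>L\<^sup>q\<close> oscillation of \<open>f\<close> over that cell by the interpolation integral, uniformly in the cell
(\<open>box_oscillation_le_interp\<close>). When the cells exhaust the part of the group over an orthant, the means of
\<open>f\<close> converge, and \<open>f\<close> minus their limit belongs to \<open>L\<^sup>q\<close> of that part (\<open>orthant_constant\<close>). Functions that
are constant over each orthant have vanishing \<open>BMO\<close> seminorm, so \<open>f\<close> has a representative in \<open>L\<^sup>q\<close>.\<close>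


section \<open>Stopping times in dyadic filtrations\<close>

text \<open>The sets \<open>cell n x\<close> form generation \<open>n\<close>, a partition of \<open>\<Omega>\<close> that refines the previous one. The
condition \<open>cell_regular\<close> keeps what outer regularity by open sets \<open>U\<close> provides when the cells around each
point shrink to it.\<close>

locale dyadic_filtration =
  fixes M :: "'a measure" and \<Omega> :: "'a set" and cell :: "nat \<Rightarrow> 'a \<Rightarrow> 'a set" and N :: real
  assumes cell_sets: "x \<in> \<Omega> \<Longrightarrow> cell n x \<in> sets M"
    and cell_finite: "x \<in> \<Omega> \<Longrightarrow> emeasure M (cell n x) < \<infinity>"
    and cell_pos: "x \<in> \<Omega> \<Longrightarrow> 0 < measure M (cell n x)"
    and cell_self: "x \<in> \<Omega> \<Longrightarrow> x \<in> cell n x"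
    and cell_subset: "x \<in> \<Omega> \<Longrightarrow> cell n x \<subseteq> \<Omega>"
    and cell_eq: "x \<in> \<Omega> \<Longrightarrow> y \<in> cell n x \<Longrightarrow> cell n y = cell n x"
    and cell_Suc: "x \<in> \<Omega> \<Longrightarrow> cell (Suc n) x \<subseteq> cell n x"
    and countable_cells: "countable (cell n ` \<Omega>)"
    and cell_ratio: "x \<in> \<Omega> \<Longrightarrow> measure M (cell n x) \<le> N * measure M (cell (Suc n) x)"
    and cell_regular: "x \<in> \<Omega> \<Longrightarrow> A \<in> sets M \<Longrightarrow> A \<subseteq> cell 0 x \<Longrightarrow> 0 < e \<Longrightarrow>
      \<exists>U\<in>sets M. A \<subseteq> U \<and> emeasure M U \<le> emeasure M A + ennreal e \<and> (\<forall>y\<in>A. \<exists>n. cell n y \<subseteq> U)"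
begin

text \<open>A property \<open>P\<close> of cells is read as a stopping rule: descend through the cells around \<open>x\<close> and stop at the
first one with \<open>P\<close>. That cell is \<open>stop P x\<close>, and \<open>reach P\<close> is where the descent stops.\<close>

definition reach :: "('a set \<Rightarrow> bool) \<Rightarrow> 'a set" where
  "reach P = {x \<in> \<Omega>. \<exists>n. P (cell n x)}"

definition stop :: "('a set \<Rightarrow> bool) \<Rightarrow> 'a \<Rightarrow> 'a set" where
  "stop P x = cell (LEAST n. P (cell n x)) x"

lemma emeasure_cell: "x \<in> \<Omega> \<Longrightarrow> emeasure M (cell n x) = ennreal (measure M (cell n x))"
  using cell_finite[of x n] by (intro emeasure_eq_ennreal_measure) auto

lemma cell_antimono:
  assumes "x \<in> \<Omega>" and "m \<le> n"
  shows "cell n x \<subseteq> cell m x"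
  using assms(2)
proof (induction n rule: dec_induct)
  case (step n)
  then show ?case using cell_Suc[OF assms(1), of n] by blast
qed simp

lemma cell_eq_le: "x \<in> \<Omega> \<Longrightarrow> y \<in> cell n x \<Longrightarrow> m \<le> n \<Longrightarrow> cell m y = cell m x"
  using cell_antimono cell_eq by blast

lemma reachI: "x \<in> \<Omega> \<Longrightarrow> P (cell n x) \<Longrightarrow> x \<in> reach P"
  by (auto simp: reach_def)

lemma reach_subset: "reach P \<subseteq> \<Omega>"
  by (auto simp: reach_def)

lemma stop_cases:
  assumes "x \<in> reach P"
  obtains n where "stop P x = cell n x" "P (cell n x)" "\<forall>m<n. \<not> P (cell m x)"
proof -
  let ?n = "LEAST n. P (cell n x)"
  have "stop P x = cell ?n x" by (simp add: stop_def)
  moreover have "P (cell ?n x)" using assms unfolding reach_def by (auto intro: LeastI)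
  moreover have "\<forall>m<?n. \<not> P (cell m x)" using not_less_Least by blast
  ultimately show ?thesis using that by blast
qed

text \<open>All points of a stopping cell share the cells of the earlier generations, hence the moment of
stopping. So the stopping cells form a partition of \<open>reach P\<close>.\<close>

lemma stop_eq:
  assumes x: "x \<in> reach P" and y: "y \<in> stop P x"
  shows "y \<in> reach P" "stop P y = stop P x"
proof -
  have xO: "x \<in> \<Omega>" using x by (auto simp: reach_def)
  obtain n where n: "stop P x = cell n x" "P (cell n x)" "\<forall>m<n. \<not> P (cell m x)"
    using stop_cases[OF x] .
  have yO: "y \<in> \<Omega>" using y n(1) cell_subset[OF xO] by auto
  have e: "cell m y = cell m x" if "m \<le> n" for m
    using cell_eq_le[OF xO _ that] y n(1) by auto
  show "y \<in> reach P" using n(2) e[of n] yO by (auto intro: reachI[of _ _ n])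
  have "(LEAST m. P (cell m y)) = n"
    using n(2,3) e by (intro Least_equality) (auto simp: not_less[symmetric])
  then show "stop P y = stop P x" by (simp add: stop_def[of P y] n(1) e)
qed

lemma stop_self: "x \<in> reach P \<Longrightarrow> x \<in> stop P x"
  unfolding stop_def by (intro cell_self) (auto simp: reach_def)

lemma stop_subset: "x \<in> reach P \<Longrightarrow> stop P x \<subseteq> reach P"
  using stop_eq by blast

lemma stop_holds: "x \<in> reach P \<Longrightarrow> P (stop P x)"
  using stop_cases by metis

lemma stop_sets [measurable]: "x \<in> reach P \<Longrightarrow> stop P x \<in> sets M"
  unfolding stop_def by (intro cell_sets) (auto simp: reach_def)

lemma stop_cell: "x \<in> reach P \<Longrightarrow> \<exists>n. stop P x = cell n x"
  using stop_cases by metis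

lemma countable_stop: "countable (stop P ` reach P)"
proof (rule countable_subset)
  show "stop P ` reach P \<subseteq> (\<Union>n. cell n ` \<Omega>)" using reach_subset by (auto simp: stop_def)
  show "countable (\<Union>n. cell n ` \<Omega>)" by (intro countable_UN countable_cells) auto
qed

lemma reach_UN: "reach P = \<Union>(stop P ` reach P)"
  using stop_self stop_subset by blast

lemma disjoint_stop: "disjoint_family_on (\<lambda>R. R) (stop P ` reach P)"
  unfolding disjoint_family_on_def
proof (intro ballI impI)
  fix R T assume RT: "R \<in> stop P ` reach P" "T \<in> stop P ` reach P" "R \<noteq> T"
  then obtain x y where "x \<in> reach P" "y \<in> reach P" "R = stop P x" "T = stop P y" by blast
  then show "R \<inter> T = {}" using stop_eq(2)[of x P] stop_eq(2)[of y P] RT(3) by blast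
qed

lemma reach_sets [measurable]: "reach P \<in> sets M"
proof -
  have "\<Union>(stop P ` reach P) \<in> sets M"
    by (intro sets.countable_Union countable_stop) (auto intro: stop_sets)
  then show ?thesis using reach_UN[of P] by simp
qed

lemma nn_integral_reach:
  assumes [measurable]: "G \<in> borel_measurable M"
  shows "(\<integral>\<^sup>+x\<in>reach P. G x \<partial>M) = (\<integral>\<^sup>+R. (\<integral>\<^sup>+x\<in>R. G x \<partial>M) \<partial>count_space (stop P ` reach P))"
proof -
  have "(\<integral>\<^sup>+x\<in>reach P. G x \<partial>M) = emeasure (density M G) (\<Union>R\<in>stop P ` reach P. R)"
    using reach_UN[of P] by (simp add: emeasure_density)
  also have "\<dots> = (\<integral>\<^sup>+R. emeasure (density M G) R \<partial>count_space (stop P ` reach P))"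
    using countable_stop disjoint_stop by (intro emeasure_UN_countable) auto
  also have "\<dots> = (\<integral>\<^sup>+R. (\<integral>\<^sup>+x\<in>R. G x \<partial>M) \<partial>count_space (stop P ` reach P))"
    by (intro nn_integral_cong) (auto simp: emeasure_density)
  finally show ?thesis .
qed

text \<open>Stopping time arguments use the partition in this form: an inequality is checked on each
stopping cell and summed.\<close>

lemma nn_integral_reach_mono:
  assumes "G \<in> borel_measurable M" "H \<in> borel_measurable M"
    and "\<And>x. x \<in> reach P \<Longrightarrow> (\<integral>\<^sup>+y\<in>stop P x. G y \<partial>M) \<le> (\<integral>\<^sup>+y\<in>stop P x. H y \<partial>M)"
  shows "(\<integral>\<^sup>+x\<in>reach P. G x \<partial>M) \<le> (\<integral>\<^sup>+x\<in>reach P. H x \<partial>M)"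
  unfolding nn_integral_reach[OF assms(1)] nn_integral_reach[OF assms(2)]
proof (rule nn_integral_mono)
  fix R assume "R \<in> space (count_space (stop P ` reach P))"
  then obtain x where "x \<in> reach P" "R = stop P x" by auto
  then show "(\<integral>\<^sup>+y\<in>R. G y \<partial>M) \<le> (\<integral>\<^sup>+y\<in>R. H y \<partial>M)" using assms(3) by simp
qed

text \<open>This takes the place of the differentiation theorem. For \<open>A \<subseteq> E\<close> take \<open>U\<close> from regularity and
stop at the first cell that lies in \<open>U\<close> and meets \<open>E\<close>. The stopping cells cover \<open>A\<close>, so the integral of \<open>G\<close> over
\<open>A\<close> is at most \<open>l\<close> times the measure of \<open>U\<close>, hence at most \<open>l\<close> times that of \<open>A\<close>. For \<open>A = {G > l} \<inter> E\<close> this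
forces measure zero.\<close>

lemma AE_le_of_cell_averages:
  fixes G :: "'a \<Rightarrow> ennreal"
  assumes [measurable]: "G \<in> borel_measurable M" "E \<in> sets M" and "E \<subseteq> \<Omega>"
    and avg: "\<And>x n. x \<in> E \<Longrightarrow> (\<integral>\<^sup>+y\<in>cell n x. G y \<partial>M) \<le> ennreal l * emeasure M (cell n x)"
  shows "AE x in M. x \<in> E \<longrightarrow> G x \<le> ennreal l"
proof -
  have le: "(\<integral>\<^sup>+y\<in>A. G y \<partial>M) \<le> ennreal l * emeasure M A"
    if A: "A \<in> sets M" "A \<subseteq> E" "A \<subseteq> cell 0 x" and x: "x \<in> \<Omega>" for A x
  proof (rule ennreal_le_epsilon)
    fix e :: real assume e: "0 < e"
    have "0 < e / (1 + \<bar>l\<bar>)" using e by (simp add: add_pos_nonneg)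
    then obtain U where U: "U \<in> sets M" "A \<subseteq> U" and Ue: "emeasure M U \<le> emeasure M A + ennreal (e / (1 + \<bar>l\<bar>))"
      and Uc: "\<forall>y\<in>A. \<exists>n. cell n y \<subseteq> U"
      using cell_regular[OF x A(1,3)] by meson
    \<comment> \<open>Meeting \<open>E\<close> makes the bound on the averages available on each stopping cell.\<close>
    define P where "P R \<longleftrightarrow> R \<subseteq> U \<and> R \<inter> E \<noteq> {}" for R
    have sub: "A \<subseteq> reach P"
    proof
      fix y assume y: "y \<in> A"
      then have yO: "y \<in> \<Omega>" "y \<in> E" using A assms(3) by auto
      obtain n where "cell n y \<subseteq> U" using Uc y by blast
      then show "y \<in> reach P" using cell_self[OF yO(1), of n] yO by (intro reachI[of _ _ n]) (auto simp: P_def)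
    qed
    have rU: "reach P \<subseteq> U" using stop_self stop_holds[of _ P] by (auto simp: P_def)
    have "(\<integral>\<^sup>+y\<in>A. G y \<partial>M) \<le> (\<integral>\<^sup>+y\<in>reach P. G y \<partial>M)"
      using sub by (intro nn_integral_mono) (auto split: split_indicator)
    also have "\<dots> \<le> (\<integral>\<^sup>+y\<in>reach P. ennreal l \<partial>M)"
    proof (rule nn_integral_reach_mono)
      fix y assume y: "y \<in> reach P"
      then have "stop P y \<inter> E \<noteq> {}" using stop_holds[OF y] by (simp add: P_def)
      then obtain z where z: "z \<in> stop P y" "z \<in> E" by blast
      have zr: "z \<in> reach P" "stop P z = stop P y" using stop_eq[OF y z(1)] .
      obtain n where "stop P z = cell n z" using stop_cell[OF zr(1)] by blast
      then show "(\<integral>\<^sup>+x\<in>stop P y. G x \<partial>M) \<le> (\<integral>\<^sup>+x\<in>stop P y. ennreal l \<partial>M)"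
        using avg[OF z(2), of n] zr(2) stop_sets[OF y] by (simp add: nn_integral_cmult_indicator)
    qed auto
    also have "\<dots> = ennreal l * emeasure M (reach P)" by (simp add: nn_integral_cmult_indicator)
    also have "\<dots> \<le> ennreal l * (emeasure M A + ennreal (e / (1 + \<bar>l\<bar>)))"
      using emeasure_mono[OF rU U(1)] Ue by (intro mult_left_mono) auto
    also have "\<dots> \<le> ennreal l * emeasure M A + ennreal e"
    proof -
      have "ennreal l * ennreal (e / (1 + \<bar>l\<bar>)) \<le> ennreal e"
      proof (cases "l \<ge> 0")
        case True
        have "l * (e / (1 + \<bar>l\<bar>)) \<le> e" using True e by (simp add: field_simps)
        then show ?thesis using True e by (simp flip: ennreal_mult)
      next
        case False
        then show ?thesis by (simp add: ennreal_neg)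
      qed
      then show ?thesis unfolding distrib_left by (intro add_left_mono)
    qed
    finally show "(\<integral>\<^sup>+y\<in>A. G y \<partial>M) \<le> ennreal l * emeasure M A + ennreal e" .
  qed
  have ae: "AE x in M. x \<in> R \<longrightarrow> x \<in> E \<longrightarrow> G x \<le> ennreal l" if "R \<in> cell 0 ` \<Omega>" for R
  proof -
    from that obtain x where x: "x \<in> \<Omega>" "R = cell 0 x" by auto
    have [measurable]: "R \<in> sets M" using x cell_sets by auto
    define A where "A = {y \<in> space M. G y > ennreal l} \<inter> E \<inter> R"
    have A [measurable]: "A \<in> sets M" unfolding A_def by measurable
    have fin: "emeasure M A < \<infinity>"
      using emeasure_mono[of A "cell 0 x" M] cell_sets[OF x(1), of 0] cell_finite[OF x(1), of 0] x
      by (auto simp: A_def intro: order.strict_trans1)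
    then have fl: "(\<integral>\<^sup>+y. ennreal l * indicator A y \<partial>M) < \<infinity>"
      by (simp add: nn_integral_cmult_indicator ennreal_mult_less_top)
    have "A \<subseteq> E" "A \<subseteq> cell 0 x" using x(2) by (auto simp: A_def)
    from le[OF A this x(1)] have leA: "(\<integral>\<^sup>+y\<in>A. G y \<partial>M) \<le> (\<integral>\<^sup>+y. ennreal l * indicator A y \<partial>M)"
      by (simp add: nn_integral_cmult_indicator)
    have "(\<integral>\<^sup>+y. G y * indicator A y - ennreal l * indicator A y \<partial>M)
        = (\<integral>\<^sup>+y\<in>A. G y \<partial>M) - (\<integral>\<^sup>+y. ennreal l * indicator A y \<partial>M)"
      using fl by (intro nn_integral_diff) (auto simp: A_def split: split_indicator)
    also have "\<dots> = 0"
      using leA fl by (intro diff_eq_0_ennreal) auto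
    finally have "AE y in M. G y * indicator A y - ennreal l * indicator A y = 0"
      by (subst (asm) nn_integral_0_iff_AE) auto
    then show ?thesis
    proof (rule AE_mp, intro AE_I2 impI)
      fix y assume y: "y \<in> space M" "G y * indicator A y - ennreal l * indicator A y = 0" "y \<in> R" "y \<in> E"
      show "G y \<le> ennreal l"
      proof (rule ccontr)
        assume "\<not> G y \<le> ennreal l"
        then have lt: "ennreal l < G y" by simp
        then have "y \<in> A" using y by (auto simp: A_def)
        then have "G y - ennreal l = 0" using y(2) by simp
        then have "G y \<le> ennreal l" using ennreal_minus_eq_0 by blast
        then show False using lt by simp
      qed
    qed
  qed
  have "AE x in M. \<forall>R\<in>cell 0 ` \<Omega>. x \<in> R \<longrightarrow> x \<in> E \<longrightarrow> G x \<le> ennreal l"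
    using ae by (subst AE_ball_countable[OF countable_cells]) auto
  then show ?thesis
    by (rule AE_mp) (use \<open>E \<subseteq> \<Omega>\<close> cell_self in \<open>auto intro!: AE_I2\<close>)
qed

lemma Omega_sets [measurable]: "\<Omega> \<in> sets M"
proof -
  have "\<Union>(cell 0 ` \<Omega>) \<in> sets M"
    by (intro sets.countable_Union countable_cells) (auto intro: cell_sets)
  also have "\<Union>(cell 0 ` \<Omega>) = \<Omega>" using cell_self cell_subset by blast
  finally show ?thesis .
qed

lemma N_ge_1:
  assumes "x \<in> \<Omega>"
  shows "1 \<le> N"
proof -
  have "measure M (cell 1 x) \<le> measure M (cell 0 x)"
    using cell_Suc[OF assms, of 0] cell_sets[OF assms] cell_finite[OF assms, of 0]
    by (intro measure_mono_fmeasurable) (auto simp: fmeasurable_def)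
  also have "\<dots> \<le> N * measure M (cell 1 x)" using cell_ratio[OF assms, of 0] by simp
  finally have "1 * measure M (cell 1 x) \<le> N * measure M (cell 1 x)" by simp
  then show ?thesis using cell_pos[OF assms, of 1] by (subst (asm) mult_le_cancel_right) auto
qed

text \<open>\<open>reach (big F l)\<close> is the set where the maximal function of \<open>F\<close> exceeds \<open>l\<close>.\<close>

definition big :: "('a \<Rightarrow> ennreal) \<Rightarrow> real \<Rightarrow> 'a set \<Rightarrow> bool" where
  "big F l R \<longleftrightarrow> ennreal l * emeasure M R < (\<integral>\<^sup>+y\<in>R. F y \<partial>M)"

lemma big_antimono: "a \<le> b \<Longrightarrow> big F b R \<Longrightarrow> big F a R"
  unfolding big_def
  by (meson ennreal_leI le_less_trans mult_right_mono zero_le)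

lemma weak_type:
  assumes [measurable]: "F \<in> borel_measurable M"
  shows "ennreal l * emeasure M (reach (big F l)) \<le> (\<integral>\<^sup>+y\<in>reach (big F l). F y \<partial>M)"
proof -
  have "ennreal l * emeasure M (reach (big F l)) = (\<integral>\<^sup>+y\<in>reach (big F l). ennreal l \<partial>M)"
    by (simp add: nn_integral_cmult_indicator)
  also have "\<dots> \<le> (\<integral>\<^sup>+y\<in>reach (big F l). F y \<partial>M)"
  proof (rule nn_integral_reach_mono)
    fix x assume x: "x \<in> reach (big F l)"
    then show "(\<integral>\<^sup>+y\<in>stop (big F l) x. ennreal l \<partial>M) \<le> (\<integral>\<^sup>+y\<in>stop (big F l) x. F y \<partial>M)"
      using stop_holds[OF x] stop_sets[OF x] by (simp add: big_def nn_integral_cmult_indicator)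
  qed auto
  finally show ?thesis .
qed

text \<open>On a cell where \<open>F\<close> has mean above \<open>2 l\<close>, the values up to \<open>l\<close> account for a mean of at most
\<open>l\<close>.\<close>

lemma weak_type_truncated:
  assumes [measurable]: "F \<in> borel_measurable M" and l: "0 \<le> l"
  shows "ennreal l * emeasure M (reach (big F (2 * l))) \<le> (\<integral>\<^sup>+y. F y * indicator {y. ennreal l < F y} y \<partial>M)"
proof -
  let ?G = "\<lambda>y. F y * indicator {y. ennreal l < F y} y"
  have l2: "ennreal (2 * l) = ennreal l + ennreal l" using l by (simp flip: ennreal_plus)
  have [measurable]: "?G \<in> borel_measurable M" by measurable
  have "reach (big F (2 * l)) \<subseteq> reach (big ?G l)"
  proof
    fix x assume "x \<in> reach (big F (2 * l))"
    then obtain n where x: "x \<in> \<Omega>" and n: "big F (2 * l) (cell n x)" by (auto simp: reach_def)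
    let ?R = "cell n x"
    have [measurable]: "?R \<in> sets M" using cell_sets[OF x] .
    have "ennreal l * emeasure M ?R + ennreal l * emeasure M ?R = ennreal (2 * l) * emeasure M ?R"
      unfolding l2 distrib_right ..
    also have "\<dots> < (\<integral>\<^sup>+y\<in>?R. F y \<partial>M)" using n by (simp add: big_def)
    also have "\<dots> \<le> (\<integral>\<^sup>+y. ?G y * indicator ?R y + ennreal l * indicator ?R y \<partial>M)"
    proof (rule nn_integral_mono)
      fix y
      show "F y * indicator ?R y \<le> ?G y * indicator ?R y + ennreal l * indicator ?R y"
        by (cases "ennreal l < F y") (simp_all add: indicator_def not_less)
    qed
    also have "\<dots> = (\<integral>\<^sup>+y\<in>?R. ?G y \<partial>M) + ennreal l * emeasure M ?R"
      by (subst nn_integral_add) (auto simp: nn_integral_cmult_indicator)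
    finally have "big ?G l ?R"
      unfolding big_def by (meson add_right_mono leD not_le)
    then show "x \<in> reach (big ?G l)" using x by (auto intro: reachI)
  qed
  then have "ennreal l * emeasure M (reach (big F (2 * l))) \<le> ennreal l * emeasure M (reach (big ?G l))"
    by (intro mult_left_mono emeasure_mono) auto
  also have "\<dots> \<le> (\<integral>\<^sup>+y\<in>reach (big ?G l). ?G y \<partial>M)" by (rule weak_type) measurable
  also have "\<dots> \<le> (\<integral>\<^sup>+y. ?G y \<partial>M)"
    by (intro nn_integral_mono) (auto split: split_indicator)
  finally show ?thesis .
qed

lemma AE_le_outside_reach:
  assumes [measurable]: "F \<in> borel_measurable M"
  shows "AE x in M. x \<in> \<Omega> - reach (big F l) \<longrightarrow> F x \<le> ennreal l"
proof (rule AE_le_of_cell_averages)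
  fix x n assume "x \<in> \<Omega> - reach (big F l)"
  then show "(\<integral>\<^sup>+y\<in>cell n x. F y \<partial>M) \<le> ennreal l * emeasure M (cell n x)"
    by (auto simp: reach_def big_def not_less)
qed auto

text \<open>The cell before the stopping cell was not yet \<open>big\<close>, and it is at most \<open>N\<close> times larger.\<close>

lemma stop_upper:
  assumes [measurable]: "F \<in> borel_measurable M" and x: "x \<in> reach (big F l)"
    and "\<not> big F l (cell 0 x)" and l: "0 \<le> l"
  shows "(\<integral>\<^sup>+y\<in>stop (big F l) x. F y \<partial>M) \<le> ennreal (N * l) * emeasure M (stop (big F l) x)"
proof -
  have xO: "x \<in> \<Omega>" using x by (auto simp: reach_def)
  obtain n where n: "stop (big F l) x = cell n x" "big F l (cell n x)" "\<forall>m<n. \<not> big F l (cell m x)"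
    using stop_cases[OF x] .
  obtain m where m: "n = Suc m" using n(2) assms(3) by (cases n) auto
  have "(\<integral>\<^sup>+y\<in>cell n x. F y \<partial>M) \<le> (\<integral>\<^sup>+y\<in>cell m x. F y \<partial>M)"
    using cell_Suc[OF xO, of m] m by (intro nn_integral_mono) (auto split: split_indicator)
  also have "\<dots> \<le> ennreal l * emeasure M (cell m x)"
    using n(3) m by (auto simp: big_def not_less)
  also have "\<dots> \<le> ennreal (N * l) * emeasure M (cell n x)"
    using mult_left_mono[OF cell_ratio[OF xO, of m] l] N_ge_1[OF xO] l
    by (auto simp: emeasure_cell[OF xO] m mult_ac simp flip: ennreal_mult intro!: ennreal_leI)
  finally show ?thesis by (simp add: n(1))
qed

definition mean :: "('a \<Rightarrow> complex) \<Rightarrow> 'a set \<Rightarrow> complex" where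
  "mean f R = (LINT z:R|M. f z) /\<^sub>R measure M R"

definition dev :: "('a \<Rightarrow> complex) \<Rightarrow> 'a set \<Rightarrow> ennreal" where
  "dev f R = (\<integral>\<^sup>+z\<in>R. ennreal (cmod (f z - mean f R)) \<partial>M)"

text \<open>\<open>reach (osc f l)\<close> is the set where the sharp maximal function of \<open>f\<close> exceeds \<open>l\<close>.\<close>

definition osc :: "('a \<Rightarrow> complex) \<Rightarrow> real \<Rightarrow> 'a set \<Rightarrow> bool" where
  "osc f l R \<longleftrightarrow> ennreal l * emeasure M R < dev f R"

lemma mean_diff_le:
  assumes "set_integrable M (cell n x) f" and x: "x \<in> \<Omega>"
  shows "ennreal (cmod (mean f (cell n x) - c)) * emeasure M (cell n x)
    \<le> (\<integral>\<^sup>+z\<in>cell n x. ennreal (cmod (f z - c)) \<partial>M)"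
proof -
  let ?R = "cell n x"
  have R [measurable]: "?R \<in> sets M" using cell_sets[OF x] .
  have ci: "set_integrable M ?R (\<lambda>z. c)"
    using cell_finite[OF x, of n] R by (simp add: set_integrable_def)
  have "measure M ?R *\<^sub>R (mean f ?R - c) = (LINT z:?R|M. f z) - measure M ?R *\<^sub>R c"
    using cell_pos[OF x, of n] by (simp add: mean_def scaleR_diff_right)
  also have "\<dots> = (LINT z:?R|M. f z - c)"
    using cell_finite[OF x, of n] R
    by (subst set_integral_diff(2)[OF assms(1) ci]) (simp add: set_lebesgue_integral_def)
  finally have e: "measure M ?R * cmod (mean f ?R - c) = cmod (LINT z:?R|M. f z - c)"
    by (metis abs_of_nonneg measure_nonneg norm_scaleR)
  have "ennreal (cmod (mean f ?R - c)) * emeasure M ?R = ennreal (cmod (LINT z:?R|M. f z - c))"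
    unfolding e[symmetric] emeasure_cell[OF x] by (simp add: mult.commute flip: ennreal_mult)
  also have "\<dots> \<le> (\<integral>\<^sup>+z. ennreal (cmod (indicator ?R z *\<^sub>R (f z - c))) \<partial>M)"
    using set_integral_diff(1)[OF assms(1) ci] unfolding set_lebesgue_integral_def set_integrable_def
    by (rule integral_norm_bound_ennreal)
  also have "\<dots> = (\<integral>\<^sup>+z\<in>?R. ennreal (cmod (f z - c)) \<partial>M)"
    by (intro nn_integral_cong) (auto split: split_indicator)
  finally show ?thesis .
qed

text \<open>Let \<open>R\<close> be a stopping cell at height \<open>a\<close> for \<open>F = |f - mean f \<Omega>|\<close>. Then \<open>mean f R\<close> differs from
\<open>mean f \<Omega>\<close> by at most \<open>N a\<close>, so that at the points of \<open>R\<close> where the maximal function of \<open>F\<close> exceeds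
\<open>(N + 1) a\<close>, the maximal function of \<open>|f - mean f R|\<close> restricted to \<open>R\<close> exceeds \<open>a\<close>. By the weak type
estimate these points have measure at most \<open>dev f R / a\<close>. Either this is at most \<open>g\<close> times the measure of
\<open>R\<close>, or \<open>R\<close> lies in the set counted by the second term.\<close>

lemma good_lambda:
  assumes f [measurable]: "f \<in> borel_measurable M" and fi: "set_integrable M \<Omega> f"
    and root: "\<And>x. x \<in> \<Omega> \<Longrightarrow> cell 0 x = \<Omega>"
    and a: "0 < a" and g: "0 < g" and b: "(N + 1) * a \<le> b"
  defines "F \<equiv> \<lambda>x. ennreal (cmod (f x - mean f \<Omega>))"
  shows "emeasure M (reach (big F b)) \<le> ennreal g * emeasure M (reach (big F a)) + emeasure M (reach (osc f (g * a)))"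
proof (cases "\<Omega> = {}")
  case True
  then have "reach P = {}" for P using reach_subset[of P] by blast
  then show ?thesis by simp
next
  case False
  then obtain x0 where "x0 \<in> \<Omega>" by auto
  then have N: "1 \<le> N" by (rule N_ge_1)
  then have "1 * a \<le> (N + 1) * a" using a by (intro mult_right_mono) auto
  then have ab: "a \<le> b" using b by simp
  have F [measurable]: "F \<in> borel_measurable M" unfolding F_def by measurable
  let ?O = "reach (big F a)" and ?O' = "reach (big F b)" and ?W = "reach (osc f (g * a))"
  have sub: "?O' \<subseteq> ?O" using big_antimono[OF ab] by (auto simp: reach_def)
  have "emeasure M ?O' = (\<integral>\<^sup>+y\<in>?O. indicator ?O' y \<partial>M)"
    using sub by (simp add: indicator_inter_arith[symmetric] Int_absorb1 inf.absorb1 inf_commute)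
  also have "\<dots> \<le> (\<integral>\<^sup>+y\<in>?O. ennreal g + indicator ?W y \<partial>M)"
  proof (rule nn_integral_reach_mono)
    fix x assume x: "x \<in> ?O"
    then have xO: "x \<in> \<Omega>" by (auto simp: reach_def)
    obtain n where n: "stop (big F a) x = cell n x" "big F a (cell n x)" "\<forall>m<n. \<not> big F a (cell m x)"
      using stop_cases[OF x] .
    let ?R = "cell n x"
    have R [measurable]: "?R \<in> sets M" using cell_sets[OF xO] .
    have fR: "set_integrable M ?R f" by (rule set_integrable_subset[OF fi R cell_subset[OF xO]])
    have "(\<integral>\<^sup>+y\<in>?R. indicator ?O' y \<partial>M) \<le> (\<integral>\<^sup>+y\<in>?R. ennreal g + indicator ?W y \<partial>M)"
    proof (cases "osc f (g * a) ?R")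
      case True
      have "?R \<subseteq> ?W"
      proof
        fix y assume y: "y \<in> ?R"
        then show "y \<in> ?W" using True cell_eq[OF xO y] cell_subset[OF xO, of n] by (intro reachI[of _ _ n]) auto
      qed
      then show ?thesis by (intro nn_integral_mono) (auto split: split_indicator)
    next
      case False
      let ?G = "\<lambda>y. ennreal (cmod (f y - mean f ?R)) * indicator ?R y"
      have close: "cmod (mean f ?R - mean f \<Omega>) \<le> N * a"
      proof (cases "big F a (cell 0 x)")
        case True
        then have "n = 0" using n(3) by (cases n) auto
        then show ?thesis using root[OF xO] N a by simp
      next
        case False
        have "ennreal (cmod (mean f ?R - mean f \<Omega>)) * emeasure M ?R \<le> (\<integral>\<^sup>+z\<in>?R. F z \<partial>M)"
          unfolding F_def by (rule mean_diff_le[OF fR xO])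
        also have "\<dots> \<le> ennreal (N * a) * emeasure M ?R"
          using stop_upper[OF F x False] a by (simp add: n(1))
        finally have "cmod (mean f ?R - mean f \<Omega>) * measure M ?R \<le> N * a * measure M ?R"
          using N a by (simp add: emeasure_cell[OF xO] flip: ennreal_mult)
        then show ?thesis using cell_pos[OF xO, of n] by simp
      qed
      have sub2: "?R \<inter> ?O' \<subseteq> reach (big ?G a)"
      proof
        fix y assume y: "y \<in> ?R \<inter> ?O'"
        then obtain m where yO: "y \<in> \<Omega>" and m: "big F b (cell m y)" by (auto simp: reach_def)
        have "n \<le> m"
        proof (rule ccontr)
          assume "\<not> n \<le> m"
          then have "cell m y = cell m x" using y by (intro cell_eq_le[OF xO, of y n]) auto
          then show False using big_antimono[OF ab m] n(3) \<open>\<not> n \<le> m\<close> by auto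
        qed
        then have sR: "cell m y \<subseteq> ?R" using cell_antimono[OF yO \<open>n \<le> m\<close>] cell_eq[OF xO, of y n] y by auto
        have [measurable]: "cell m y \<in> sets M" using cell_sets[OF yO] .
        have "big ?G a (cell m y)"
        proof (rule ccontr)
          assume "\<not> big ?G a (cell m y)"
          then have le: "(\<integral>\<^sup>+z\<in>cell m y. ?G z \<partial>M) \<le> ennreal a * emeasure M (cell m y)" by (simp add: big_def not_less)
          have "(\<integral>\<^sup>+z\<in>cell m y. F z \<partial>M) \<le> (\<integral>\<^sup>+z. ?G z * indicator (cell m y) z + ennreal (N * a) * indicator (cell m y) z \<partial>M)"
          proof (rule nn_integral_mono)
            fix z
            have "cmod (f z - mean f \<Omega>) \<le> cmod (f z - mean f ?R) + cmod (mean f ?R - mean f \<Omega>)"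
              by (metis diff_add_cancel norm_triangle_ineq add_diff_eq diff_add_eq)
            then have "cmod (f z - mean f \<Omega>) \<le> cmod (f z - mean f ?R) + N * a" using close by simp
            then have "F z \<le> ennreal (cmod (f z - mean f ?R)) + ennreal (N * a)"
              unfolding F_def using N a by (simp flip: ennreal_plus add: ennreal_leI)
            then show "F z * indicator (cell m y) z \<le> ?G z * indicator (cell m y) z + ennreal (N * a) * indicator (cell m y) z"
              using sR by (auto split: split_indicator)
          qed
          also have "\<dots> = (\<integral>\<^sup>+z\<in>cell m y. ?G z \<partial>M) + ennreal (N * a) * emeasure M (cell m y)"
            by (subst nn_integral_add) (auto simp: nn_integral_cmult_indicator)
          also have "\<dots> \<le> ennreal a * emeasure M (cell m y) + ennreal (N * a) * emeasure M (cell m y)"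
            using le by (intro add_right_mono)
          also have "\<dots> = ennreal ((N + 1) * a) * emeasure M (cell m y)"
            using N a by (simp add: distrib_right[symmetric] flip: ennreal_plus) (simp add: algebra_simps)
          also have "\<dots> \<le> ennreal b * emeasure M (cell m y)" using b by (intro mult_right_mono ennreal_leI) auto
          finally show False using m by (simp add: big_def)
        qed
        then show "y \<in> reach (big ?G a)" using yO by (auto intro: reachI)
      qed
      have "ennreal a * emeasure M (?R \<inter> ?O') \<le> ennreal a * emeasure M (reach (big ?G a))"
        using sub2 by (intro mult_left_mono emeasure_mono) auto
      also have "\<dots> \<le> (\<integral>\<^sup>+y\<in>reach (big ?G a). ?G y \<partial>M)" by (rule weak_type) measurable
      also have "\<dots> \<le> dev f ?R"
        unfolding dev_def by (intro nn_integral_mono) (auto split: split_indicator)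
      also have "\<dots> \<le> ennreal a * (ennreal g * emeasure M ?R)"
        using False a g by (simp add: osc_def not_less ennreal_mult mult_ac)
      finally have le: "emeasure M (?R \<inter> ?O') \<le> ennreal g * emeasure M ?R"
        using a by (simp add: ennreal_mult_le_mult_iff)
      have "(\<integral>\<^sup>+y\<in>?R. indicator ?O' y \<partial>M) = emeasure M (?R \<inter> ?O')"
        by (simp add: indicator_inter_arith[symmetric] inf_commute)
      also have "\<dots> \<le> (\<integral>\<^sup>+y\<in>?R. ennreal g \<partial>M)" using le by (simp add: nn_integral_cmult_indicator)
      also have "\<dots> \<le> (\<integral>\<^sup>+y\<in>?R. ennreal g + indicator ?W y \<partial>M)"
        by (intro nn_integral_mono) (auto split: split_indicator)
      finally show ?thesis .
    qed
    then show "(\<integral>\<^sup>+y\<in>stop (big F a) x. indicator ?O' y \<partial>M) \<le> (\<integral>\<^sup>+y\<in>stop (big F a) x. ennreal g + indicator ?W y \<partial>M)"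
      by (simp add: n(1))
  qed auto
  also have "\<dots> \<le> (\<integral>\<^sup>+y. ennreal g * indicator ?O y + indicator ?W y \<partial>M)"
    by (intro nn_integral_mono) (auto split: split_indicator)
  also have "\<dots> = ennreal g * emeasure M ?O + emeasure M ?W"
    by (subst nn_integral_add) (auto simp: nn_integral_cmult_indicator)
  finally show ?thesis .
qed

end

section \<open>The sharp maximal estimate\<close>

lemma dyadic_geometric_sum:
  assumes s: "0 < s"
  shows "(\<integral>\<^sup>+k. ennreal (2 powr (real_of_int k * s)) * indicator {..L} k \<partial>count_space UNIV)
    = ennreal (2 powr (real_of_int L * s) / (1 - 2 powr (- s)))"
proof -
  have bij: "bij_betw (\<lambda>i. L - int i) UNIV {..L}"
    by (rule bij_betwI[where g = "\<lambda>k. nat (L - k)"]) auto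
  have lt: "2 powr (- s) < 1" using powr_less_mono[of "- s" 0 2] s by simp
  have "(\<integral>\<^sup>+k. ennreal (2 powr (real_of_int k * s)) * indicator {..L} k \<partial>count_space UNIV)
      = (\<integral>\<^sup>+k. ennreal (2 powr (real_of_int k * s)) \<partial>count_space {..L})"
    by (simp add: nn_integral_count_space_indicator)
  also have "\<dots> = (\<integral>\<^sup>+i. ennreal (2 powr (real_of_int (L - int i) * s)) \<partial>count_space UNIV)"
    by (rule nn_integral_bij_count_space[OF bij, symmetric])
  also have "\<dots> = (\<Sum>i. ennreal (2 powr (real_of_int (L - int i) * s)))"
    by (rule nn_integral_count_space_nat)
  also have "\<dots> = (\<Sum>i. ennreal (2 powr (real_of_int L * s) * (2 powr (- s)) ^ i))"
    by (simp add: powr_realpow[symmetric] powr_powr powr_add[symmetric] algebra_simps flip: powr_add)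
  also have "\<dots> = ennreal (2 powr (real_of_int L * s) * (1 / (1 - 2 powr (- s))))"
    using lt by (intro suminf_ennreal_eq sums_mult geometric_sums) auto
  finally show ?thesis by simp
qed

lemma dyadic_sum_below:
  assumes s: "0 < s" and v: "0 \<le> v"
  shows "(\<integral>\<^sup>+k. ennreal (2 powr (real_of_int k * s)) * indicator {k. 2 powr real_of_int k < v} k \<partial>count_space UNIV)
    \<le> ennreal (v powr s / (1 - 2 powr (- s)))"
proof (cases "v = 0")
  case True
  have "{k :: int. 2 powr real_of_int k < v} = {}" using True by (auto simp: not_less)
  then show ?thesis by simp
next
  case False
  then have v: "0 < v" using assms by simp
  let ?L = "\<lfloor>log 2 v\<rfloor>"
  have lt: "2 powr (- s) < 1" using powr_less_mono[of "- s" 0 2] s by simp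
  have sub: "k \<le> ?L" if "2 powr real_of_int k < v" for k :: int
  proof -
    have "real_of_int k < log 2 v" using that v by (simp add: less_log_iff)
    then show ?thesis by linarith
  qed
  have "2 powr real_of_int ?L \<le> v" using v by (simp add: le_log_iff[symmetric])
  then have "(2 powr real_of_int ?L) powr s \<le> v powr s" using s by (intro powr_mono2) auto
  then have le: "2 powr (real_of_int ?L * s) \<le> v powr s" by (simp add: powr_powr)
  have "(\<integral>\<^sup>+k. ennreal (2 powr (real_of_int k * s)) * indicator {k. 2 powr real_of_int k < v} k \<partial>count_space UNIV)
      \<le> (\<integral>\<^sup>+k. ennreal (2 powr (real_of_int k * s)) * indicator {..?L} k \<partial>count_space UNIV)"
    using sub by (intro nn_integral_mono) (auto split: split_indicator)
  also have "\<dots> = ennreal (2 powr (real_of_int ?L * s) / (1 - 2 powr (- s)))"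
    by (rule dyadic_geometric_sum[OF s])
  also have "\<dots> \<le> ennreal (v powr s / (1 - 2 powr (- s)))"
    using le lt by (intro ennreal_leI divide_right_mono) auto
  finally show ?thesis .
qed

lemma dyadic_level:
  assumes "0 < v"
  obtains k :: int where "2 powr real_of_int k < v" "v \<le> 2 powr real_of_int (k + 1)"
proof
  let ?k = "\<lceil>log 2 v\<rceil> - 1"
  have "real_of_int ?k < log 2 v" "log 2 v \<le> real_of_int (?k + 1)" by linarith+
  then show "2 powr real_of_int ?k < v" "v \<le> 2 powr real_of_int (?k + 1)"
    using assms by (simp_all only: less_log_iff[of 2 v] log_le_iff[of 2 v] one_less_numeral_iff semiring_norm)
qed

lemma ennreal_absorb_half:
  fixes S X :: ennreal
  assumes "S < \<infinity>" "S \<le> ennreal (1 / 2) * S + X"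
  shows "S \<le> 2 * X"
proof (cases X)
  case (real x)
  obtain s where s: "S = ennreal s" "0 \<le> s" using assms(1) by (cases S) auto
  have "ennreal (1 / 2) * S = ennreal (1 / 2 * s)"
    unfolding s(1) using s(2) by (intro ennreal_mult[symmetric]) auto
  moreover have "ennreal (1 / 2 * s + x) = ennreal (1 / 2 * s) + ennreal x"
    using real s by (intro ennreal_plus) auto
  ultimately have "ennreal s \<le> ennreal (1 / 2 * s + x)"
    using assms(2) real(2) s(1) by metis
  then have "s \<le> 1 / 2 * s + x"
    using real s by (subst (asm) ennreal_le_iff) auto
  then have "s \<le> 2 * x" by simp
  then have "ennreal s \<le> ennreal (2 * x)" by (rule ennreal_leI)
  then show ?thesis using s real by (simp add: ennreal_mult)
qed (simp add: ennreal_mult_top)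

context dyadic_filtration
begin

text \<open>The inequality of Fefferman and Stein on a single cell. The good-lambda inequality for the heights
\<open>2\<^sup>k\<close> and \<open>2\<^sup>k\<^sup>+\<^sup>m\<close> is multiplied by the \<open>q\<close>-th power of the larger one and summed over \<open>k\<close>. The constant \<open>g\<close> is chosen so that
\<open>2\<^sup>m\<^sup>q g = 1/2\<close>, and half of the left-hand side can be absorbed. The absorbed sum has to be finite; this is
why heights are first cut off at some \<open>K\<close>, where finiteness follows from that of the measure of \<open>\<Omega>\<close>.\<close>

lemma sharp_maximal_estimate:
  assumes f [measurable]: "f \<in> borel_measurable M" and fi: "set_integrable M \<Omega> f"
    and root: "\<And>x. x \<in> \<Omega> \<Longrightarrow> cell 0 x = \<Omega>"
    and q: "0 < q" and m: "N + 1 \<le> 2 ^ m"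
  defines "g \<equiv> 2 powr (- (real m * q) - 1)"
  shows "(\<integral>\<^sup>+x\<in>\<Omega>. ennreal (cmod (f x - mean f \<Omega>) powr q) \<partial>M)
    \<le> ennreal (2 * 2 powr (q * (real m + 1))) *
      (\<integral>\<^sup>+k. ennreal (2 powr (real_of_int k * q)) * emeasure M (reach (osc f (g * 2 powr real_of_int k))) \<partial>count_space UNIV)"
proof (cases "\<Omega> = {}")
  case False
  then obtain x0 where x0: "x0 \<in> \<Omega>" by auto
  define F where "F = (\<lambda>x. ennreal (cmod (f x - mean f \<Omega>)))"
  have F [measurable]: "F \<in> borel_measurable M" unfolding F_def by measurable
  define O' where "O' k = reach (big F (2 powr real_of_int k))" for k :: int
  define w where "w k = ennreal (2 powr (real_of_int k * q)) * emeasure M (reach (osc f (g * 2 powr real_of_int k)))" for k :: int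
  define a where "a k = ennreal (2 powr (real_of_int k * q)) * emeasure M (O' k)" for k :: int
  define D where "D = ennreal (2 powr (real m * q))"
  define S where "S K = (\<integral>\<^sup>+k. a k * indicator {..K} k \<partial>count_space UNIV)" for K :: int
  have g: "0 < g" by (simp add: g_def)
  have O'_sets [measurable]: "O' k \<in> sets M" for k by (simp add: O'_def)
  have step: "a (k + int m) \<le> ennreal (1 / 2) * a k + D * w k" for k
  proof -
    have "(N + 1) * 2 powr real_of_int k \<le> 2 ^ m * 2 powr real_of_int k" using m by (intro mult_right_mono) auto
    also have "\<dots> = 2 powr real_of_int (k + int m)" by (simp add: powr_add powr_realpow)
    finally have le: "(N + 1) * 2 powr real_of_int k \<le> 2 powr real_of_int (k + int m)" .
    have "emeasure M (O' (k + int m)) \<le> ennreal g * emeasure M (O' k) + emeasure M (reach (osc f (g * 2 powr real_of_int k)))"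
      unfolding O'_def F_def by (rule good_lambda[OF f fi root _ g le]) auto
    then have "a (k + int m) \<le> ennreal (2 powr (real_of_int (k + int m) * q)) *
        (ennreal g * emeasure M (O' k) + emeasure M (reach (osc f (g * 2 powr real_of_int k))))"
      unfolding a_def by (rule mult_left_mono) simp
    also have "ennreal (2 powr (real_of_int (k + int m) * q)) = D * ennreal (2 powr (real_of_int k * q))"
      by (simp add: D_def ennreal_mult[symmetric] powr_add[symmetric] algebra_simps)
    also have "D * ennreal (2 powr (real_of_int k * q)) *
        (ennreal g * emeasure M (O' k) + emeasure M (reach (osc f (g * 2 powr real_of_int k)))) = D * ennreal g * a k + D * w k"
      by (simp add: a_def w_def algebra_simps)
    also have "D * ennreal g = ennreal (1 / 2)"
      by (simp add: D_def g_def ennreal_mult[symmetric] powr_add[symmetric] powr_minus_divide)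
    finally show ?thesis .
  qed
  have S_le: "S K \<le> 2 * (D * (\<integral>\<^sup>+k. w k \<partial>count_space UNIV))" for K
  proof (rule ennreal_absorb_half)
    have "S K \<le> (\<integral>\<^sup>+k. emeasure M \<Omega> * (ennreal (2 powr (real_of_int k * q)) * indicator {..K} k) \<partial>count_space UNIV)"
      unfolding S_def a_def O'_def
    proof (rule nn_integral_mono)
      fix k
      have "emeasure M (reach (big F (2 powr real_of_int k))) \<le> emeasure M \<Omega>"
        using reach_subset by (intro emeasure_mono) auto
      then show "ennreal (2 powr (real_of_int k * q)) * emeasure M (reach (big F (2 powr real_of_int k))) * indicator {..K} k
        \<le> emeasure M \<Omega> * (ennreal (2 powr (real_of_int k * q)) * indicator {..K} k)"
        by (cases "k \<le> K") (simp_all add: mult.commute[of "emeasure M \<Omega>"] mult_left_mono)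
    qed
    also have "\<dots> = emeasure M \<Omega> * ennreal (2 powr (real_of_int K * q) / (1 - 2 powr (- q)))"
      by (simp add: nn_integral_cmult dyadic_geometric_sum[OF q])
    also have "\<dots> < \<infinity>"
      using cell_finite[OF x0, of 0] root[OF x0] by (auto simp: ennreal_mult_less_top)
    finally show "S K < \<infinity>" .
    have "S K = (\<integral>\<^sup>+k. a (k + int m) * indicator {..K} (k + int m) \<partial>count_space UNIV)"
      unfolding S_def
      by (rule nn_integral_bij_count_space[symmetric, where g = "\<lambda>k. k + int m"])
         (rule bij_betwI[where g = "\<lambda>k. k - int m"], auto)
    also have "\<dots> \<le> (\<integral>\<^sup>+k. ennreal (1 / 2) * (a k * indicator {..K} k) + D * w k \<partial>count_space UNIV)"
    proof (rule nn_integral_mono)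
      fix k
      show "a (k + int m) * indicator {..K} (k + int m) \<le> ennreal (1 / 2) * (a k * indicator {..K} k) + D * w k"
        using step[of k] by (cases "k + int m \<le> K") (simp_all add: indicator_def)
    qed
    also have "\<dots> = ennreal (1 / 2) * S K + D * (\<integral>\<^sup>+k. w k \<partial>count_space UNIV)"
      unfolding S_def by (simp add: nn_integral_add nn_integral_cmult)
    finally show "S K \<le> ennreal (1 / 2) * S K + D * (\<integral>\<^sup>+k. w k \<partial>count_space UNIV)" .
  qed
  have "(\<integral>\<^sup>+k. a k \<partial>count_space UNIV) = (\<integral>\<^sup>+k. (SUP n. a k * indicator {..int n} k) \<partial>count_space UNIV)"
  proof (rule nn_integral_cong)
    fix k :: int
    show "a k = (SUP n. a k * indicator {..int n} k)"
    proof (rule antisym)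
      have "k \<le> int (nat \<bar>k\<bar>)" by simp
      then have "a k = a k * indicator {..int (nat \<bar>k\<bar>)} k" by simp
      also have "\<dots> \<le> (SUP n. a k * indicator {..int n} k)" by (rule SUP_upper) simp
      finally show "a k \<le> (SUP n. a k * indicator {..int n} k)" .
      show "(SUP n. a k * indicator {..int n} k) \<le> a k"
        by (rule SUP_least) (simp split: split_indicator)
    qed
  qed
  also have "\<dots> = (SUP n. S (int n))"
    unfolding S_def
    by (rule nn_integral_monotone_convergence_SUP) (auto simp: incseq_def le_fun_def split: split_indicator)
  also have "\<dots> \<le> 2 * (D * (\<integral>\<^sup>+k. w k \<partial>count_space UNIV))" by (rule SUP_least) (rule S_le)
  finally have T: "(\<integral>\<^sup>+k. a k \<partial>count_space UNIV) \<le> 2 * (D * (\<integral>\<^sup>+k. w k \<partial>count_space UNIV))" .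
  have "AE x in M. \<forall>k\<in>UNIV. x \<in> \<Omega> - O' k \<longrightarrow> F x \<le> ennreal (2 powr real_of_int k)"
    unfolding O'_def using AE_le_outside_reach[OF F] by (subst AE_ball_countable) auto
  then have "AE x in M. ennreal (cmod (f x - mean f \<Omega>) powr q) * indicator \<Omega> x
      \<le> (\<integral>\<^sup>+k. ennreal (2 powr q) * (ennreal (2 powr (real_of_int k * q)) * indicator (O' k) x) \<partial>count_space UNIV)"
  proof (rule AE_mp, intro AE_I2 impI)
    fix x assume ae: "\<forall>k\<in>UNIV. x \<in> \<Omega> - O' k \<longrightarrow> F x \<le> ennreal (2 powr real_of_int k)"
    let ?v = "cmod (f x - mean f \<Omega>)"
    show "ennreal (?v powr q) * indicator \<Omega> x
      \<le> (\<integral>\<^sup>+k. ennreal (2 powr q) * (ennreal (2 powr (real_of_int k * q)) * indicator (O' k) x) \<partial>count_space UNIV)"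
    proof (cases "x \<in> \<Omega> \<and> 0 < ?v")
      case True
      then obtain k :: int where k: "2 powr real_of_int k < ?v" "?v \<le> 2 powr real_of_int (k + 1)"
        using dyadic_level by blast
      have "x \<in> O' k"
      proof (rule ccontr)
        assume "x \<notin> O' k"
        then have "F x \<le> ennreal (2 powr real_of_int k)" using ae True by auto
        then show False using k(1) by (simp add: F_def)
      qed
      have "?v powr q \<le> (2 powr real_of_int (k + 1)) powr q" using k(2) q by (intro powr_mono2) auto
      also have "\<dots> = 2 powr q * 2 powr (real_of_int k * q)"
        by (simp add: powr_powr powr_add[symmetric] algebra_simps)
      finally have "ennreal (?v powr q) * indicator \<Omega> x
          \<le> ennreal (2 powr q) * (ennreal (2 powr (real_of_int k * q)) * indicator (O' k) x)"
        using \<open>x \<in> O' k\<close> True by (simp add: ennreal_leI flip: ennreal_mult)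
      also have "\<dots> \<le> (\<integral>\<^sup>+k. ennreal (2 powr q) * (ennreal (2 powr (real_of_int k * q)) * indicator (O' k) x) \<partial>count_space UNIV)"
        by (rule nn_integral_ge_point) simp
      finally show ?thesis .
    next
      case False
      then show ?thesis using q by (auto split: split_indicator)
    qed
  qed
  then have "(\<integral>\<^sup>+x\<in>\<Omega>. ennreal (cmod (f x - mean f \<Omega>) powr q) \<partial>M)
      \<le> (\<integral>\<^sup>+x. (\<integral>\<^sup>+k. ennreal (2 powr q) * (ennreal (2 powr (real_of_int k * q)) * indicator (O' k) x) \<partial>count_space UNIV) \<partial>M)"
    by (rule nn_integral_mono_AE)
  also have "\<dots> = (\<integral>\<^sup>+k. (\<integral>\<^sup>+x. ennreal (2 powr q) * (ennreal (2 powr (real_of_int k * q)) * indicator (O' k) x) \<partial>M) \<partial>count_space UNIV)"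
    by (rule nn_integral_count_space_nn_integral) auto
  also have "\<dots> = ennreal (2 powr q) * (\<integral>\<^sup>+k. a k \<partial>count_space UNIV)"
    by (simp add: nn_integral_cmult nn_integral_cmult_indicator a_def)
  also have "\<dots> \<le> ennreal (2 powr q) * (2 * (D * (\<integral>\<^sup>+k. w k \<partial>count_space UNIV)))"
    by (rule mult_left_mono[OF T]) simp
  also have "\<dots> = ennreal (2 * 2 powr (q * (real m + 1))) * (\<integral>\<^sup>+k. w k \<partial>count_space UNIV)"
  proof -
    have "2 * 2 powr (q * (real m + 1)) = 2 powr q * (2 * 2 powr (real m * q))"
      by (simp add: powr_add[symmetric] algebra_simps)
    then show ?thesis unfolding D_def by (simp add: ennreal_mult mult_ac)
  qed
  finally show ?thesis unfolding w_def .
qed simp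

end

section \<open>Decomposition into pieces with mean zero\<close>

context dyadic_filtration
begin

lemma stop_step_measurable [measurable]:
  "(\<lambda>x. if x \<in> reach P then \<phi> (stop P x) else (0::complex)) \<in> borel_measurable M"
proof (rule measurableI)
  fix B :: "complex set"
  let ?h = "\<lambda>x. if x \<in> reach P then \<phi> (stop P x) else (0::complex)"
  let ?U = "\<Union>{R \<in> stop P ` reach P. \<phi> R \<in> B}"
  have "countable {R \<in> stop P ` reach P. \<phi> R \<in> B}"
    by (rule countable_subset[OF _ countable_stop]) auto
  moreover have "{R \<in> stop P ` reach P. \<phi> R \<in> B} \<subseteq> sets M" using stop_sets by blast
  ultimately have [measurable]: "?U \<in> sets M" by (rule sets.countable_Union)
  have U: "x \<in> ?U \<longleftrightarrow> x \<in> reach P \<and> \<phi> (stop P x) \<in> B" for x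
  proof
    assume "x \<in> ?U"
    then obtain y where "y \<in> reach P" "\<phi> (stop P y) \<in> B" "x \<in> stop P y" by blast
    then show "x \<in> reach P \<and> \<phi> (stop P x) \<in> B" using stop_eq[of y P x] by simp
  next
    assume "x \<in> reach P \<and> \<phi> (stop P x) \<in> B"
    then show "x \<in> ?U" using stop_self[of x P] by blast
  qed
  have "?h -` B \<inter> space M = (?U \<inter> space M) \<union> (if 0 \<in> B then space M - reach P else {})"
    unfolding set_eq_iff Un_iff Int_iff U by auto
  also have "\<dots> \<in> sets M" by auto
  finally show "?h -` B \<inter> space M \<in> sets M" .
qed auto

lemma set_integral_reach_zero:
  fixes v :: "'a \<Rightarrow> complex"
  assumes v: "set_integrable M (reach P) v"
    and zero: "\<And>x. x \<in> reach P \<Longrightarrow> (LINT z:stop P x|M. v z) = 0"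
  shows "(LINT z:reach P|M. v z) = 0"
proof -
  let ?I = "stop P ` reach P"
  define A where "A n = (if n \<in> to_nat_on ?I ` ?I then from_nat_into ?I n else {})" for n
  have inI: "A n \<in> ?I" if "A n \<noteq> {}" for n
    using that by (auto simp: A_def countable_stop split: if_splits)
  have U: "(\<Union>n. A n) = reach P"
  proof (rule antisym)
    show "(\<Union>n. A n) \<subseteq> reach P" using inI stop_subset by blast
    have "R \<subseteq> (\<Union>n. A n)" if "R \<in> ?I" for R
    proof -
      have "A (to_nat_on ?I R) = R" using that by (simp add: A_def countable_stop)
      then show ?thesis by blast
    qed
    then show "reach P \<subseteq> (\<Union>n. A n)" using stop_self by blast
  qed
  have disj: "A i \<inter> A j = {}" if "i \<noteq> j" for i j
  proof (cases "i \<in> to_nat_on ?I ` ?I \<and> j \<in> to_nat_on ?I ` ?I")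
    case True
    then obtain R T where RT: "R \<in> ?I" "T \<in> ?I" "i = to_nat_on ?I R" "j = to_nat_on ?I T" by blast
    then have "R \<noteq> T" "A i = R" "A j = T" using that by (auto simp: A_def countable_stop)
    then show ?thesis using disjoint_stop[of P] RT(1,2) unfolding disjoint_family_on_def by metis
  qed (auto simp: A_def)
  have Az: "(LINT z:A n|M. v z) = 0" for n
  proof (cases "A n = {}")
    case False
    then show ?thesis using inI[OF False] zero by auto
  qed (simp add: set_lebesgue_integral_def)
  have Am: "A n \<in> sets M" for n using inI[of n] by (cases "A n = {}") auto
  have "(LINT z:(\<Union>n. A n)|M. v z) = (\<Sum>n. (LINT z:A n|M. v z))"
    using v by (intro lebesgue_integral_countable_add Am disj) (auto simp: U)
  then show ?thesis by (simp add: U Az)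
qed

text \<open>Let \<open>O\<^sub>k\<close> be the set where the maximal function of \<open>|f|\<close> exceeds \<open>l 2\<^sup>k\<close>, and let \<open>b\<^sub>k\<close> be
\<open>f\<close> minus its mean on each stopping cell of that height, and \<open>0\<close> outside \<open>O\<^sub>k\<close>. The good part is \<open>g = f - b\<^sub>0\<close>.
The pieces \<open>u i\<close> are the restrictions of \<open>b\<^sub>k - b\<^sub>k\<^sub>+\<^sub>1\<close> to the stopping cells of height \<open>l 2\<^sup>k\<close>. They have mean
zero, since the stopping cells of height \<open>l 2\<^sup>k\<^sup>+\<^sup>1\<close> refine those of height \<open>l 2\<^sup>k\<close>, and they are bounded by
\<open>3 N l 2\<^sup>k\<close>, since on a stopping cell only means of \<open>|f|\<close> and values of \<open>f\<close> outside \<open>O\<^sub>k\<^sub>+\<^sub>1\<close> occur. They add up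
to \<open>b\<^sub>0\<close>, because almost every point lies in only finitely many of the \<open>O\<^sub>k\<close>. The weak type estimate for
truncated functions bounds the sum of the products of bound and measure.\<close>

lemma calderon_zygmund_telescoping:
  assumes f [measurable]: "f \<in> borel_measurable M" and ne: "\<Omega> \<noteq> {}" and l: "0 < l"
    and small: "\<forall>x\<in>\<Omega>. \<not> big (\<lambda>z. ennreal (cmod (f z))) l (cell 0 x)"
  defines "B \<equiv> (\<Sum>k. \<integral>\<^sup>+y. ennreal (cmod (f y)) * indicator {y. ennreal (l * 2 ^ k / 2) < ennreal (cmod (f y))} y \<partial>M)"
  assumes B: "B < \<infinity>"
  shows "\<exists>g u \<beta> R. g \<in> borel_measurable M \<and> (AE x in M. x \<in> \<Omega> \<longrightarrow> cmod (g x) \<le> N * l) \<and>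
    (\<forall>i. u i \<in> borel_measurable M \<and> (\<exists>n. \<exists>x\<in>\<Omega>. R i = cell n x) \<and> (\<forall>x. x \<notin> R i \<longrightarrow> u i x = 0) \<and>
       (AE x in M. cmod (u i x) \<le> \<beta> i) \<and> 0 \<le> \<beta> i \<and> (LINT x|M. u i x) = (0::complex)) \<and>
    (\<Sum>i. ennreal (\<beta> i * measure M (R i))) \<le> ennreal (6 * N) * B \<and>
    (AE x in M. x \<in> \<Omega> \<longrightarrow> (\<lambda>i::nat. u i x) sums (f x - g x))"
proof -
  obtain x0 where x0: "x0 \<in> \<Omega>" using ne by auto
  have N: "1 \<le> N" using N_ge_1[OF x0] .
  define F where "F = (\<lambda>z. ennreal (cmod (f z)))"
  have F [measurable]: "F \<in> borel_measurable M" unfolding F_def by measurable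
  define L where "L k = l * 2 ^ k" for k :: nat
  have L: "0 < L k" "L (Suc k) = 2 * L k" "l \<le> L k" for k
    using l by (auto simp: L_def)
  define P where "P k = big F (L k)" for k
  define O' where "O' k = reach (P k)" for k
  define T where "T k = stop (P k)" for k
  have O'm [measurable]: "O' k \<in> sets M" for k by (simp add: O'_def)
  have O'sub: "O' k \<subseteq> \<Omega>" for k unfolding O'_def by (rule reach_subset)
  have PP: "P k R" if "P (Suc k) R" for k R
    using that big_antimono[of "L k" "L (Suc k)" F R] L(1)[of k] L(2)[of k] by (simp add: P_def)
  have O'dec: "O' (Suc k) \<subseteq> O' k" for k using PP by (auto simp: O'_def reach_def)
  have O'anti: "O' j \<subseteq> O' i" if "i \<le> j" for i j
    using that by (induction j rule: dec_induct) (use O'dec in blast)+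
  have Tsub: "T (Suc k) x \<subseteq> T k x" if x: "x \<in> O' (Suc k)" for k x
  proof -
    have xO: "x \<in> \<Omega>" using x O'sub by auto
    obtain n where n: "T (Suc k) x = cell n x" "P (Suc k) (cell n x)"
      using stop_cases[of x "P (Suc k)"] x unfolding T_def O'_def by metis
    have "(LEAST n. P k (cell n x)) \<le> n" using PP[OF n(2)] by (rule Least_le)
    then have "cell n x \<subseteq> T k x" unfolding T_def stop_def by (rule cell_antimono[OF xO])
    then show ?thesis unfolding n(1) .
  qed
  have small': "\<not> P k (cell 0 x)" if "x \<in> \<Omega>" for k x
    using bspec[OF small that] big_antimono[of l "L k" F] L(3) by (auto simp: P_def F_def)
  have fT: "set_integrable M (T k x) f"
    and meanT: "cmod (mean f (T k x)) \<le> N * L k" if x: "x \<in> O' k" for k x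
  proof -
    have xO: "x \<in> \<Omega>" using x O'sub by auto
    have le: "(\<integral>\<^sup>+y\<in>T k x. F y \<partial>M) \<le> ennreal (N * L k) * emeasure M (T k x)"
      using stop_upper[OF F, of x "L k"] x small'[OF xO, of k] L(1)[of k] by (simp add: T_def O'_def P_def)
    obtain n where n: "T k x = cell n x" using stop_cell[of x "P k"] x by (auto simp: T_def O'_def)
    have [measurable]: "cell n x \<in> sets M" using cell_sets[OF xO] .
    have "(\<integral>\<^sup>+y. ennreal (norm (indicator (cell n x) y *\<^sub>R f y)) \<partial>M) = (\<integral>\<^sup>+y\<in>T k x. F y \<partial>M)"
      unfolding n F_def by (intro nn_integral_cong) (auto split: split_indicator)
    also have "\<dots> < \<infinity>"
      using le_less_trans[OF le] cell_finite[OF xO, of n] n by (simp add: ennreal_mult_less_top)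
    finally show i: "set_integrable M (T k x) f"
      unfolding n set_integrable_def by (intro integrableI_bounded) auto
    have "ennreal (cmod (mean f (cell n x))) * emeasure M (cell n x) \<le> ennreal (N * L k) * emeasure M (cell n x)"
      using mean_diff_le[of n x f 0] i xO le n by (simp add: F_def)
    then have "cmod (mean f (cell n x)) * measure M (cell n x) \<le> N * L k * measure M (cell n x)"
      using N L(1)[of k] by (simp add: emeasure_cell[OF xO] flip: ennreal_mult)
    then show "cmod (mean f (T k x)) \<le> N * L k" using cell_pos[OF xO, of n] n by simp
  qed
  define b where "b k x = (if x \<in> O' k then f x - mean f (T k x) else 0)" for k x
  have bm [measurable]: "b k \<in> borel_measurable M" for k
  proof -
    have [measurable]: "(\<lambda>x. if x \<in> O' k then mean f (T k x) else 0) \<in> borel_measurable M"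
      unfolding O'_def T_def by (rule stop_step_measurable)
    have "b k = (\<lambda>x. (if x \<in> O' k then f x else 0) - (if x \<in> O' k then mean f (T k x) else 0))"
      by (auto simp: b_def)
    also have "\<dots> \<in> borel_measurable M" by measurable
    finally show ?thesis .
  qed
  have out: "AE x in M. \<forall>k\<in>UNIV. x \<in> \<Omega> - O' k \<longrightarrow> cmod (f x) \<le> L k"
  proof -
    have "AE x in M. x \<in> \<Omega> - O' k \<longrightarrow> F x \<le> ennreal (L k)" for k
      unfolding O'_def P_def by (rule AE_le_outside_reach[OF F])
    then have "AE x in M. x \<in> \<Omega> - O' k \<longrightarrow> cmod (f x) \<le> L k" for k
      using less_imp_le[OF L(1)] by (simp add: F_def)
    then show ?thesis by (subst AE_ball_countable) auto
  qed
  define g where "g x = f x - b 0 x" for x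
  have gm [measurable]: "g \<in> borel_measurable M" unfolding g_def by measurable
  have g_le: "AE x in M. x \<in> \<Omega> \<longrightarrow> cmod (g x) \<le> N * l"
    using out
  proof (rule AE_mp, intro AE_I2 impI)
    fix x assume a: "\<forall>k\<in>UNIV. x \<in> \<Omega> - O' k \<longrightarrow> cmod (f x) \<le> L k" "x \<in> \<Omega>"
    have L0: "L 0 = l" by (simp add: L_def)
    show "cmod (g x) \<le> N * l"
    proof (cases "x \<in> O' 0")
      case True
      then show ?thesis using meanT[OF True] by (simp add: g_def b_def L0)
    next
      case False
      then have "cmod (f x) \<le> 1 * l" using a L0 by force
      also have "1 * l \<le> N * l" using N l by (intro mult_right_mono) auto
      finally show ?thesis using False by (simp add: g_def b_def)
    qed
  qed
  \<comment> \<open>The index set of the pieces. It may be finite, so the sequence is filled up with zeros below.\<close>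
  define I where "I = (SIGMA k:UNIV. T k ` O' k)"
  have Ic: "countable I" unfolding I_def T_def O'_def by (intro countable_SIGMA countable_stop) auto
  define v where "v p x = indicator (snd p) x * (b (fst p) x - b (Suc (fst p)) x)" for p :: "nat \<times> 'a set" and x
  have cellI: "\<exists>n. \<exists>x\<in>\<Omega>. R = cell n x" if kR: "(k, R) \<in> I" for k R
  proof -
    obtain x where x: "x \<in> O' k" "R = T k x" using kR by (auto simp: I_def)
    obtain n where "stop (P k) x = cell n x" using stop_cell[of x "P k"] x(1) by (auto simp: O'_def)
    then show ?thesis using x O'sub[of k] unfolding T_def by blast
  qed
  have vm [measurable]: "v p \<in> borel_measurable M" if "p \<in> I" for p
  proof -
    have [measurable]: "snd p \<in> sets M" using that by (auto simp: I_def T_def O'_def)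
    show ?thesis unfolding v_def by measurable
  qed
  have v_le: "AE x in M. cmod (v p x) \<le> 3 * N * L (fst p)" if p: "p \<in> I" for p
    using out
  proof (rule AE_mp, intro AE_I2 impI)
    fix x assume a: "\<forall>k\<in>UNIV. x \<in> \<Omega> - O' k \<longrightarrow> cmod (f x) \<le> L k"
    obtain k R where kR: "p = (k, R)" by (cases p)
    have nn: "0 \<le> N * L k" using N L(1)[of k] by simp
    show "cmod (v p x) \<le> 3 * N * L (fst p)"
    proof (cases "x \<in> R")
      case True
      obtain y where y: "y \<in> O' k" "R = T k y" using p kR by (auto simp: I_def)
      have xk: "x \<in> O' k" "T k x = R" using stop_eq[of y "P k" x] y True by (auto simp: O'_def T_def)
      have e: "v p x = (f x - mean f (T k x)) - b (Suc k) x" using True xk by (simp add: v_def kR b_def)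
      show ?thesis
      proof (cases "x \<in> O' (Suc k)")
        case T': True
        have "v p x = mean f (T (Suc k) x) - mean f (T k x)" unfolding e b_def using T' by simp
        then have "cmod (v p x) \<le> cmod (mean f (T (Suc k) x)) + cmod (mean f (T k x))"
          using norm_triangle_ineq4 by metis
        also have "\<dots> \<le> N * L (Suc k) + N * L k" by (intro add_mono meanT T' xk)
        finally show ?thesis using L(2)[of k] by (simp add: kR)
      next
        case False
        then have "cmod (f x) \<le> L (Suc k)" using a xk O'sub by blast
        also have "L (Suc k) = 1 * (2 * L k)" using L(2) by simp
        also have "\<dots> \<le> N * (2 * L k)" using N L(1)[of k] by (intro mult_right_mono) auto
        finally have "cmod (f x) \<le> 2 * N * L k" by simp
        moreover have "cmod (v p x) \<le> cmod (f x) + cmod (mean f (T k x))"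
          unfolding e b_def using False norm_triangle_ineq4[of "f x" "mean f (T k x)"] by simp
        ultimately show ?thesis using meanT[OF xk(1)] by (simp add: kR)
      qed
    next
      case False
      then show ?thesis using nn by (simp add: v_def kR)
    qed
  qed
  have bint: "set_integrable M R (b j)" if R: "R \<in> T k ` O' k" for k j R
  proof -
    obtain y where y: "y \<in> O' k" "R = T k y" using R by auto
    have Rm [measurable]: "R \<in> sets M" using y by (simp add: T_def O'_def)
    obtain n where n: "R = cell n y" using stop_cell[of y "P k"] y by (auto simp: T_def O'_def)
    have yO: "y \<in> \<Omega>" using y O'sub by auto
    have fR: "set_integrable M R f" using fT[OF y(1)] y(2) by simp
    have cR: "set_integrable M R (\<lambda>x. complex_of_real (N * L j))"
      using cell_finite[OF yO, of n] n Rm by (simp add: set_integrable_def)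
    have "set_integrable M R (\<lambda>x. norm (f x) + norm (complex_of_real (N * L j)))"
      by (intro set_integral_add set_integrable_norm fR cR)
    then show ?thesis
      unfolding set_integrable_def
    proof (rule Bochner_Integration.integrable_bound)
      show "AE x in M. norm (indicator R x *\<^sub>R b j x) \<le> norm (indicator R x *\<^sub>R (norm (f x) + norm (complex_of_real (N * L j))))"
      proof (rule AE_I2)
        fix x
        have "0 \<le> N * L j" using N L(1)[of j] by simp
        then have e: "cmod (complex_of_real (N * L j)) = N * L j" by (simp only: norm_of_real abs_of_nonneg)
        have "cmod (b j x) \<le> cmod (f x) + N * L j"
          using meanT[of x j] norm_triangle_ineq4[of "f x" "mean f (T j x)"] \<open>0 \<le> N * L j\<close>
          by (cases "x \<in> O' j") (auto simp: b_def)
        then have "cmod (b j x) \<le> cmod (f x) + cmod (complex_of_real (N * L j))" unfolding e .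
        then show "norm (indicator R x *\<^sub>R b j x) \<le> norm (indicator R x *\<^sub>R (norm (f x) + norm (complex_of_real (N * L j))))"
          by (auto split: split_indicator)
      qed
    qed measurable
  qed
  have bzero: "(LINT z:R|M. b k z) = 0" if R: "R \<in> T k ` O' k" for k R
  proof -
    obtain y where y: "y \<in> O' k" "R = T k y" using R by auto
    have Rm [measurable]: "R \<in> sets M" using y by (simp add: T_def O'_def)
    obtain n where n: "R = cell n y" using stop_cell[of y "P k"] y by (auto simp: T_def O'_def)
    have yO: "y \<in> \<Omega>" using y O'sub by auto
    have fR: "set_integrable M R f" using fT[OF y(1)] y(2) by simp
    have cR: "set_integrable M R (\<lambda>x. mean f R)"
      using cell_finite[OF yO, of n] n Rm by (simp add: set_integrable_def)
    have "(LINT z:R|M. b k z) = (LINT z:R|M. f z - mean f R)"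
      unfolding set_lebesgue_integral_def
    proof (intro Bochner_Integration.integral_cong refl)
      fix z
      have "z \<in> R \<Longrightarrow> z \<in> O' k \<and> T k z = R" using stop_eq[of y "P k" z] y by (auto simp: O'_def T_def)
      then show "indicator R z *\<^sub>R b k z = indicator R z *\<^sub>R (f z - mean f R)"
        by (auto simp: b_def split: split_indicator)
    qed
    also have "\<dots> = (LINT z:R|M. f z) - measure M R *\<^sub>R mean f R"
      using cell_finite[OF yO, of n] n Rm
      by (subst set_integral_diff(2)[OF fR cR]) (simp add: set_lebesgue_integral_def)
    also have "\<dots> = 0" using cell_pos[OF yO, of n] n by (simp add: mean_def)
    finally show ?thesis .
  qed
  have bzero': "(LINT z:R|M. b (Suc k) z) = 0" if R: "R \<in> T k ` O' k" for k R
  proof -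
    obtain y where y: "y \<in> O' k" "R = T k y" using R by auto
    have Rm [measurable]: "R \<in> sets M" using y by (simp add: T_def O'_def)
    let ?v = "\<lambda>z. indicator R z *\<^sub>R b (Suc k) z"
    have "(LINT z:O' (Suc k)|M. ?v z) = 0"
      unfolding O'_def
    proof (rule set_integral_reach_zero)
      have "integrable M ?v" using bint[OF R] by (simp add: set_integrable_def)
      then show "set_integrable M (reach (P (Suc k))) ?v"
        unfolding set_integrable_def by (rule integrable_mult_indicator[OF reach_sets])
      fix x assume x: "x \<in> reach (P (Suc k))"
      let ?C = "stop (P (Suc k)) x"
      show "(LINT z:?C|M. ?v z) = 0"
      proof (cases "?C \<subseteq> R")
        case True
        then have "(LINT z:?C|M. ?v z) = (LINT z:?C|M. b (Suc k) z)"
          unfolding set_lebesgue_integral_def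
          by (intro Bochner_Integration.integral_cong refl) (auto split: split_indicator)
        then show ?thesis using bzero[of ?C "Suc k"] x by (auto simp: T_def O'_def)
      next
        case False
        have "?C \<inter> R = {}"
        proof (rule ccontr)
          assume "?C \<inter> R \<noteq> {}"
          then obtain z where z: "z \<in> ?C" "z \<in> R" by blast
          have z1: "z \<in> O' (Suc k)" "T (Suc k) z = ?C" using stop_eq[OF x z(1)] by (auto simp: O'_def T_def)
          have z2: "T k z = R" using stop_eq[of y "P k" z] y z(2) by (auto simp: O'_def T_def)
          show False using Tsub[OF z1(1)] z1(2) z2 False by simp
        qed
        then have "indicator ?C z *\<^sub>R ?v z = 0" for z
        proof -
          have "z \<notin> ?C \<or> z \<notin> R" using \<open>?C \<inter> R = {}\<close> by blast
          then show ?thesis by auto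
        qed
        then have "(\<lambda>z. indicator ?C z *\<^sub>R ?v z) = (\<lambda>z. 0)" by (rule ext)
        then show ?thesis unfolding set_lebesgue_integral_def by (simp only: integral_zero)
      qed
    qed
    moreover have "(LINT z:O' (Suc k)|M. ?v z) = (LINT z:R|M. b (Suc k) z)"
      unfolding set_lebesgue_integral_def
      by (intro Bochner_Integration.integral_cong refl) (auto split: split_indicator simp: b_def)
    ultimately show ?thesis by simp
  qed
  have vzero: "(LINT x|M. v p x) = 0" if p: "p \<in> I" for p
  proof -
    obtain k R where kR: "p = (k, R)" by (cases p)
    have R: "R \<in> T k ` O' k" using p kR by (auto simp: I_def)
    have "(LINT x|M. v p x) = (LINT x:R|M. b k x - b (Suc k) x)"
      unfolding set_lebesgue_integral_def v_def kR
      by (intro Bochner_Integration.integral_cong refl) (auto split: split_indicator)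
    also have "\<dots> = 0"
      by (subst set_integral_diff(2)[OF bint[OF R] bint[OF R]]) (simp add: bzero[OF R] bzero'[OF R])
    finally show ?thesis .
  qed
  have wk: "ennreal (L k) * emeasure M (O' k) \<le> 2 * (\<integral>\<^sup>+y. F y * indicator {y. ennreal (L k / 2) < F y} y \<partial>M)" for k
  proof -
    have "ennreal (L k / 2) * emeasure M (reach (big F (2 * (L k / 2)))) \<le> (\<integral>\<^sup>+y. F y * indicator {y. ennreal (L k / 2) < F y} y \<partial>M)"
      using L(1)[of k] by (intro weak_type_truncated F) auto
    then have "2 * (ennreal (L k / 2) * emeasure M (O' k)) \<le> 2 * (\<integral>\<^sup>+y. F y * indicator {y. ennreal (L k / 2) < F y} y \<partial>M)"
      by (intro mult_left_mono) (auto simp: O'_def P_def)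
    moreover have "2 * ennreal (L k / 2) = ennreal (L k)"
      using L(1)[of k] ennreal_mult[of 2 "L k / 2"] by simp
    ultimately show ?thesis by (simp add: mult.assoc[symmetric])
  qed
  have Beq: "B = (\<Sum>k. \<integral>\<^sup>+y. F y * indicator {y. ennreal (L k / 2) < F y} y \<partial>M)"
    unfolding B_def F_def L_def ..
  have null: "emeasure M (\<Inter>k. O' k) = 0"
  proof (rule ccontr)
    let ?Z = "\<Inter>k. O' k"
    assume nz: "emeasure M ?Z \<noteq> 0"
    obtain e where e: "0 < e" "ennreal e \<le> emeasure M ?Z"
    proof (cases "emeasure M ?Z")
      case (real r)
      then show ?thesis using nz that[of r] by (cases "r = 0") auto
    next
      case top
      then show ?thesis using that[of 1] by simp
    qed
    obtain c where c: "2 * B = ennreal c" "0 \<le> c" using B by (cases "2 * B") (auto simp: ennreal_mult_eq_top_iff)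
    have "l * 2 ^ k * e \<le> c" for k
    proof -
      have "ennreal (L k) * ennreal e \<le> ennreal (L k) * emeasure M (O' k)"
      proof (rule mult_left_mono)
        have "emeasure M ?Z \<le> emeasure M (O' k)" by (intro emeasure_mono) auto
        then show "ennreal e \<le> emeasure M (O' k)" by (rule order.trans[OF e(2)])
      qed simp
      also have "\<dots> \<le> 2 * (\<integral>\<^sup>+y. F y * indicator {y. ennreal (L k / 2) < F y} y \<partial>M)" by (rule wk)
      also have "\<dots> \<le> 2 * B"
        unfolding Beq
        using sum_le_suminf[of "\<lambda>k. \<integral>\<^sup>+y. F y * indicator {y. ennreal (L k / 2) < F y} y \<partial>M" "{k}"]
        by (intro mult_left_mono) auto
      finally have "ennreal (L k * e) \<le> ennreal c" using L(1)[of k] e c by (simp add: ennreal_mult)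
      then show ?thesis using c by (simp add: L_def)
    qed
    moreover obtain k :: nat where "c / (l * e) < 2 ^ k" using real_arch_pow[of 2 "c / (l * e)"] by auto
    ultimately show False using l e(1) by (auto simp: field_simps dest: not_le_imp_less) (metis mult.commute mult.left_commute not_le)
  qed
  define e where "e = to_nat_on I"
  have e_inj: "inj_on e I" unfolding e_def by (rule inj_on_to_nat_on[OF Ic])
  define u where "u n x = (if n \<in> e ` I then v (from_nat_into I n) x else 0)" for n x
  define \<beta> where "\<beta> n = (if n \<in> e ` I then 3 * N * L (fst (from_nat_into I n)) else 0)" for n
  define RR where "RR n = (if n \<in> e ` I then snd (from_nat_into I n) else cell 0 x0)" for n
  have from_e [simp]: "from_nat_into I (e p) = p" if "p \<in> I" for p using that Ic by (simp add: e_def)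
  have props: "u i \<in> borel_measurable M \<and> (\<exists>n. \<exists>x\<in>\<Omega>. RR i = cell n x) \<and> (\<forall>x. x \<notin> RR i \<longrightarrow> u i x = 0) \<and>
       (AE x in M. cmod (u i x) \<le> \<beta> i) \<and> 0 \<le> \<beta> i \<and> (LINT x|M. u i x) = 0" for i
  proof (cases "i \<in> e ` I")
    case True
    then obtain p where p: "p \<in> I" "i = e p" by blast
    have [simp]: "u i = v p" "\<beta> i = 3 * N * L (fst p)" "RR i = snd p"
      using p by (auto simp: u_def \<beta>_def RR_def fun_eq_iff)
    have "0 \<le> 3 * N * L (fst p)" using N L(1)[of "fst p"] by simp
    moreover have "\<exists>n. \<exists>x\<in>\<Omega>. snd p = cell n x" using cellI[of "fst p" "snd p"] p by simp
    moreover have "\<forall>x. x \<notin> snd p \<longrightarrow> v p x = 0" by (simp add: v_def)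
    ultimately show ?thesis using vm[OF p(1)] v_le[OF p(1)] vzero[OF p(1)] by simp
  next
    case False
    then have "u i = (\<lambda>x. 0)" "\<beta> i = 0" "RR i = cell 0 x0" by (auto simp: u_def \<beta>_def RR_def)
    then show ?thesis using x0 by auto
  qed
  have "(\<Sum>i. ennreal (\<beta> i * measure M (RR i))) = (\<integral>\<^sup>+i. ennreal (\<beta> i * measure M (RR i)) \<partial>count_space UNIV)"
    by (rule nn_integral_count_space_nat[symmetric])
  also have "\<dots> = (\<integral>\<^sup>+i. ennreal (\<beta> i * measure M (RR i)) \<partial>count_space (e ` I))"
    by (rule nn_integral_count_space_eq) (auto simp: \<beta>_def)
  also have "\<dots> = (\<integral>\<^sup>+p. ennreal (\<beta> (e p) * measure M (RR (e p))) \<partial>count_space I)"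
    using e_inj by (intro nn_integral_bij_count_space[symmetric]) (simp add: bij_betw_def)
  also have "\<dots> = (\<integral>\<^sup>+p. ennreal (3 * N * L (fst p)) * emeasure M (snd p) \<partial>count_space I)"
  proof (rule nn_integral_cong)
    fix p assume "p \<in> space (count_space I)"
    then have p: "p \<in> I" by simp
    then obtain n x where x: "x \<in> \<Omega>" "snd p = cell n x" using cellI[of "fst p" "snd p"] by auto
    have "0 \<le> 3 * N * L (fst p)" using N L(1)[of "fst p"] by simp
    then show "ennreal (\<beta> (e p) * measure M (RR (e p))) = ennreal (3 * N * L (fst p)) * emeasure M (snd p)"
      using p x by (simp add: \<beta>_def RR_def emeasure_cell flip: ennreal_mult)
  qed
  also have "\<dots> = (\<integral>\<^sup>+p. ennreal (3 * N * L (fst p)) * emeasure M (snd p) * indicator I p \<partial>count_space UNIV)"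
    by (simp add: nn_integral_count_space_indicator)
  also have "\<dots> = (\<integral>\<^sup>+k. \<integral>\<^sup>+C. ennreal (3 * N * L k) * (emeasure M C * indicator (T k ` O' k) C) \<partial>count_space UNIV \<partial>count_space UNIV)"
    by (subst nn_integral_fst_count_space[symmetric], intro nn_integral_cong)
       (auto simp: I_def indicator_def)
  also have "\<dots> = (\<integral>\<^sup>+k. ennreal (3 * N * L k) * emeasure M (O' k) \<partial>count_space UNIV)"
  proof (rule nn_integral_cong)
    fix k
    have "emeasure M (O' k) = (\<integral>\<^sup>+C. emeasure M C \<partial>count_space (T k ` O' k))"
    proof -
      have "emeasure M (\<Union>C\<in>T k ` O' k. C) = (\<integral>\<^sup>+C. emeasure M C \<partial>count_space (T k ` O' k))"
        unfolding T_def O'_def by (intro emeasure_UN_countable countable_stop disjoint_stop) auto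
      then show ?thesis using reach_UN[of "P k"] by (simp add: T_def O'_def)
    qed
    then show "(\<integral>\<^sup>+C. ennreal (3 * N * L k) * (emeasure M C * indicator (T k ` O' k) C) \<partial>count_space UNIV)
      = ennreal (3 * N * L k) * emeasure M (O' k)"
      by (simp add: nn_integral_cmult nn_integral_count_space_indicator)
  qed
  also have "\<dots> = (\<Sum>k. ennreal (3 * N * L k) * emeasure M (O' k))"
    by (rule nn_integral_count_space_nat)
  also have "\<dots> \<le> (\<Sum>k. ennreal (6 * N) * (\<integral>\<^sup>+y. F y * indicator {y. ennreal (L k / 2) < F y} y \<partial>M))"
  proof (intro suminf_le allI)
    fix k
    have "ennreal (3 * N * L k) * emeasure M (O' k) = ennreal (3 * N) * (ennreal (L k) * emeasure M (O' k))"
      using N L(1)[of k] by (simp add: ennreal_mult mult.assoc)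
    also have "\<dots> \<le> ennreal (3 * N) * (2 * (\<integral>\<^sup>+y. F y * indicator {y. ennreal (L k / 2) < F y} y \<partial>M))"
      by (rule mult_left_mono[OF wk]) simp
    also have "\<dots> = ennreal (6 * N) * (\<integral>\<^sup>+y. F y * indicator {y. ennreal (L k / 2) < F y} y \<partial>M)"
    proof -
      have "ennreal (3 * N) * 2 = ennreal (6 * N)" using N ennreal_mult[of "3 * N" 2] by simp
      then show ?thesis by (simp add: mult.assoc[symmetric])
    qed
    finally show "ennreal (3 * N * L k) * emeasure M (O' k) \<le> ennreal (6 * N) * (\<integral>\<^sup>+y. F y * indicator {y. ennreal (L k / 2) < F y} y \<partial>M)" .
  qed auto
  also have "\<dots> = ennreal (6 * N) * B" unfolding Beq by simp
  finally have sum_le: "(\<Sum>i. ennreal (\<beta> i * measure M (RR i))) \<le> ennreal (6 * N) * B" .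
  have "AE x in M. x \<notin> (\<Inter>k. O' k)"
    using null by (intro AE_not_in) auto
  then have sums: "AE x in M. x \<in> \<Omega> \<longrightarrow> (\<lambda>i. u i x) sums (f x - g x)"
  proof (rule AE_mp, intro AE_I2 impI)
    fix x assume "x \<notin> (\<Inter>k. O' k)" "x \<in> \<Omega>"
    then obtain K where K: "x \<notin> O' K" by blast
    let ?J = "{k. k < K \<and> x \<in> O' k}"
    \<comment> \<open>At a point outside \<open>O' K\<close> only the pieces of the levels below \<open>K\<close> can be nonzero, one for each level.\<close>
    let ?G = "(\<lambda>k. (k, T k x)) ` ?J"
    have G: "?G \<subseteq> I" "finite ?G" by (auto simp: I_def)
    have "(\<lambda>n. u n x) sums (\<Sum>n\<in>e ` ?G. u n x)"
    proof (rule sums_finite)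
      fix n assume n: "n \<notin> e ` ?G"
      show "u n x = 0"
      proof (rule ccontr)
        assume nz: "u n x \<noteq> 0"
        then obtain p where p: "p \<in> I" "n = e p" by (auto simp: u_def split: if_splits)
        obtain k C where kC: "p = (k, C)" by (cases p)
        have "v p x \<noteq> 0" using nz p by (simp add: u_def)
        then have xC: "x \<in> C" by (auto simp: v_def kC split: split_indicator_asm)
        obtain y where y: "y \<in> O' k" "C = T k y" using p kC by (auto simp: I_def)
        have xk: "x \<in> O' k" "T k x = C" using stop_eq[of y "P k" x] y xC by (auto simp: O'_def T_def)
        have "k < K" using K xk O'anti[of K k] by (meson not_le subsetD)
        then have "p \<in> ?G" using xk kC by auto
        then show False using n p(2) by blast
      qed
    qed (use G in auto)
    also have "(\<Sum>n\<in>e ` ?G. u n x) = (\<Sum>p\<in>?G. u (e p) x)"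
      using inj_on_subset[OF e_inj G(1)] by (simp add: sum.reindex)
    also have "\<dots> = (\<Sum>p\<in>?G. v p x)"
    proof (intro sum.cong refl)
      fix p assume "p \<in> ?G"
      then have "p \<in> I" using G(1) by blast
      then show "u (e p) x = v p x" by (simp add: u_def)
    qed
    also have "\<dots> = (\<Sum>k\<in>?J. v (k, T k x) x)"
      by (subst sum.reindex) (auto simp: inj_on_def)
    also have "\<dots> = (\<Sum>k\<in>?J. b k x - b (Suc k) x)"
      using stop_self by (intro sum.cong refl) (auto simp: v_def T_def O'_def)
    also have "\<dots> = (\<Sum>k<K. b k x - b (Suc k) x)"
      using O'dec by (intro sum.mono_neutral_left) (auto simp: b_def)
    also have "\<dots> = b 0 x - b K x" by (rule sum_lessThan_telescope')
    also have "\<dots> = f x - g x" using K by (simp add: g_def b_def)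
    finally show "(\<lambda>i. u i x) sums (f x - g x)" .
  qed
  show ?thesis
    using gm g_le props sum_le sums by (intro exI[of _ g] exI[of _ u] exI[of _ \<beta>] exI[of _ RR]) blast
qed

end

section \<open>Splitting the shapes of Calderon-Zygmund sets\<close>

text \<open>A triple \<open>(k, t, r)\<close>, called a shape, describes the products of dyadic cubes of side \<open>2\<^sup>k\<close> with the
interval from \<open>e\<^sup>t\<^sup>-\<^sup>r\<close> to \<open>e\<^sup>t\<^sup>+\<^sup>r\<close>. The condition on Calderon-Zygmund sets with \<open>a = e\<^sup>t\<close> says that the side
lies between \<open>min_side t r\<close> and \<open>max_side t r\<close>.\<close>

definition min_side :: "real \<Rightarrow> real \<Rightarrow> real" where
  "min_side t r = (if r < 1 then exp (t + 2) * r else exp (t + 2 * r))"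

definition max_side :: "real \<Rightarrow> real \<Rightarrow> real" where
  "max_side t r = (if r < 1 then exp (t + 8) * r else exp (t + 8 * r))"

definition admissible :: "int \<times> real \<times> real \<Rightarrow> bool" where
  "admissible = (\<lambda>(k, t, r). 0 < r \<and> min_side t r \<le> 2 powi k \<and> 2 powi k < max_side t r)"

text \<open>The cube is halved as long as it remains wide enough for the interval; otherwise the interval is
halved and the half that contains \<open>s\<close> is kept. Which move is made depends on the shape only, so that
all cubes over the same interval are treated alike.\<close>

definition refine :: "real \<Rightarrow> int \<times> real \<times> real \<Rightarrow> int \<times> real \<times> real" where
  "refine s = (\<lambda>(k, t, r). if min_side t r \<le> 2 powi (k - 1) then (k - 1, t, r)
     else if s \<le> t then (k, t - r / 2, r / 2) else (k, t + r / 2, r / 2))"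

definition in_shape :: "real \<Rightarrow> int \<times> real \<times> real \<Rightarrow> bool" where
  "in_shape s = (\<lambda>(k, t, r). t - r < s \<and> s \<le> t + r)"

text \<open>Cells are half-open in both factors, which makes each generation an exact partition. The closed
Calderon-Zygmund set differs from the cell by a null set.\<close>

definition cell_box :: "int \<times> real \<times> real \<Rightarrow> real^'n \<Rightarrow> ((real^'n) \<times> real) set" where
  "cell_box = (\<lambda>(k, t, r) x. {y. \<forall>i. \<lfloor>y $ i / 2 powi k\<rfloor> = \<lfloor>x $ i / 2 powi k\<rfloor>} \<times> {exp (t - r)<..exp (t + r)})"

lemma mult_exp_le: "c \<le> 1 + (y - x) \<Longrightarrow> c * exp x \<le> exp (y :: real)"
proof -
  assume "c \<le> 1 + (y - x)"
  then have "c \<le> exp (y - x)" using exp_ge_add_one_self[of "y - x"] by linarith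
  then have "c * exp x \<le> exp (y - x) * exp x" by (rule mult_right_mono) simp
  then show ?thesis by (simp add: exp_add[symmetric])
qed

text \<open>These two inequalities make the splitting work: a cube that is too narrow to be halved has side
between \<open>min_side t r\<close> and twice that number, which is admissible for both halves of the interval.\<close>

lemma side_bounds_half:
  assumes "0 < r" "\<bar>t' - t\<bar> \<le> r / 2"
  shows "min_side t' (r / 2) \<le> min_side t r" "2 * min_side t r \<le> max_side t' (r / 2)"
proof -
  consider "r < 1" | "1 \<le> r" "r < 2" | "2 \<le> r" by linarith
  then have "min_side t' (r / 2) \<le> min_side t r \<and> 2 * min_side t r \<le> max_side t' (r / 2)"
  proof cases
    case 1
    have "1 / 2 * exp (t' + 2) \<le> exp (t + 2)" using assms 1 by (intro mult_exp_le) linarith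
    then have a: "1 / 2 * exp (t' + 2) * r \<le> exp (t + 2) * r" using assms by (intro mult_right_mono) auto
    have "4 * exp (t + 2) \<le> exp (t' + 8)" using assms 1 by (intro mult_exp_le) linarith
    then have "4 * exp (t + 2) * r \<le> exp (t' + 8) * r" using assms by (intro mult_right_mono) auto
    then show ?thesis using a 1 by (simp add: min_side_def max_side_def)
  next
    case 2
    have "r / 2 * exp (t' + 2) \<le> exp (t + 2 * r)" using assms 2 by (intro mult_exp_le) linarith
    moreover have "4 * exp (t + 2 * r) \<le> exp (t' + 8)" using assms 2 by (intro mult_exp_le) linarith
    moreover have "exp (t' + 8) * 1 \<le> exp (t' + 8) * r" using 2 by (intro mult_left_mono) auto
    ultimately have "exp (t' + 2) * (r / 2) \<le> exp (t + 2 * r)" "2 * exp (t + 2 * r) \<le> exp (t' + 8) * (r / 2)"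
      by (simp_all only: mult.commute)
    then show ?thesis using 2 by (simp add: min_side_def max_side_def)
  next
    case 3
    have "2 * exp (t + 2 * r) \<le> exp (t' + 8 * (r / 2))" using assms 3 by (intro mult_exp_le) linarith
    moreover have "t' + r \<le> t + 2 * r" using assms by linarith
    ultimately show ?thesis using 3 by (simp add: min_side_def max_side_def)
  qed
  then show "min_side t' (r / 2) \<le> min_side t r" "2 * min_side t r \<le> max_side t' (r / 2)" by auto
qed

lemma two_powi_pred: "2 * 2 powi (k - 1) = (2 :: real) powi k"
  by (simp add: power_int_diff)

lemma admissible_refine:
  assumes "admissible \<sigma>"
  shows "admissible (refine s \<sigma>)"
proof -
  obtain k t r where \<sigma>: "\<sigma> = (k, t, r)" by (cases \<sigma>)
  have a: "0 < r" "min_side t r \<le> 2 powi k" "2 powi k < max_side t r" using assms by (auto simp: \<sigma> admissible_def)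
  have p: "0 < (2 :: real) powi (k - 1)" by simp
  show ?thesis
  proof (cases "min_side t r \<le> 2 powi (k - 1)")
    case True
    moreover have "2 powi (k - 1) < max_side t r" using a(3) p two_powi_pred[of k] by linarith
    ultimately show ?thesis using a by (simp add: \<sigma> admissible_def refine_def)
  next
    case False
    then have "2 powi k < 2 * min_side t r" using two_powi_pred[of k] by simp
    then show ?thesis
      using False a side_bounds_half[of r "t - r / 2" t] side_bounds_half[of r "t + r / 2" t]
      by (auto simp: \<sigma> admissible_def refine_def)
  qed
qed

lemma in_shape_refine:
  assumes "in_shape s' (refine s \<sigma>)" "admissible \<sigma>" "in_shape s \<sigma>"
  shows "in_shape s' \<sigma>" "refine s' \<sigma> = refine s \<sigma>"
proof -
  obtain k t r where \<sigma>: "\<sigma> = (k, t, r)" by (cases \<sigma>)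
  have r: "0 < r" using assms(2) by (simp add: \<sigma> admissible_def)
  have s: "t - r < s" "s \<le> t + r" using assms(3) by (auto simp: \<sigma> in_shape_def)
  consider "min_side t r \<le> 2 powi (k - 1)" | "\<not> min_side t r \<le> 2 powi (k - 1)" "s \<le> t" | "\<not> min_side t r \<le> 2 powi (k - 1)" "t < s"
    by linarith
  then have "in_shape s' \<sigma> \<and> refine s' \<sigma> = refine s \<sigma>"
    by cases (use assms(1) r in \<open>simp_all add: \<sigma> refine_def in_shape_def\<close>)
  then show "in_shape s' \<sigma>" "refine s' \<sigma> = refine s \<sigma>" by auto
qed

lemma in_shape_refine_self:
  assumes "in_shape s \<sigma>"
  shows "in_shape s (refine s \<sigma>)"
  using assms by (cases \<sigma>) (auto simp: refine_def in_shape_def)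

primrec shape :: "(real \<Rightarrow> int \<times> real \<times> real) \<Rightarrow> nat \<Rightarrow> real \<Rightarrow> int \<times> real \<times> real" where
  "shape \<sigma> 0 s = \<sigma> s"
| "shape \<sigma> (Suc n) s = refine s (shape \<sigma> n s)"

lemma countable_shapes:
  assumes "countable (range \<sigma>)"
  shows "countable (range (shape \<sigma> n))"
proof (induction n)
  case (Suc n)
  have "range (shape \<sigma> (Suc n)) \<subseteq> (\<Union>(k, t, r)\<in>range (shape \<sigma> n). {(k - 1, t, r), (k, t - r / 2, r / 2), (k, t + r / 2, r / 2)})"
  proof
    fix \<tau> assume "\<tau> \<in> range (shape \<sigma> (Suc n))"
    then obtain s where s: "\<tau> = refine s (shape \<sigma> n s)" by auto
    obtain k t r where e: "shape \<sigma> n s = (k, t, r)" by (cases "shape \<sigma> n s")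
    have "(k, t, r) \<in> range (shape \<sigma> n)" using e by (metis rangeI)
    moreover have "\<tau> \<in> {(k - 1, t, r), (k, t - r / 2, r / 2), (k, t + r / 2, r / 2)}"
      unfolding s e refine_def by simp
    ultimately show "\<tau> \<in> (\<Union>(k, t, r)\<in>range (shape \<sigma> n). {(k - 1, t, r), (k, t - r / 2, r / 2), (k, t + r / 2, r / 2)})"
      by blast
  qed
  moreover have "countable (\<Union>(k, t, r)\<in>range (shape \<sigma> n). {(k - 1, t, r), (k, t - r / 2, r / 2), (k, t + r / 2, r / 2)})"
    using Suc by (intro countable_UN) auto
  ultimately show ?case by (rule countable_subset)
qed (simp add: assms)

lemma shape_props:
  assumes "admissible (\<sigma> s)" "in_shape s (\<sigma> s)" and "\<And>s'. in_shape s' (\<sigma> s) \<Longrightarrow> \<sigma> s' = \<sigma> s"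
  shows "admissible (shape \<sigma> n s)" "in_shape s (shape \<sigma> n s)"
    "\<And>s'. in_shape s' (shape \<sigma> n s) \<Longrightarrow> shape \<sigma> n s' = shape \<sigma> n s"
proof -
  have "admissible (shape \<sigma> n s) \<and> in_shape s (shape \<sigma> n s) \<and> (\<forall>s'. in_shape s' (shape \<sigma> n s) \<longrightarrow> shape \<sigma> n s' = shape \<sigma> n s)"
  proof (induction n)
    case (Suc n)
    then have ih: "admissible (shape \<sigma> n s)" "in_shape s (shape \<sigma> n s)"
      "\<And>s'. in_shape s' (shape \<sigma> n s) \<Longrightarrow> shape \<sigma> n s' = shape \<sigma> n s" by blast+
    have "shape \<sigma> (Suc n) s' = shape \<sigma> (Suc n) s" if "in_shape s' (shape \<sigma> (Suc n) s)" for s'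
    proof -
      have s': "in_shape s' (refine s (shape \<sigma> n s))" using that by simp
      have "shape \<sigma> n s' = shape \<sigma> n s" using ih(3) in_shape_refine(1)[OF s' ih(1,2)] .
      then show ?thesis using in_shape_refine(2)[OF s' ih(1,2)] by (metis shape.simps(2))
    qed
    then show ?case
      using admissible_refine[OF ih(1)] in_shape_refine_self[OF ih(2)] unfolding shape.simps by blast
  qed (use assms in \<open>unfold shape.simps, blast\<close>)
  then show "admissible (shape \<sigma> n s)" "in_shape s (shape \<sigma> n s)"
    "\<And>s'. in_shape s' (shape \<sigma> n s) \<Longrightarrow> shape \<sigma> n s' = shape \<sigma> n s" by blast+
qed

text \<open>Each step halves the product of side and radius. As \<open>t\<close> stays bounded, the side is at least a constant
times \<open>min 1 r\<close>, so the radius tends to \<open>0\<close>. The upper bound for the side then takes the side to \<open>0\<close> as well.\<close>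

lemma shape_shrinks:
  assumes adm: "admissible (\<sigma> s)" and ins: "in_shape s (\<sigma> s)" and \<delta>: "0 < \<delta>"
  obtains n k t r where "shape \<sigma> n s = (k, t, r)" "2 powi k < \<delta>" "r < \<delta>"
proof -
  obtain k0 t0 r0 where 0: "\<sigma> s = (k0, t0, r0)" by (cases "\<sigma> s")
  define P0 where "P0 = 2 powi k0 * r0"
  have inv: "\<exists>k t r. shape \<sigma> n s = (k, t, r) \<and> admissible (k, t, r) \<and> 2 powi k * r = P0 / 2 ^ n \<and>
      t0 - r0 \<le> t - r \<and> t + r \<le> t0 + r0" for n
  proof (induction n)
    case 0
    show ?case using \<open>\<sigma> s = (k0, t0, r0)\<close> adm by (auto simp: P0_def)
  next
    case (Suc n)
    then obtain k t r where e: "shape \<sigma> n s = (k, t, r)" and a: "admissible (k, t, r)"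
      and p: "2 powi k * r = P0 / 2 ^ n" and b: "t0 - r0 \<le> t - r" "t + r \<le> t0 + r0" by blast
    obtain k' t' r' where e': "refine s (k, t, r) = (k', t', r')" by (cases "refine s (k, t, r)")
    have r: "0 < r" using a by (simp add: admissible_def)
    have "2 powi k' * r' = 2 powi k * r / 2"
      using e' two_powi_pred[of k] by (auto simp: refine_def split: if_splits)
    then have "2 powi k' * r' = P0 / 2 ^ Suc n" using p by simp
    moreover have "t0 - r0 \<le> t' - r'" "t' + r' \<le> t0 + r0"
      using e' b r by (auto simp: refine_def split: if_splits)
    moreover have "admissible (k', t', r')" using admissible_refine[OF a] e' by metis
    ultimately show ?case using e e' by auto
  qed
  \<comment> \<open>A radius below \<open>d < 1\<close> has the formula of \<open>max_side\<close> for \<open>r < 1\<close>, which then gives a side below \<open>\<delta>\<close>.\<close>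
  define d where "d = min (1 / 2) (min \<delta> (\<delta> / exp (t0 + r0 + 8)))"
  have d: "0 < d" "d < 1" "d \<le> \<delta>" "d \<le> \<delta> / exp (t0 + r0 + 8)" using \<delta> by (auto simp: d_def)
  obtain n :: nat where n: "P0 / (exp (t0 - r0) * d * d) < 2 ^ n" using real_arch_pow[of 2] by auto
  obtain k t r where e: "shape \<sigma> n s = (k, t, r)" and a: "admissible (k, t, r)"
    and p: "2 powi k * r = P0 / 2 ^ n" and b: "t0 - r0 \<le> t - r" "t + r \<le> t0 + r0"
    using inv by blast
  have r: "0 < r" "min_side t r \<le> 2 powi k" "2 powi k < max_side t r" using a by (auto simp: admissible_def)
  have "r < d"
  proof (rule ccontr)
    assume "\<not> r < d"
    then have rd: "d \<le> r" by simp
    have "exp (t0 - r0) * d \<le> min_side t r"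
    proof (cases "r < 1")
      case True
      have "exp (t0 - r0) * d \<le> exp (t + 2) * r" using b r d rd by (intro mult_mono) auto
      then show ?thesis using True by (simp add: min_side_def)
    next
      case False
      have "exp (t0 - r0) * d \<le> exp (t + 2 * r) * 1" using b r d by (intro mult_mono) auto
      then show ?thesis using False by (simp add: min_side_def)
    qed
    then have "exp (t0 - r0) * d \<le> 2 powi k" using r by simp
    then have "exp (t0 - r0) * d * d \<le> 2 powi k * r" using rd d by (intro mult_mono) auto
    also have "\<dots> = P0 / 2 ^ n" by (rule p)
    finally have "2 ^ n \<le> P0 / (exp (t0 - r0) * d * d)" using d by (simp add: field_simps)
    then show False using n by simp
  qed
  moreover have "2 powi k < \<delta>"
  proof -
    have "2 powi k < exp (t + 8) * r" using r \<open>r < d\<close> d by (simp add: max_side_def)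
    also have "\<dots> \<le> exp (t0 + r0 + 8) * d" using b r \<open>r < d\<close> by (intro mult_mono) auto
    also have "\<dots> \<le> \<delta>" using d(4) by (simp add: field_simps)
    finally show ?thesis .
  qed
  ultimately show ?thesis using that[OF e] d(3) by linarith
qed

section \<open>Half-open cells and their measure\<close>

definition dcube :: "int \<Rightarrow> real^'n \<Rightarrow> (real^'n) set" where
  "dcube k x = {y. \<forall>i. \<lfloor>y $ i / 2 powi k\<rfloor> = \<lfloor>x $ i / 2 powi k\<rfloor>}"

lemma box_eq: "cell_box (k, t, r) x = dcube k x \<times> {exp (t - r)<..exp (t + r)}"
  by (simp add: cell_box_def dcube_def)

lemma dcube_eq:
  "dcube k x = {y. \<forall>i. 2 powi k * of_int \<lfloor>x $ i / 2 powi k\<rfloor> \<le> y $ i \<and> y $ i < 2 powi k * (of_int \<lfloor>x $ i / 2 powi k\<rfloor> + 1)}"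
proof -
  have p: "0 < (2 :: real) powi k" by simp
  have "\<lfloor>y / 2 powi k\<rfloor> = m \<longleftrightarrow> 2 powi k * of_int m \<le> y \<and> y < 2 powi k * (of_int m + 1)" for y :: real and m
    unfolding floor_eq_iff using p by (simp add: pos_le_divide_eq pos_divide_less_eq mult.commute)
  then show ?thesis by (simp add: dcube_def)
qed

lemma in_exp_interval_iff: "0 < a \<Longrightarrow> a \<in> {exp (t - r)<..exp (t + r)} \<longleftrightarrow> in_shape (ln a) (k, t, r)"
proof -
  assume "0 < a"
  then have "a = exp (ln a)" by simp
  then have "(exp (t - r) < a \<longleftrightarrow> t - r < ln a) \<and> (a \<le> exp (t + r) \<longleftrightarrow> ln a \<le> t + r)"
    by (metis exp_le_cancel_iff exp_less_cancel_iff)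
  then show ?thesis by (simp add: in_shape_def)
qed

lemma box_subset_S: "cell_box \<sigma> x \<subseteq> S_set"
  by (cases \<sigma>) (auto simp: box_eq S_set_def intro: less_trans[OF exp_gt_zero])

definition closed_box :: "int \<times> real \<times> real \<Rightarrow> real^'n \<Rightarrow> ((real^'n) \<times> real) set" where
  "closed_box = (\<lambda>(k, t, r) x. dcube k x \<times> {exp (t - r)..exp (t + r)})"

lemma closed_box_CZ:
  assumes "admissible \<sigma>"
  shows "closed_box \<sigma> x \<in> CZ_sets"
proof -
  obtain k t r where \<sigma>: "\<sigma> = (k, t, r)" by (cases \<sigma>)
  have "dyadic_cube (dcube k x) (2 powi k)"
    unfolding dyadic_cube_def using dcube_eq[of k x]
    by (intro exI[of _ k] exI[of _ "\<lambda>i. \<lfloor>x $ i / 2 powi k\<rfloor>"]) simp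
  then show ?thesis
    using assms unfolding CZ_sets_def mem_Collect_eq
    by (intro exI[of _ "dcube k x"] exI[of _ "2 powi k"] exI[of _ "exp t"] exI[of _ r])
       (auto simp: \<sigma> admissible_def min_side_def max_side_def closed_box_def exp_add exp_diff exp_minus field_simps)
qed

lemma closed_box_borel: "admissible \<sigma> \<Longrightarrow> closed_box \<sigma> x \<in> sets borel"
  using CZ_set_compact_hull[OF closed_box_CZ] by metis

lemma box_borel:
  assumes "admissible \<sigma>"
  shows "cell_box \<sigma> x \<in> sets borel"
proof -
  obtain k t r where \<sigma>: "\<sigma> = (k, t, r)" by (cases \<sigma>)
  have "cell_box \<sigma> x = closed_box \<sigma> x \<inter> (UNIV \<times> {exp (t - r)<..})"
    by (auto simp: \<sigma> box_eq closed_box_def)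
  moreover have "(UNIV \<times> {exp (t - r)<..} :: ((real^'b) \<times> real) set) \<in> sets borel"
    by (intro borel_open open_Times) auto
  ultimately show ?thesis using closed_box_borel[OF assms] by auto
qed

lemma box_sets [measurable]: "admissible \<sigma> \<Longrightarrow> cell_box \<sigma> x \<in> sets rho"
  by (intro sets_rho box_subset_S box_borel)

lemma closed_box_subset_S: "closed_box \<sigma> x \<subseteq> S_set"
  by (cases \<sigma>) (auto simp: closed_box_def S_set_def intro: less_le_trans[OF exp_gt_zero])

lemma closed_box_sets: "admissible \<sigma> \<Longrightarrow> closed_box \<sigma> x \<in> sets rho"
  by (intro sets_rho closed_box_subset_S closed_box_borel)

lemma emeasure_rho:
  assumes A: "A \<subseteq> S_set" "A \<in> sets borel"
  shows "emeasure rho A = (\<integral>\<^sup>+z\<in>A. ennreal (1 / snd z) \<partial>lborel)"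
proof -
  have m: "(\<lambda>(x, a). ennreal (1 / a)) \<in> borel_measurable (restrict_space lborel S_set)"
    by (intro measurable_restrict_space1) (simp add: borel_prod[symmetric] split_beta')
  have "emeasure rho A = (\<integral>\<^sup>+z. (case z of (x, a) \<Rightarrow> ennreal (1 / a)) * indicator A z \<partial>restrict_space lborel S_set)"
    unfolding rho_def using A sets_rho[OF A] by (intro emeasure_density m) (simp add: rho_def)
  also have "\<dots> = (\<integral>\<^sup>+z. (case z of (x, a) \<Rightarrow> ennreal (1 / a)) * indicator A z * indicator S_set z \<partial>lborel)"
    by (rule nn_integral_restrict_space) (simp add: S_set_borel)
  also have "\<dots> = (\<integral>\<^sup>+z\<in>A. ennreal (1 / snd z) \<partial>lborel)"
    using A by (intro nn_integral_cong) (auto split: split_indicator)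
  finally show ?thesis .
qed

lemma emeasure_rho_Times:
  fixes C :: "(real^'n) set"
  assumes C: "C \<in> sets borel" and I: "I \<in> sets borel" "I \<subseteq> {0<..}"
  shows "emeasure rho (C \<times> I) = emeasure lborel C * (\<integral>\<^sup>+a\<in>I. ennreal (1 / a) \<partial>lborel)"
proof -
  have [measurable]: "C \<in> sets borel" "I \<in> sets borel" using C I by auto
  have "emeasure rho (C \<times> I) = (\<integral>\<^sup>+z\<in>C \<times> I. ennreal (1 / snd z) \<partial>(lborel \<Otimes>\<^sub>M lborel))"
    unfolding lborel_prod
    by (rule emeasure_rho) (use I borel_Times[OF C I(1)] in \<open>auto simp: S_set_def\<close>)
  also have "\<dots> = (\<integral>\<^sup>+x. \<integral>\<^sup>+a. ennreal (1 / a) * indicator (C \<times> I) (x, a) \<partial>lborel \<partial>lborel)"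
    by (subst lborel.nn_integral_fst[symmetric]) auto
  also have "\<dots> = (\<integral>\<^sup>+x. indicator C x * (\<integral>\<^sup>+a\<in>I. ennreal (1 / a) \<partial>lborel) \<partial>lborel)"
    by (intro nn_integral_cong) (auto split: split_indicator intro!: nn_integral_cong)
  also have "\<dots> = emeasure lborel C * (\<integral>\<^sup>+a\<in>I. ennreal (1 / a) \<partial>lborel)"
    by (simp add: nn_integral_multc)
  finally show ?thesis .
qed

lemma nn_integral_inverse_interval:
  assumes "0 < u" "u \<le> v"
  shows "(\<integral>\<^sup>+a\<in>{u<..v}. ennreal (1 / a) \<partial>lborel) = ennreal (ln v - ln u)"
proof -
  have "(\<integral>\<^sup>+a\<in>{u<..v}. ennreal (1 / a) \<partial>lborel) = (\<integral>\<^sup>+a\<in>{u..v}. ennreal (1 / a) \<partial>lborel)"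
    using AE_lborel_singleton[of u]
    by (intro nn_integral_cong_AE) (auto split: split_indicator elim!: eventually_mono)
  also have "\<dots> = ennreal (ln v - ln u)"
  proof -
    have "(\<lambda>a :: real. 1 / a) \<in> borel_measurable borel" by measurable
    moreover have "DERIV ln x :> 1 / x" if "u \<le> x" for x
      using that assms by (intro DERIV_ln_divide) auto
    moreover have "0 \<le> 1 / x" if "u \<le> x" for x using that assms by simp
    ultimately show ?thesis using assms by (intro nn_integral_FTC_Icc) auto
  qed
  finally show ?thesis .
qed

text \<open>The half-open cube lies between the open and the closed box with the same corners, and these have
equal measure.\<close>

lemma emeasure_dcube: "emeasure lborel (dcube k x :: (real^'n) set) = ennreal ((2 powi k) ^ CARD('n))"
proof -
  let ?L = "2 powi k :: real"
  let ?u = "(\<chi> i. ?L * of_int \<lfloor>x $ i / ?L\<rfloor>) :: real^'n" and ?v = "(\<chi> i. ?L * (of_int \<lfloor>x $ i / ?L\<rfloor> + 1)) :: real^'n"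
  have L: "0 < ?L" by simp
  have d: "?v - ?u = (\<chi> i. ?L)" by (simp add: vec_eq_iff algebra_simps)
  have in1: "b \<in> Basis \<Longrightarrow> (\<chi> i. ?L) \<bullet> b = ?L" for b :: "real^'n"
    by (auto simp: Basis_vec_def inner_axis)
  have pr: "(\<Prod>b\<in>(Basis :: (real^'n) set). (?v - ?u) \<bullet> b) = ?L ^ CARD('n)"
    unfolding d by (subst prod.cong[OF refl in1]) simp_all
  have le: "?u \<bullet> b \<le> ?v \<bullet> b" if "b \<in> Basis" for b
  proof -
    have "(?v - ?u) \<bullet> b = ?L" unfolding d using in1[OF that] .
    then show ?thesis using L unfolding inner_diff_left by linarith
  qed
  have 1: "emeasure lborel (box ?u ?v) = ennreal (?L ^ CARD('n))"
    using emeasure_lborel_box[OF le] pr by simp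
  have 2: "emeasure lborel (cbox ?u ?v) = ennreal (?L ^ CARD('n))"
    using emeasure_lborel_cbox[OF le] pr by simp
  have C: "dcube k x \<in> sets borel"
  proof -
    have "{y :: real^'n. c \<le> y $ i \<and> y $ i < d} \<in> sets borel" for c d i
      by measurable
    moreover have "dcube k x = (\<Inter>i\<in>UNIV. {y. ?L * of_int \<lfloor>x $ i / ?L\<rfloor> \<le> y $ i \<and> y $ i < ?L * (of_int \<lfloor>x $ i / ?L\<rfloor> + 1)})"
      unfolding dcube_eq by auto
    ultimately show ?thesis by (simp only:) (intro sets.finite_INT finite UNIV_not_empty)
  qed
  have "box ?u ?v \<subseteq> dcube k x" "dcube k x \<subseteq> cbox ?u ?v"
    unfolding dcube_eq by (auto simp: mem_box_cart less_imp_le)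
  then have "emeasure lborel (box ?u ?v) \<le> emeasure lborel (dcube k x)"
    "emeasure lborel (dcube k x) \<le> emeasure lborel (cbox ?u ?v)"
    using C by (auto intro!: emeasure_mono)
  then show ?thesis using 1 2 by simp
qed

lemma dcube_borel: "dcube k (x :: real^'n) \<in> sets borel"
  using emeasure_dcube[of k x] by (metis emeasure_notin_sets ennreal_eq_0_iff less_irrefl not_le sets_lborel zero_less_power zero_less_power_int zero_less_numeral)

lemma emeasure_box:
  assumes "0 < r"
  shows "emeasure rho (cell_box (k, t, r) (x :: real^'n)) = ennreal ((2 powi k) ^ CARD('n) * (2 * r))"
proof -
  have "emeasure rho (cell_box (k, t, r) x) = emeasure lborel (dcube k x) * (\<integral>\<^sup>+a\<in>{exp (t - r)<..exp (t + r)}. ennreal (1 / a) \<partial>lborel)"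
    unfolding box_eq by (intro emeasure_rho_Times dcube_borel) (auto intro: less_trans[OF exp_gt_zero])
  also have "\<dots> = ennreal ((2 powi k) ^ CARD('n)) * ennreal (2 * r)"
    using assms by (subst nn_integral_inverse_interval) (auto simp: emeasure_dcube)
  finally show ?thesis using assms by (simp add: ennreal_mult)
qed

lemma measure_box:
  assumes "0 < r"
  shows "measure rho (cell_box (k, t, r) (x :: real^'n)) = (2 powi k) ^ CARD('n) * (2 * r)"
  using emeasure_box[OF assms, of k t x] assms by (intro measure_eq_emeasure_eq_ennreal) auto

lemma closed_box_null:
  assumes "admissible \<sigma>"
  shows "cell_box \<sigma> x \<subseteq> closed_box \<sigma> x" "emeasure rho (closed_box \<sigma> x - cell_box \<sigma> x) = 0"
proof -
  obtain k t r where \<sigma>: "\<sigma> = (k, t, r)" by (cases \<sigma>)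
  show sub: "cell_box \<sigma> x \<subseteq> closed_box \<sigma> x" by (auto simp: \<sigma> box_eq closed_box_def)
  have sub2: "closed_box \<sigma> x - cell_box \<sigma> x \<subseteq> dcube k x \<times> {exp (t - r)}"
    by (auto simp: \<sigma> box_eq closed_box_def)
  have "emeasure rho (closed_box \<sigma> x - cell_box \<sigma> x) \<le> emeasure rho (dcube k x \<times> {exp (t - r)})"
    using sub2 by (rule emeasure_mono) (intro sets_rho borel_Times dcube_borel, auto simp: S_set_def)
  also have "\<dots> = emeasure lborel (dcube k x) * (\<integral>\<^sup>+a\<in>{exp (t - r)}. ennreal (1 / a) \<partial>lborel)"
    by (intro emeasure_rho_Times dcube_borel) auto
  also have "(\<integral>\<^sup>+a\<in>{exp (t - r)}. ennreal (1 / a) \<partial>lborel) = 0"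
    using AE_lborel_singleton[of "exp (t - r)"]
    by (subst nn_integral_0_iff_AE) (auto elim!: eventually_mono)
  finally show "emeasure rho (closed_box \<sigma> x - cell_box \<sigma> x) = 0" by simp
qed

text \<open>The density \<open>1/a\<close> is unbounded on the group, so regularity is taken from the finite measure obtained
by cutting it off outside \<open>R\<close>.\<close>

lemma rho_outer_regular:
  fixes R :: "((real^'n) \<times> real) set"
  assumes R: "R \<in> sets borel" "R \<subseteq> S_set" "emeasure rho R < \<infinity>" and A: "A \<in> sets borel" "A \<subseteq> R" and e: "0 < e"
  shows "\<exists>U. open U \<and> A \<subseteq> U \<and> emeasure rho (U \<inter> R) \<le> emeasure rho A + ennreal e"
proof -
  define M where "M = density lborel (\<lambda>z. ennreal (1 / snd z) * indicator R z :: ennreal)"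
  have [measurable]: "R \<in> sets borel" by fact
  have [measurable]: "(\<lambda>z :: (real^'n) \<times> real. ennreal (1 / snd z)) \<in> borel_measurable borel"
    by (simp add: borel_prod[symmetric])
  have [measurable]: "(\<lambda>z. ennreal (1 / snd z) * indicator R z) \<in> borel_measurable borel"
    by measurable
  have sM: "sets M = sets borel" by (simp add: M_def)
  have eM: "emeasure M B = emeasure rho (B \<inter> R)" if "B \<in> sets borel" for B
  proof -
    have "emeasure M B = (\<integral>\<^sup>+z. ennreal (1 / snd z) * indicator R z * indicator B z \<partial>lborel)"
      unfolding M_def using that by (intro emeasure_density) auto
    also have "\<dots> = (\<integral>\<^sup>+z\<in>B \<inter> R. ennreal (1 / snd z) \<partial>lborel)"
      by (intro nn_integral_cong) (auto split: split_indicator)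
    also have "\<dots> = emeasure rho (B \<inter> R)"
      using that R by (intro emeasure_rho[symmetric]) auto
    finally show ?thesis .
  qed
  have fin: "emeasure M (space M) \<noteq> \<infinity>"
    using eM[of UNIV] R(3) by (simp add: M_def)
  have "emeasure M A = (INF U\<in>{U. A \<subseteq> U \<and> open U}. emeasure M U)"
    using outer_regular[OF sM fin A(1)] .
  moreover have "emeasure M A < emeasure M A + ennreal e"
    using e eM[OF A(1)] A(2) R(3) emeasure_mono[of A R rho] sets_rho[OF R(2,1)]
    by (simp add: Int_absorb2 ennreal_less_top order.strict_trans1)
  ultimately obtain U where "A \<subseteq> U" "open U" "emeasure M U < emeasure M A + ennreal e"
    by (metis (no_types, lifting) INF_less_iff mem_Collect_eq)
  then show ?thesis
    using eM[of U] eM[OF A(1)] A(2) by (intro exI[of _ U]) (auto simp: Int_absorb2 less_imp_le)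
qed

lemma sets_rho_borel: "A \<in> sets rho \<Longrightarrow> A \<in> sets borel"
  by (auto simp: rho_def sets_restrict_space_iff S_set_borel)

lemma dcube_pred_subset: "dcube (k - 1) x \<subseteq> dcube k x"
proof -
  have "\<lfloor>y / 2 powi k\<rfloor> = \<lfloor>y / 2 powi (k - 1)\<rfloor> div 2" for y :: real
  proof -
    have "y / 2 powi k = y / 2 powi (k - 1) / real_of_int 2"
      using two_powi_pred[of k] by (simp add: field_simps)
    moreover have "\<lfloor>y / 2 powi (k - 1) / real_of_int 2\<rfloor> = \<lfloor>y / 2 powi (k - 1)\<rfloor> div 2"
      by (rule floor_divide_real_eq_div) simp
    ultimately show ?thesis by (simp only:)
  qed
  then show ?thesis by (auto simp: dcube_def)
qed

lemma box_refine_subset: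
  assumes "admissible \<sigma>"
  shows "cell_box (refine s \<sigma>) x \<subseteq> cell_box \<sigma> x"
proof -
  obtain k t r where \<sigma>: "\<sigma> = (k, t, r)" by (cases \<sigma>)
  have r: "0 < r" using assms by (simp add: \<sigma> admissible_def)
  have sub: "{exp u<..exp v} \<subseteq> {exp u'<..exp v'}" if "u' \<le> u" "v \<le> v'" for u v u' v' :: real
  proof
    fix b assume "b \<in> {exp u<..exp v}"
    moreover have "exp u' \<le> exp u" "exp v \<le> exp v'" using that by simp_all
    ultimately show "b \<in> {exp u'<..exp v'}" by (simp only: greaterThanAtMost_iff) linarith
  qed
  have i1: "{exp (t - r / 2 - r / 2)<..exp (t - r / 2 + r / 2)} \<subseteq> {exp (t - r)<..exp (t + r)}"
    using r by (intro sub) linarith+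
  have i2: "{exp (t + r / 2 - r / 2)<..exp (t + r / 2 + r / 2)} \<subseteq> {exp (t - r)<..exp (t + r)}"
    using r by (intro sub) linarith+
  show ?thesis
    unfolding \<sigma> refine_def prod.case
    by (simp only: box_eq split: if_splits) (intro conjI impI Sigma_mono dcube_pred_subset i1 i2 order.refl)
qed

lemma measure_box_refine:
  assumes "admissible \<sigma>"
  shows "measure rho (cell_box \<sigma> (x :: real^'n)) \<le> 2 ^ CARD('n) * measure rho (cell_box (refine s \<sigma>) x)"
proof -
  obtain k t r where \<sigma>: "\<sigma> = (k, t, r)" by (cases \<sigma>)
  have r: "0 < r" using assms by (simp add: \<sigma> admissible_def)
  have c: "(2 :: real) \<le> 2 ^ CARD('n)"
    using power_increasing[of 1 "CARD('n)" "2 :: real"] zero_less_card_finite[where 'a = 'n] by simp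
  let ?V = "((2 :: real) powi k) ^ CARD('n)"
  have V: "?V = 2 ^ CARD('n) * (2 powi (k - 1)) ^ CARD('n)"
    unfolding two_powi_pred[symmetric, of k] by (rule power_mult_distrib)
  have half: "measure rho (cell_box (k, t', r / 2) x) = ?V * r" for t'
    using r by (subst measure_box) auto
  have "?V * (2 * r) \<le> 2 ^ CARD('n) * (?V * r)"
    using mult_right_mono[OF c, of "?V * r"] r by (simp add: mult_ac)
  then have "measure rho (cell_box (k, t, r) x) \<le> 2 ^ CARD('n) * measure rho (cell_box (k, t', r / 2) x)" for t'
    unfolding half measure_box[OF r] .
  moreover have "measure rho (cell_box (k, t, r) x) \<le> 2 ^ CARD('n) * measure rho (cell_box (k - 1, t, r) x)"
    unfolding measure_box[OF r] V by simp
  ultimately show ?thesis unfolding \<sigma> refine_def by simp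
qed

lemma box_shrinks:
  fixes x :: "real^'n"
  assumes adm: "admissible (\<sigma> (ln a))" and ins: "in_shape (ln a) (\<sigma> (ln a))"
    and inv: "\<And>s'. in_shape s' (\<sigma> (ln a)) \<Longrightarrow> \<sigma> s' = \<sigma> (ln a)"
    and a: "0 < a" and U: "open U" "(x, a) \<in> U"
  shows "\<exists>n. cell_box (shape \<sigma> n (ln a)) x \<subseteq> U"
proof -
  obtain A B where AB: "open A" "open B" "x \<in> A" "a \<in> B" "A \<times> B \<subseteq> U" using U by (rule open_prod_elim) auto
  obtain d1 where d1: "0 < d1" "\<And>y. dist y x < d1 \<Longrightarrow> y \<in> A" using AB(1,3) by (auto simp: open_dist)
  have "open (exp -` B :: real set)" using AB(2) by (intro open_vimage continuous_intros)
  moreover have "ln a \<in> exp -` B" using AB(4) a by simp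
  ultimately obtain d2 where d2: "0 < d2" "\<And>s. dist s (ln a) < d2 \<Longrightarrow> exp s \<in> B"
    unfolding open_dist by auto
  define c where "c = real CARD('n)"
  have c: "1 \<le> c" unfolding c_def using zero_less_card_finite[where 'a = 'n] by (simp add: Suc_leI)
  define \<delta> where "\<delta> = min (d1 / c) (d2 / 2)"
  have "0 < \<delta>" unfolding \<delta>_def using d1(1) d2(1) c by simp
  moreover have "\<delta> \<le> d1 / c" unfolding \<delta>_def by (rule min.cobounded1)
  moreover have "\<delta> \<le> d2 / 2" unfolding \<delta>_def by (rule min.cobounded2)
  ultimately have \<delta>: "0 < \<delta>" "\<delta> \<le> d1 / c" "\<delta> \<le> d2 / 2" by blast+
  obtain n k t r where n: "shape \<sigma> n (ln a) = (k, t, r)" "2 powi k < \<delta>" "r < \<delta>"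
    using shape_shrinks[of \<sigma> "ln a", OF adm ins \<delta>(1)] .
  have ins': "in_shape (ln a) (k, t, r)" using shape_props(2)[of \<sigma> "ln a" n, OF adm ins inv] n(1) by simp
  have "cell_box (k, t, r) x \<subseteq> A \<times> B"
  proof
    fix z assume z: "z \<in> cell_box (k, t, r) x"
    obtain y b where yb: "z = (y, b)" by (cases z)
    have y: "y \<in> dcube k x" and b: "exp (t - r) < b" "b \<le> exp (t + r)" using z by (auto simp: yb box_eq)
    have x: "x \<in> dcube k x" by (simp add: dcube_def)
    have "\<bar>(y - x) $ i\<bar> \<le> 2 powi k" for i
      using spec[OF y[unfolded dcube_eq mem_Collect_eq], of i] spec[OF x[unfolded dcube_eq mem_Collect_eq], of i]
      by (simp add: distrib_left) linarith
    then have "norm (y - x) \<le> (\<Sum>i\<in>(UNIV :: 'n set). 2 powi k)"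
      by (intro order.trans[OF norm_le_l1_cart] sum_mono)
    also have "\<dots> = c * 2 powi k" by (simp add: c_def)
    also have "\<dots> < c * (d1 / c)" using n(2) \<delta>(2) c by (intro mult_strict_left_mono) auto
    also have "\<dots> = d1" using c by simp
    finally have "y \<in> A" by (intro d1) (simp add: dist_norm)
    have b0: "0 < b" using b(1) exp_gt_zero less_trans by blast
    then have "in_shape (ln b) (k, t, r)" using in_exp_interval_iff[of b t r k] b by auto
    then have "\<bar>ln b - ln a\<bar> < d2" using ins' n(3) \<delta>(3) by (auto simp: in_shape_def)
    then have "exp (ln b) \<in> B" by (intro d2) (simp add: dist_real_def)
    then show "z \<in> A \<times> B" using \<open>y \<in> A\<close> b0 by (simp add: yb)
  qed
  then show ?thesis using AB(5) n(1) by (intro exI[of _ n]) auto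
qed

definition cell_of :: "(real \<Rightarrow> int \<times> real \<times> real) \<Rightarrow> nat \<Rightarrow> (real^'n) \<times> real \<Rightarrow> ((real^'n) \<times> real) set" where
  "cell_of \<sigma> n z = cell_box (shape \<sigma> n (ln (snd z))) (fst z)"

text \<open>A choice \<open>\<sigma>\<close> of starting shapes, one for each value of \<open>ln a\<close>, generates a filtration as soon as
it is constant on the interval of each shape that it takes and \<open>\<Omega>\<close> is a union of cells of these shapes.\<close>

lemma dyadic_filtration_boxes:
  fixes \<Omega> :: "((real^'n) \<times> real) set"
  assumes S: "\<Omega> \<subseteq> S_set" and count: "countable (range \<sigma>)"
    and adm: "\<And>z. z \<in> \<Omega> \<Longrightarrow> admissible (\<sigma> (ln (snd z)))"
    and ins: "\<And>z. z \<in> \<Omega> \<Longrightarrow> in_shape (ln (snd z)) (\<sigma> (ln (snd z)))"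
    and inv: "\<And>z s'. z \<in> \<Omega> \<Longrightarrow> in_shape s' (\<sigma> (ln (snd z))) \<Longrightarrow> \<sigma> s' = \<sigma> (ln (snd z))"
    and sub: "\<And>z. z \<in> \<Omega> \<Longrightarrow> cell_box (\<sigma> (ln (snd z))) (fst z) \<subseteq> \<Omega>"
  shows "dyadic_filtration rho \<Omega> (cell_of \<sigma>) (2 ^ CARD('n))"
proof -
  have adm': "admissible (shape \<sigma> n (ln (snd z)))" if "z \<in> \<Omega>" for z n
    by (rule shape_props(1)[of \<sigma> "ln (snd z)" n, OF adm[OF that] ins[OF that] inv[OF that]])
  have ins': "in_shape (ln (snd z)) (shape \<sigma> n (ln (snd z)))" if "z \<in> \<Omega>" for z n
    by (rule shape_props(2)[of \<sigma> "ln (snd z)" n, OF adm[OF that] ins[OF that] inv[OF that]])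
  have inv': "shape \<sigma> n s' = shape \<sigma> n (ln (snd z))" if "z \<in> \<Omega>" "in_shape s' (shape \<sigma> n (ln (snd z)))" for z n s'
    by (rule shape_props(3)[of \<sigma> "ln (snd z)" s' n, OF adm[OF that(1)] ins[OF that(1)] inv[OF that(1)] that(2)])
  have m: "measure rho (cell_of \<sigma> n z) > 0 \<and> emeasure rho (cell_of \<sigma> n z) < \<infinity>" if "z \<in> \<Omega>" for n z
  proof -
    obtain k t r where e: "shape \<sigma> n (ln (snd z)) = (k, t, r)" by (cases "shape \<sigma> n (ln (snd z))")
    have "0 < r" using adm'[OF that, of n] e by (simp add: admissible_def)
    then show ?thesis unfolding cell_of_def e by (simp add: measure_box emeasure_box)
  qed
  have Suc: "cell_of \<sigma> (Suc n) z \<subseteq> cell_of \<sigma> n z" if "z \<in> \<Omega>" for n z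
    unfolding cell_of_def shape.simps by (rule box_refine_subset[OF adm'[OF that]])
  have sub': "cell_of \<sigma> n z \<subseteq> \<Omega>" if "z \<in> \<Omega>" for n z
  proof (induction n)
    case 0
    show ?case using sub[OF that] by (simp add: cell_of_def)
  qed (use Suc[OF that] in blast)
  have self: "z \<in> cell_of \<sigma> n z" if "z \<in> \<Omega>" for n z
  proof -
    obtain k t r where e: "shape \<sigma> n (ln (snd z)) = (k, t, r)" by (cases "shape \<sigma> n (ln (snd z))")
    have "0 < snd z" using that S by (auto simp: S_set_def)
    then have "snd z \<in> {exp (t - r)<..exp (t + r)}" using in_exp_interval_iff[of "snd z" t r k] ins'[OF that, of n] e by simp
    then show ?thesis unfolding cell_of_def e box_eq by (cases z) (simp add: dcube_def)
  qed
  have eq: "cell_of \<sigma> n y = cell_of \<sigma> n z" if z: "z \<in> \<Omega>" and y: "y \<in> cell_of \<sigma> n z" for n y z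
  proof -
    obtain k t r where e: "shape \<sigma> n (ln (snd z)) = (k, t, r)" by (cases "shape \<sigma> n (ln (snd z))")
    have "0 < snd y" using y box_subset_S[of "(k, t, r)" "fst z"] by (auto simp: cell_of_def e S_set_def)
    moreover have y': "snd y \<in> {exp (t - r)<..exp (t + r)}" "fst y \<in> dcube k (fst z)"
      using y by (auto simp: cell_of_def e box_eq)
    ultimately have "in_shape (ln (snd y)) (k, t, r)" using in_exp_interval_iff by blast
    then have "shape \<sigma> n (ln (snd y)) = (k, t, r)" using inv'[OF z, of "ln (snd y)" n] e by simp
    moreover have "dcube k (fst y) = dcube k (fst z)" using y'(2) by (simp add: dcube_def)
    ultimately show ?thesis by (simp add: cell_of_def e box_eq)
  qed
  show ?thesis
  proof
    fix x :: "(real^'n) \<times> real" and n assume x: "x \<in> \<Omega>"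
    show "cell_of \<sigma> n x \<in> sets rho" unfolding cell_of_def using adm'[OF x] by (rule box_sets)
    show "emeasure rho (cell_of \<sigma> n x) < \<infinity>" "0 < measure rho (cell_of \<sigma> n x)" using m[OF x] by auto
    show "x \<in> cell_of \<sigma> n x" "cell_of \<sigma> n x \<subseteq> \<Omega>" "cell_of \<sigma> (Suc n) x \<subseteq> cell_of \<sigma> n x"
      using self[OF x] sub'[OF x] Suc[OF x] by auto
    show "measure rho (cell_of \<sigma> n x) \<le> 2 ^ CARD('n) * measure rho (cell_of \<sigma> (Suc n) x)"
      unfolding cell_of_def shape.simps by (rule measure_box_refine[OF adm'[OF x]])
  next
    fix x y :: "(real^'n) \<times> real" and n assume "x \<in> \<Omega>" "y \<in> cell_of \<sigma> n x"
    then show "cell_of \<sigma> n y = cell_of \<sigma> n x" by (rule eq)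
  next
    fix n
    let ?c = "\<lambda>(\<tau>, m :: 'n \<Rightarrow> int). case \<tau> of (k, t, r) \<Rightarrow> {y :: real^'n. \<forall>i. \<lfloor>y $ i / 2 powi k\<rfloor> = m i} \<times> {exp (t - r)<..exp (t + r)}"
    have "cell_of \<sigma> n z \<in> ?c ` (range (shape \<sigma> n) \<times> UNIV)" for z :: "(real^'n) \<times> real"
    proof (rule image_eqI)
      obtain k t r where e: "shape \<sigma> n (ln (snd z)) = (k, t, r)" by (cases "shape \<sigma> n (ln (snd z))")
      show "cell_of \<sigma> n z = ?c (shape \<sigma> n (ln (snd z)), \<lambda>i. \<lfloor>fst z $ i / 2 powi fst (shape \<sigma> n (ln (snd z)))\<rfloor>)"
        unfolding cell_of_def e by (simp add: cell_box_def)
    qed simp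
    then have "cell_of \<sigma> n ` \<Omega> \<subseteq> ?c ` (range (shape \<sigma> n) \<times> UNIV)" by blast
    then show "countable (cell_of \<sigma> n ` \<Omega>)"
      by (rule countable_subset) (intro countable_image countable_SIGMA countable_shapes count countableI_type)
  next
    fix x :: "(real^'n) \<times> real" and A and e :: real
    assume x: "x \<in> \<Omega>" and A: "A \<in> sets rho" "A \<subseteq> cell_of \<sigma> 0 x" and e: "0 < e"
    let ?R = "cell_of \<sigma> 0 x"
    have R: "?R \<in> sets rho" unfolding cell_of_def using adm'[OF x] by (rule box_sets)
    have "?R \<subseteq> S_set" using sub'[OF x] S by blast
    then obtain U where U: "open U" "A \<subseteq> U" "emeasure rho (U \<inter> ?R) \<le> emeasure rho A + ennreal e"
      using rho_outer_regular[OF sets_rho_borel[OF R] _ _ sets_rho_borel[OF A(1)] A(2) e] m[OF x] by blast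
    have "\<exists>n. cell_of \<sigma> n y \<subseteq> U \<inter> ?R" if y: "y \<in> A" for y
    proof -
      have yO: "y \<in> \<Omega>" using y A(2) sub'[OF x] by blast
      have "0 < snd y" using yO S by (auto simp: S_set_def)
      then obtain n where n: "cell_of \<sigma> n y \<subseteq> U"
        using box_shrinks[of \<sigma> "snd y" U "fst y", OF adm[OF yO] ins[OF yO] inv[OF yO] _ U(1)] y U(2) by (auto simp: cell_of_def)
      have "cell_of \<sigma> n y \<subseteq> cell_of \<sigma> 0 y" by (induction n) (use Suc[OF yO] in blast)+
      also have "\<dots> = ?R" using eq[OF x] y A(2) by blast
      finally show ?thesis using n by blast
    qed
    moreover have "U \<inter> ?R \<in> sets rho"
      using \<open>?R \<subseteq> S_set\<close> U(1) sets_rho_borel[OF R] by (intro sets_rho) auto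
    ultimately show "\<exists>V\<in>sets rho. A \<subseteq> V \<and> emeasure rho V \<le> emeasure rho A + ennreal e \<and> (\<forall>y\<in>A. \<exists>n. cell_of \<sigma> n y \<subseteq> V)"
      using U A(2) by (intro bexI[of _ "U \<inter> ?R"]) auto
  qed
qed

section \<open>Atoms, the Hardy space and BMO\<close>

lemma rho_compact_finite:
  assumes K: "compact K" "K \<subseteq> S_set"
  shows "emeasure rho K < \<infinity>"
proof (cases "K = {}")
  case False
  have "continuous_on K snd" by (intro continuous_intros)
  then obtain z where z: "z \<in> K" "\<And>y. y \<in> K \<Longrightarrow> snd z \<le> snd y"
    using continuous_attains_inf[OF K(1) False] by blast
  have pos: "0 < snd z" using z(1) K(2) by (auto simp: S_set_def)
  have B: "K \<in> sets borel" using K(1) by (simp add: borel_compact)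
  have "emeasure rho K = (\<integral>\<^sup>+y\<in>K. ennreal (1 / snd y) \<partial>lborel)" by (rule emeasure_rho[OF K(2) B])
  also have "\<dots> \<le> (\<integral>\<^sup>+y\<in>K. ennreal (1 / snd z) \<partial>lborel)"
    using z pos by (intro nn_integral_mono) (auto split: split_indicator intro!: ennreal_leI divide_left_mono mult_pos_pos intro: less_le_trans)
  also have "\<dots> = ennreal (1 / snd z) * emeasure lborel K" using B by (simp add: nn_integral_cmult_indicator)
  also have "\<dots> < \<infinity>" using emeasure_compact_finite[OF K(1)] by (simp add: ennreal_mult_less_top)
  finally show ?thesis .
qed simp

lemma compact_sets_rho: "compact K \<Longrightarrow> K \<subseteq> S_set \<Longrightarrow> K \<in> sets rho"
  by (intro sets_rho) (simp_all add: borel_compact)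

lemma L1_locI:
  assumes [measurable]: "f \<in> borel_measurable rho"
    and "\<And>K. compact K \<Longrightarrow> K \<subseteq> S_set \<Longrightarrow> (\<integral>\<^sup>+z\<in>K. ennreal (cmod (f z)) \<partial>rho) < \<infinity>"
  shows "f \<in> L1_loc"
  unfolding L1_loc_def
proof (intro CollectI conjI allI impI)
  fix K :: "((real^'a) \<times> real) set" assume K: "compact K \<and> K \<subseteq> S_set"
  have [measurable]: "K \<in> sets rho" using K compact_sets_rho by auto
  have "(\<integral>\<^sup>+z. ennreal (norm (indicator K z *\<^sub>R f z)) \<partial>rho) = (\<integral>\<^sup>+z\<in>K. ennreal (cmod (f z)) \<partial>rho)"
    by (intro nn_integral_cong) (auto split: split_indicator)
  then show "set_integrable rho K f"
    unfolding set_integrable_def using assms(2)[of K] K by (intro integrableI_bounded) auto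
qed fact

lemma CZ_finite: "R \<in> CZ_sets \<Longrightarrow> emeasure rho R < \<infinity>"
  using CZ_set_compact_hull[of R] rho_compact_finite emeasure_mono[of R _ rho] compact_sets_rho
  by (metis le_less_trans)

lemma CZ_sets_rho: "R \<in> CZ_sets \<Longrightarrow> R \<in> sets rho"
  using CZ_set_compact_hull[of R] sets_rho by (metis order.trans)

lemma integrable_L1_loc: "integrable rho f \<Longrightarrow> f \<in> L1_loc"
  unfolding L1_loc_def set_integrable_def using compact_sets_rho
  by (auto intro!: integrable_mult_indicator borel_measurable_integrable)

lemma bounded_L1_loc:
  assumes [measurable]: "g \<in> borel_measurable rho" and b: "AE z in rho. cmod (g z) \<le> c"
  shows "g \<in> L1_loc"
proof (rule L1_locI)
  fix K :: "((real^'a) \<times> real) set" assume K: "compact K" "K \<subseteq> S_set"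
  have [measurable]: "K \<in> sets rho" using K compact_sets_rho by auto
  have "(\<integral>\<^sup>+z\<in>K. ennreal (cmod (g z)) \<partial>rho) \<le> (\<integral>\<^sup>+z\<in>K. ennreal c \<partial>rho)"
    using b by (intro nn_integral_mono_AE) (auto split: split_indicator intro: ennreal_leI elim!: eventually_mono)
  also have "\<dots> < \<infinity>"
    using rho_compact_finite[OF K] by (simp add: nn_integral_cmult_indicator ennreal_mult_less_top)
  finally show "(\<integral>\<^sup>+z\<in>K. ennreal (cmod (g z)) \<partial>rho) < \<infinity>" .
qed fact

lemma cmod_avg_le:
  assumes "f \<in> L1_loc" "R \<in> CZ_sets"
  shows "ennreal (cmod (avg f R)) * emeasure rho R \<le> (\<integral>\<^sup>+z\<in>R. ennreal (cmod (f z)) \<partial>rho)"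
proof (cases "measure rho R = 0")
  case True
  then have "avg f R = 0" by (simp add: avg_def)
  then show ?thesis by simp
next
  case False
  have e: "emeasure rho R = ennreal (measure rho R)"
    using CZ_finite[OF assms(2)] by (intro emeasure_eq_ennreal_measure) auto
  have "ennreal (cmod (avg f R)) * emeasure rho R = ennreal (cmod (LINT z:R|rho. f z))"
    unfolding e using False by (simp add: avg_def flip: ennreal_mult)
  also have "\<dots> \<le> (\<integral>\<^sup>+z. ennreal (cmod (indicator R z *\<^sub>R f z)) \<partial>rho)"
    using L1_loc_CZ(1)[OF assms] unfolding set_lebesgue_integral_def set_integrable_def
    by (rule integral_norm_bound_ennreal)
  also have "\<dots> = (\<integral>\<^sup>+z\<in>R. ennreal (cmod (f z)) \<partial>rho)"
    by (intro nn_integral_cong) (auto split: split_indicator)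
  finally show ?thesis .
qed

lemma deviation_le_L1:
  assumes f: "f \<in> L1_loc" and R: "R \<in> CZ_sets"
  shows "(\<integral>\<^sup>+z\<in>R. ennreal (cmod (f z - avg f R)) \<partial>rho) \<le> 2 * (\<integral>\<^sup>+z\<in>R. ennreal (cmod (f z)) \<partial>rho)"
proof -
  have [measurable]: "f \<in> borel_measurable rho" "R \<in> sets rho" using f CZ_sets_rho[OF R] by (auto simp: L1_loc_def)
  have "(\<integral>\<^sup>+z\<in>R. ennreal (cmod (f z - avg f R)) \<partial>rho)
      \<le> (\<integral>\<^sup>+z. ennreal (cmod (f z)) * indicator R z + ennreal (cmod (avg f R)) * indicator R z \<partial>rho)"
    by (intro nn_integral_mono)
       (auto split: split_indicator simp flip: ennreal_plus intro!: ennreal_leI norm_triangle_ineq4)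
  also have "\<dots> = (\<integral>\<^sup>+z\<in>R. ennreal (cmod (f z)) \<partial>rho) + ennreal (cmod (avg f R)) * emeasure rho R"
    by (subst nn_integral_add) (auto simp: nn_integral_cmult_indicator)
  also have "\<dots> \<le> (\<integral>\<^sup>+z\<in>R. ennreal (cmod (f z)) \<partial>rho) + (\<integral>\<^sup>+z\<in>R. ennreal (cmod (f z)) \<partial>rho)"
    by (intro add_left_mono cmod_avg_le f R)
  finally show ?thesis by (simp add: mult_2)
qed

lemma bounded_BMO:
  assumes g [measurable]: "g \<in> borel_measurable rho" and b: "AE z in rho. cmod (g z) \<le> c" and c: "0 < c"
  shows "g \<in> BMO" "BMO_norm g \<le> 2 * c"
proof -
  have loc: "g \<in> L1_loc" using bounded_L1_loc[OF g b] .
  have le: "star_norm g \<le> ennreal (2 * c)"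
    unfolding star_norm_def
  proof (rule SUP_least)
    fix R :: "((real^'a) \<times> real) set" assume R: "R \<in> CZ_sets"
    have [measurable]: "R \<in> sets rho" using CZ_sets_rho[OF R] .
    have "(\<integral>\<^sup>+z\<in>R. ennreal (cmod (g z)) \<partial>rho) \<le> (\<integral>\<^sup>+z\<in>R. ennreal c \<partial>rho)"
      using b by (intro nn_integral_mono_AE) (auto split: split_indicator intro: ennreal_leI elim!: eventually_mono)
    then have "2 * (\<integral>\<^sup>+z\<in>R. ennreal (cmod (g z)) \<partial>rho) \<le> 2 * (ennreal c * emeasure rho R)"
      by (intro mult_left_mono) (auto simp: nn_integral_cmult_indicator)
    then have "2 * (\<integral>\<^sup>+z\<in>R. ennreal (cmod (g z)) \<partial>rho) \<le> ennreal (2 * c) * emeasure rho R"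
      using c by (simp add: ennreal_mult mult.assoc)
    with deviation_le_L1[OF loc R]
    have le: "(\<integral>\<^sup>+z\<in>R. ennreal (cmod (g z - avg g R)) \<partial>rho) \<le> ennreal (2 * c) * emeasure rho R"
      by (rule order.trans)
    show "(\<integral>\<^sup>+z\<in>R. ennreal (cmod (g z - avg g R)) \<partial>rho) / emeasure rho R \<le> ennreal (2 * c)"
    proof (cases "emeasure rho R = 0")
      case True
      then show ?thesis using le by simp
    next
      case False
      then show ?thesis using le by (intro divide_le_posI_ennreal) (auto simp: zero_less_iff_neq_zero mult.commute)
    qed
  qed
  then have "star_norm g < \<infinity>" using le_less_trans[OF le] by simp
  then show "g \<in> BMO" using loc by (simp add: BMO_def)
  show "BMO_norm g \<le> 2 * c" unfolding BMO_norm_def using enn2real_mono[OF le] c by simp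
qed

lemma box_eq_closed_box:
  assumes "admissible \<sigma>"
  shows "measure rho (closed_box \<sigma> x) = measure rho (cell_box \<sigma> x)"
    "emeasure rho (closed_box \<sigma> x) = emeasure rho (cell_box \<sigma> x)"
    "AE z in rho. z \<in> closed_box \<sigma> x \<longleftrightarrow> z \<in> cell_box \<sigma> x"
proof -
  have n: "closed_box \<sigma> x - cell_box \<sigma> x \<in> null_sets rho"
    using closed_box_null(2)[OF assms] closed_box_sets[OF assms] box_sets[OF assms] by (auto simp: null_sets_def)
  have U: "closed_box \<sigma> x = cell_box \<sigma> x \<union> (closed_box \<sigma> x - cell_box \<sigma> x)" using closed_box_null(1)[OF assms, of x] by auto
  show e: "emeasure rho (closed_box \<sigma> x) = emeasure rho (cell_box \<sigma> x)"
    using emeasure_Un_null_set[OF box_sets[OF assms] n] U by metis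
  show "measure rho (closed_box \<sigma> x) = measure rho (cell_box \<sigma> x)" using e by (simp add: measure_def)
  show "AE z in rho. z \<in> closed_box \<sigma> x \<longleftrightarrow> z \<in> cell_box \<sigma> x"
    using AE_not_in[OF n] closed_box_null(1)[OF assms, of x] by (auto elim!: eventually_mono)
qed

lemma box_deviation:
  assumes f: "f \<in> borel_measurable rho" and a: "admissible \<sigma>"
  shows "(\<integral>\<^sup>+z\<in>cell_box \<sigma> x. ennreal (cmod (f z - avg f (cell_box \<sigma> x))) \<partial>rho)
    = (\<integral>\<^sup>+z\<in>closed_box \<sigma> x. ennreal (cmod (f z - avg f (closed_box \<sigma> x))) \<partial>rho)"
proof -
  have [measurable]: "f \<in> borel_measurable rho" "cell_box \<sigma> x \<in> sets rho" "closed_box \<sigma> x \<in> sets rho"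
    using f box_sets[OF a] closed_box_sets[OF a] by auto
  note ae = box_eq_closed_box(3)[OF a, of x]
  have "(LINT z:cell_box \<sigma> x|rho. f z) = (LINT z:closed_box \<sigma> x|rho. f z)"
    unfolding set_lebesgue_integral_def
    using ae by (intro integral_cong_AE) (auto elim!: eventually_mono split: split_indicator)
  then have e: "avg f (cell_box \<sigma> x) = avg f (closed_box \<sigma> x)" by (simp add: avg_def box_eq_closed_box(1)[OF a])
  show ?thesis
    unfolding e using ae by (intro nn_integral_cong_AE) (auto elim!: eventually_mono split: split_indicator)
qed

lemma CZ_deviation_le_star_norm:
  assumes R: "R \<in> CZ_sets" and pos: "emeasure rho R \<noteq> 0"
  shows "(\<integral>\<^sup>+z\<in>R. ennreal (cmod (f z - avg f R)) \<partial>rho) \<le> star_norm f * emeasure rho R"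
proof -
  let ?D = "\<integral>\<^sup>+z\<in>R. ennreal (cmod (f z - avg f R)) \<partial>rho"
  have "?D = ?D / emeasure rho R * emeasure rho R"
    using pos CZ_finite[OF R] by (simp add: ennreal_divide_times ennreal_divide_self)
  also have "\<dots> \<le> star_norm f * emeasure rho R"
    unfolding star_norm_def by (intro mult_right_mono SUP_upper R) simp
  finally show ?thesis .
qed

lemma box_emeasure_pos:
  assumes "admissible \<sigma>"
  shows "emeasure rho (cell_box \<sigma> x) \<noteq> 0" "0 < measure rho (cell_box \<sigma> x)" "emeasure rho (cell_box \<sigma> x) < \<infinity>"
proof -
  obtain k t r where \<sigma>: "\<sigma> = (k, t, r)" by (cases \<sigma>)
  have "0 < r" using assms by (simp add: \<sigma> admissible_def)
  then show "emeasure rho (cell_box \<sigma> x) \<noteq> 0" "0 < measure rho (cell_box \<sigma> x)" "emeasure rho (cell_box \<sigma> x) < \<infinity>"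
    by (simp_all add: \<sigma> emeasure_box measure_box)
qed

lemma atom_boxI:
  assumes a: "admissible \<sigma>" and b: "b \<in> borel_measurable rho"
    and supp: "\<And>z. z \<notin> cell_box \<sigma> x \<Longrightarrow> b z = 0"
    and le: "AE z in rho. cmod (b z) \<le> 1 / measure rho (cell_box \<sigma> x)" and zero: "(LINT z|rho. b z) = 0"
  shows "atom b"
  unfolding atom_def
proof (intro conjI bexI)
  show "closed_box \<sigma> x \<in> CZ_sets" by (rule closed_box_CZ[OF a])
  show "AE z in rho. z \<notin> closed_box \<sigma> x \<longrightarrow> b z = 0"
    using supp closed_box_null(1)[OF a, of x] by (intro AE_I2 impI) blast
  show "AE z in rho. cmod (b z) \<le> 1 / measure rho (closed_box \<sigma> x)"
    using le by (simp add: box_eq_closed_box(1)[OF a])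
qed fact+

lemma ennreal_norm_suminf_le:
  fixes f :: "nat \<Rightarrow> complex"
  assumes "f sums s"
  shows "ennreal (cmod s) \<le> (\<Sum>i. ennreal (cmod (f i)))"
proof (cases "(\<Sum>i. ennreal (cmod (f i))) = top")
  case False
  then have s: "summable (\<lambda>i. cmod (f i))" by (intro summable_suminf_not_top) auto
  then have "cmod s \<le> (\<Sum>i. cmod (f i))" using summable_norm[OF s] sums_unique[OF assms] by simp
  then show ?thesis using s by (subst suminf_ennreal2) (auto intro: ennreal_leI)
qed simp

text \<open>Dividing the pieces by \<open>\<beta> i\<close> times the measure of their cell gives atoms. The partial sums converge in
\<open>L\<^sup>1\<close> because the tails of the series of the weights dominate the remainders.\<close>

lemma H1I:
  fixes h :: "(real^'n) \<times> real \<Rightarrow> complex"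
  assumes h [measurable]: "h \<in> borel_measurable rho"
    and u [measurable]: "\<And>i::nat. u i \<in> borel_measurable rho"
    and R: "\<And>i. \<exists>\<sigma> x. admissible \<sigma> \<and> R i = cell_box \<sigma> x"
    and supp: "\<And>i z. z \<notin> R i \<Longrightarrow> u i z = 0"
    and le: "\<And>i. AE z in rho. cmod (u i z) \<le> \<beta> i" and \<beta>: "\<And>i. 0 \<le> \<beta> i"
    and zero: "\<And>i. (LINT z|rho. u i z) = 0"
    and sum: "(\<Sum>i. ennreal (\<beta> i * measure rho (R i))) \<le> ennreal B" and B: "0 \<le> B"
    and sums: "AE z in rho. (\<lambda>i. u i z) sums h z"
  shows "h \<in> H1 \<and> H1_norm h \<le> B"
proof -
  define a where "a i = \<beta> i * measure rho (R i)" for i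
  define c where "c i = complex_of_real (a i)" for i
  define b where "b i = (if a i = 0 then (\<lambda>z. 0) else (\<lambda>z. u i z / c i))" for i
  have Rpos: "0 < measure rho (R i)" and Rm [measurable]: "R i \<in> sets rho" and Rfin: "emeasure rho (R i) = ennreal (measure rho (R i))" for i
  proof -
    obtain \<sigma> x where s: "admissible \<sigma>" "R i = cell_box \<sigma> x" using R by blast
    show "0 < measure rho (R i)" "R i \<in> sets rho" "emeasure rho (R i) = ennreal (measure rho (R i))"
      using box_emeasure_pos[OF s(1), of x] box_sets[OF s(1)] s(2) by (auto simp: emeasure_eq_ennreal_measure)
  qed
  have a0: "0 \<le> a i" for i using \<beta> by (simp add: a_def)
  have ca: "cmod (c i) = a i" for i using a0 by (simp add: c_def)
  have atom: "atom (b i)" for i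
  proof -
    obtain \<sigma> x where s: "admissible \<sigma>" "R i = cell_box \<sigma> x" using R by blast
    show ?thesis
    proof (rule atom_boxI[OF s(1)])
      show "b i \<in> borel_measurable rho" unfolding b_def by simp
      show "z \<notin> cell_box \<sigma> x \<Longrightarrow> b i z = 0" for z using supp[of z i] s(2) by (simp add: b_def)
      show "AE z in rho. cmod (b i z) \<le> 1 / measure rho (cell_box \<sigma> x)"
      proof (cases "a i = 0")
        case False
        then have "\<beta> i \<noteq> 0" by (simp add: a_def)
        then have bp: "0 < \<beta> i" using \<beta>[of i] by simp
        show ?thesis using le[of i]
        proof (rule AE_mp, intro AE_I2 impI)
          fix z assume "cmod (u i z) \<le> \<beta> i"
          then have "cmod (u i z) / a i \<le> \<beta> i / a i" using a0 by (intro divide_right_mono) auto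
          also have "\<dots> = 1 / measure rho (cell_box \<sigma> x)" using bp by (simp add: a_def s(2))
          finally show "cmod (b i z) \<le> 1 / measure rho (cell_box \<sigma> x)" using False by (simp add: b_def norm_divide ca)
        qed
      qed (simp add: b_def)
      show "(LINT z|rho. b i z) = 0" using zero[of i] by (simp add: b_def)
    qed
  qed
  have cb: "AE z in rho. \<forall>i. c i * b i z = u i z"
  proof -
    have "AE z in rho. c i * b i z = u i z" for i
    proof (cases "a i = 0")
      case True
      then have "\<beta> i = 0" using Rpos[of i] by (simp add: a_def)
      then have "AE z in rho. u i z = 0" using le[of i] by simp
      then show ?thesis using True by (auto simp: b_def elim!: eventually_mono)
    next
      case False
      then show ?thesis by (simp add: b_def c_def)
    qed
    then show ?thesis by (subst AE_all_countable) blast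
  qed
  have summ: "summable a"
    using sum a0 by (intro summable_suminf_not_top) (auto simp: a_def top_unique)
  have suminf_a: "(\<Sum>i. ennreal (a i)) = ennreal (\<Sum>i. a i)" by (rule suminf_ennreal2[OF a0 summ])
  have sumB: "(\<Sum>i. a i) \<le> B" using sum B unfolding a_def[symmetric] suminf_a by simp
  have u_int: "(\<integral>\<^sup>+z. ennreal (cmod (u i z)) \<partial>rho) \<le> ennreal (a i)" for i
  proof -
    have "(\<integral>\<^sup>+z. ennreal (cmod (u i z)) \<partial>rho) \<le> (\<integral>\<^sup>+z\<in>R i. ennreal (\<beta> i) \<partial>rho)"
      using le[of i] supp by (intro nn_integral_mono_AE) (auto elim!: eventually_mono split: split_indicator intro: ennreal_leI)
    also have "\<dots> = ennreal (a i)"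
      using \<beta>[of i] by (simp add: nn_integral_cmult_indicator Rfin a_def ennreal_mult)
    finally show ?thesis .
  qed
  have tail: "(\<integral>\<^sup>+z. ennreal (cmod (h z - (\<Sum>j<n. c j * b j z))) \<partial>rho) \<le> ennreal ((\<Sum>i. a i) - (\<Sum>i<n. a i))" for n
  proof -
    have "(\<integral>\<^sup>+z. ennreal (cmod (h z - (\<Sum>j<n. c j * b j z))) \<partial>rho) \<le> (\<integral>\<^sup>+z. (\<Sum>i. ennreal (cmod (u (i + n) z))) \<partial>rho)"
    proof (rule nn_integral_mono_AE, use sums in \<open>rule AE_mp\<close>, use cb in \<open>rule AE_mp\<close>, intro AE_I2 impI)
      fix z assume z: "\<forall>i. c i * b i z = u i z" "(\<lambda>i. u i z) sums h z"
      have "(\<lambda>i. u (i + n) z) sums (h z - (\<Sum>j<n. u j z))" using z(2) by (rule sums_split_initial_segment)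
      then show "ennreal (cmod (h z - (\<Sum>j<n. c j * b j z))) \<le> (\<Sum>i. ennreal (cmod (u (i + n) z)))"
        using ennreal_norm_suminf_le z(1) by simp
    qed
    also have "\<dots> = (\<Sum>i. \<integral>\<^sup>+z. ennreal (cmod (u (i + n) z)) \<partial>rho)" by (rule nn_integral_suminf) simp
    also have "\<dots> \<le> (\<Sum>i. ennreal (a (i + n)))" by (intro suminf_le allI u_int) auto
    also have "\<dots> = ennreal (\<Sum>i. a (i + n))"
      using a0 summ by (intro suminf_ennreal2) (auto simp: summable_iff_shift)
    also have "(\<Sum>i. a (i + n)) = (\<Sum>i. a i) - (\<Sum>i<n. a i)" by (rule suminf_minus_initial_segment[OF summ])
    finally show ?thesis .
  qed
  have hi: "integrable rho h"
    using tail[of 0] by (intro integrableI_bounded) (auto intro: le_less_trans)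
  have bm [measurable]: "b j \<in> borel_measurable rho" for j using atom[of j] by (simp add: atom_def)
  have nn: "0 \<le> (\<Sum>i. a i) - (\<Sum>i<n. a i)" for n
    using sum_le_suminf[OF summ, of "{..<n}"] a0 by simp
  have lim: "(\<lambda>n. (\<Sum>i. a i) - (\<Sum>i<n. a i)) \<longlonglongrightarrow> 0"
    using tendsto_diff[OF tendsto_const[of "\<Sum>i. a i"] summable_LIMSEQ[OF summ]] by simp
  have "(\<lambda>n. LINT z|rho. cmod (h z - (\<Sum>j<n. c j * b j z))) \<longlonglongrightarrow> 0"
  proof (rule tendsto_sandwich[OF _ _ tendsto_const lim])
    show "\<forall>\<^sub>F n in sequentially. 0 \<le> (LINT z|rho. cmod (h z - (\<Sum>j<n. c j * b j z)))" by simp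
    show "\<forall>\<^sub>F n in sequentially. (LINT z|rho. cmod (h z - (\<Sum>j<n. c j * b j z))) \<le> (\<Sum>i. a i) - (\<Sum>i<n. a i)"
      using tail nn by (intro always_eventually allI integral_real_bounded) auto
  qed
  then have dec: "atomic_decomp h c b"
    unfolding atomic_decomp_def using hi summ atom ca by simp
  have "H1_norm h \<le> (\<Sum>j. cmod (c j))"
    unfolding H1_norm_def
  proof (rule cInf_lower)
    show "(\<Sum>j. cmod (c j)) \<in> {\<Sum>j. cmod (c j) |c b. atomic_decomp h c b}" using dec by blast
    show "bdd_below {\<Sum>j. cmod (c j) |c b. atomic_decomp h c b}"
      by (rule bdd_belowI[of _ 0]) (auto simp: atomic_decomp_def intro: suminf_nonneg)
  qed
  then show ?thesis using dec sumB by (auto simp: H1_def ca)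
qed

lemma atom_L1:
  assumes "atom b"
  shows "(\<integral>\<^sup>+z. ennreal (cmod (b z)) \<partial>rho) \<le> 1"
proof -
  obtain R where R: "R \<in> CZ_sets" "AE z in rho. z \<notin> R \<longrightarrow> b z = 0" "AE z in rho. cmod (b z) \<le> 1 / measure rho R"
    using assms by (auto simp: atom_def)
  have [measurable]: "R \<in> sets rho" using CZ_sets_rho[OF R(1)] .
  have "(\<integral>\<^sup>+z. ennreal (cmod (b z)) \<partial>rho) \<le> (\<integral>\<^sup>+z\<in>R. ennreal (1 / measure rho R) \<partial>rho)"
    using R(2,3) by (intro nn_integral_mono_AE) (auto elim!: eventually_elim2 split: split_indicator intro: ennreal_leI)
  also have "\<dots> = ennreal (1 / measure rho R) * ennreal (measure rho R)"
    using CZ_finite[OF R(1)] by (simp add: nn_integral_cmult_indicator emeasure_eq_ennreal_measure)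
  also have "\<dots> \<le> 1" by (simp flip: ennreal_mult)
  finally show ?thesis .
qed

lemma atomic_decomp_L1:
  assumes d: "atomic_decomp h c b"
  shows "(\<integral>\<^sup>+z. ennreal (cmod (h z)) \<partial>rho) \<le> ennreal (\<Sum>j. cmod (c j))"
proof -
  have hi: "integrable rho h" and summ: "summable (\<lambda>j. cmod (c j))" and at: "\<And>j. atom (b j)"
    and lim: "(\<lambda>n. LINT z|rho. cmod (h z - (\<Sum>j<n. c j * b j z))) \<longlonglongrightarrow> 0"
    using d by (auto simp: atomic_decomp_def)
  have bm [measurable]: "b j \<in> borel_measurable rho" for j using at[of j] by (simp add: atom_def)
  have bi: "integrable rho (b j)" for j
    using atom_L1[OF at[of j]] by (intro integrableI_bounded) (auto intro: le_less_trans)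
  have bn: "(LINT z|rho. cmod (b j z)) \<le> 1" for j
    using atom_L1[OF at[of j]] by (intro integral_real_bounded) auto
  have le: "(LINT z|rho. cmod (h z)) \<le> (LINT z|rho. cmod (h z - (\<Sum>j<n. c j * b j z))) + (\<Sum>j. cmod (c j))" for n
  proof -
    have ii: "integrable rho (\<lambda>z. h z - (\<Sum>j<n. c j * b j z))" by (intro Bochner_Integration.integrable_diff Bochner_Integration.integrable_sum integrable_mult_right hi bi)
    have "(LINT z|rho. cmod (h z)) \<le> (LINT z|rho. cmod (h z - (\<Sum>j<n. c j * b j z)) + (\<Sum>j<n. cmod (c j) * cmod (b j z)))"
    proof (rule integral_mono)
      show "integrable rho (\<lambda>z. cmod (h z - (\<Sum>j<n. c j * b j z)) + (\<Sum>j<n. cmod (c j) * cmod (b j z)))"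
        by (intro Bochner_Integration.integrable_add integrable_norm ii Bochner_Integration.integrable_sum integrable_mult_right bi)
      fix z
      have "cmod (h z) \<le> cmod (h z - (\<Sum>j<n. c j * b j z)) + cmod (\<Sum>j<n. c j * b j z)"
        by (metis diff_add_cancel norm_triangle_ineq)
      also have "cmod (\<Sum>j<n. c j * b j z) \<le> (\<Sum>j<n. cmod (c j) * cmod (b j z))"
        by (rule sum_norm_le) (simp add: norm_mult)
      finally show "cmod (h z) \<le> cmod (h z - (\<Sum>j<n. c j * b j z)) + (\<Sum>j<n. cmod (c j) * cmod (b j z))" by simp
    qed (intro integrable_norm hi)
    also have "\<dots> = (LINT z|rho. cmod (h z - (\<Sum>j<n. c j * b j z))) + (\<Sum>j<n. cmod (c j) * (LINT z|rho. cmod (b j z)))"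
      using ii bi by (simp add: integrable_norm)
    also have "(\<Sum>j<n. cmod (c j) * (LINT z|rho. cmod (b j z))) \<le> (\<Sum>j<n. cmod (c j) * 1)"
      by (intro sum_mono mult_left_mono bn) auto
    also have "\<dots> \<le> (\<Sum>j. cmod (c j))" using sum_le_suminf[OF summ, of "{..<n}"] by simp
    finally show ?thesis by simp
  qed
  have "(LINT z|rho. cmod (h z)) \<le> 0 + (\<Sum>j. cmod (c j))"
    by (rule LIMSEQ_le_const[OF tendsto_add[OF lim tendsto_const]]) (use le in auto)
  then show ?thesis
    using nn_integral_eq_integral[OF integrable_norm[OF hi]] by (simp add: ennreal_leI)
qed

lemma H1_L1:
  assumes "h \<in> H1"
  shows "(\<integral>\<^sup>+z. ennreal (cmod (h z)) \<partial>rho) \<le> ennreal (H1_norm h)" "0 \<le> H1_norm h" "h \<in> L1_loc"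
proof -
  let ?S = "{\<Sum>j. cmod (c j) |c b. atomic_decomp h c b}"
  obtain c0 b0 where d0: "atomic_decomp h c0 b0" using assms by (auto simp: H1_def)
  have ne: "?S \<noteq> {}" using d0 by blast
  have hi: "integrable rho h" using d0 by (simp add: atomic_decomp_def)
  show "h \<in> L1_loc" using integrable_L1_loc[OF hi] .
  show n: "0 \<le> H1_norm h"
    unfolding H1_norm_def using ne by (rule cInf_greatest) (auto simp: atomic_decomp_def intro: suminf_nonneg)
  have e: "(\<integral>\<^sup>+z. ennreal (cmod (h z)) \<partial>rho) = ennreal (LINT z|rho. cmod (h z))"
    using hi by (intro nn_integral_eq_integral) auto
  have "(LINT z|rho. cmod (h z)) \<le> H1_norm h"
    unfolding H1_norm_def using ne
  proof (rule cInf_greatest)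
    fix s assume "s \<in> ?S"
    then obtain c b where cb: "s = (\<Sum>j. cmod (c j))" "atomic_decomp h c b" by blast
    have "0 \<le> s" using cb by (auto simp: atomic_decomp_def intro: suminf_nonneg)
    then show "(LINT z|rho. cmod (h z)) \<le> s"
      using atomic_decomp_L1[OF cb(2)] by (simp add: e cb(1))
  qed
  then show "(\<integral>\<^sup>+z. ennreal (cmod (h z)) \<partial>rho) \<le> ennreal (H1_norm h)" by (simp add: e ennreal_leI)
qed

section \<open>Partition into large cells and the decomposition at a given height\<close>

text \<open>The side \<open>16\<^sup>p\<close> lies between \<open>e\<^sup>5\<^sup>p\<^sup>/\<^sup>2\<close> and \<open>e\<^sup>5\<^sup>p\<close>.\<close>

lemma admissible_large:
  assumes "0 < p" "1 \<le> r" "t + 2 * r \<le> 5 / 2 * real p" "5 * real p \<le> t + 8 * r"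
  shows "admissible (4 * int p, t, r)"
proof -
  have e1: "2 \<le> exp (1 :: real)" using exp_ge_add_one_self[of 1] by simp
  have e5: "exp 5 = (exp (1 :: real)) ^ 5" by (simp add: exp_of_nat_mult[symmetric])
  have "(exp (5 / 2 :: real))\<^sup>2 = (exp 1) ^ 5"
    unfolding e5[symmetric] by (simp add: power2_eq_square exp_add[symmetric])
  also have "\<dots> \<le> 3 ^ 5" by (intro power_mono exp_le) auto
  also have "\<dots> \<le> (16 :: real)\<^sup>2" by simp
  finally have a: "exp (5 / 2 :: real) \<le> 16" by (rule power2_le_imp_le) simp
  have "(16 :: real) < 2 ^ 5" by simp
  also have "\<dots> \<le> exp 5" unfolding e5 by (intro power_mono e1) auto
  finally have b: "(16 :: real) < exp 5" .
  have i: "4 * int p = int (4 * p)" by simp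
  have L: "2 powi (4 * int p) = (16 :: real) ^ p" unfolding i power_int_of_nat power_mult by simp
  have "exp (t + 2 * r) \<le> exp (real p * (5 / 2))" using assms by simp
  also have "\<dots> = exp (5 / 2) ^ p" by (rule exp_of_nat_mult)
  also have "\<dots> \<le> 16 ^ p" by (intro power_mono a) auto
  finally have 1: "exp (t + 2 * r) \<le> 16 ^ p" .
  have "(16 :: real) ^ p < exp 5 ^ p" using assms b by (intro power_strict_mono) auto
  also have "\<dots> = exp (real p * 5)" by (rule exp_of_nat_mult[symmetric])
  also have "\<dots> \<le> exp (t + 8 * r)" using assms by simp
  finally have "16 ^ p < exp (t + 8 * r)" .
  then show ?thesis using 1 assms by (simp add: admissible_def L min_side_def max_side_def)
qed

text \<open>The logarithmic axis is cut into \<open>(-j, j]\<close> and the intervals \<open>(j 2\<^sup>i, j 2\<^sup>i\<^sup>+\<^sup>1]\<close> and \<open>(-j 2\<^sup>i\<^sup>+\<^sup>1, -j 2\<^sup>i]\<close>. Their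
length grows with the distance from \<open>0\<close> for the sake of the negative ones: long intervals far below \<open>0\<close>
admit cubes of side \<open>1\<close>, whereas bounded ones would force small cubes. In this way all cells have measure at
least \<open>j\<close>.\<close>

fun root_shape :: "nat \<Rightarrow> nat \<Rightarrow> bool \<Rightarrow> int \<times> real \<times> real" where
  "root_shape j 0 b = (4 * int j, 0, real j)"
| "root_shape j (Suc i) True = (4 * int (j * 2 ^ i), 3 / 2 * real (j * 2 ^ i), real (j * 2 ^ i) / 2)"
| "root_shape j (Suc i) False = (0, - 3 / 2 * real (j * 2 ^ i), real (j * 2 ^ i) / 2)"

definition root_level :: "nat \<Rightarrow> real \<Rightarrow> nat" where
  "root_level j s = (LEAST i. - real (j * 2 ^ i) < s \<and> s \<le> real (j * 2 ^ i))"

definition root_shape_of :: "nat \<Rightarrow> real \<Rightarrow> int \<times> real \<times> real" where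
  "root_shape_of j s = root_shape j (root_level j s) (0 < s)"

lemma root_shape_admissible:
  assumes "2 \<le> j"
  shows "admissible (root_shape j i b)"
proof (cases "(j, i, b)" rule: root_shape.cases)
  case (1 j' b')
  then show ?thesis using assms by (auto intro!: admissible_large)
next
  case (2 j' i')
  have "2 \<le> real (j * 2 ^ i')" using assms mult_mono[of 2 "real j" 1 "2 ^ i'"] by simp
  then have "admissible (4 * int (j * 2 ^ i'), 3 / 2 * real (j * 2 ^ i'), real (j * 2 ^ i') / 2)"
    by (intro admissible_large) linarith+
  then show ?thesis using 2 by (metis Pair_inject root_shape.simps(2))
next
  case (3 j' i')
  have p: "2 \<le> real (j * 2 ^ i')" using assms mult_mono[of 2 "real j" 1 "2 ^ i'"] by simp
  have "exp (- 3 / 2 * real (j * 2 ^ i') + 2 * (real (j * 2 ^ i') / 2)) \<le> exp 0"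
    unfolding exp_le_cancel_iff using p by linarith
  moreover have "exp 0 < exp (- 3 / 2 * real (j * 2 ^ i') + 8 * (real (j * 2 ^ i') / 2))"
    unfolding exp_less_cancel_iff using p by linarith
  ultimately show ?thesis using 3 p unfolding admissible_def min_side_def max_side_def by auto
qed

lemma root_level_le:
  assumes "2 \<le> j"
  shows "- real (j * 2 ^ root_level j s) < s \<and> s \<le> real (j * 2 ^ root_level j s)"
  unfolding root_level_def
proof (rule LeastI_ex)
  obtain i :: nat where "\<bar>s\<bar> < 2 ^ i" using real_arch_pow[of 2 "\<bar>s\<bar>"] by auto
  moreover have "1 * 2 ^ i \<le> real j * 2 ^ i" using assms by (intro mult_right_mono) auto
  moreover have "real j * 2 ^ i = real (j * 2 ^ i)" by simp
  ultimately have "- real (j * 2 ^ i) < s \<and> s \<le> real (j * 2 ^ i)" by linarith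
  then show "\<exists>i. - real (j * 2 ^ i) < s \<and> s \<le> real (j * 2 ^ i)" ..
qed

lemma root_level_less: "i < root_level j s \<Longrightarrow> \<not> (- real (j * 2 ^ i) < s \<and> s \<le> real (j * 2 ^ i))"
  unfolding root_level_def by (rule not_less_Least)

lemma root_in_shape:
  assumes "2 \<le> j"
  shows "in_shape s (root_shape_of j s)"
proof (cases "root_level j s")
  case 0
  then show ?thesis using root_level_le[OF assms, of s] by (simp add: root_shape_of_def in_shape_def)
next
  case (Suc i)
  then show ?thesis
    using root_level_le[OF assms, of s] root_level_less[of i j s]
    by (cases "0 < s") (auto simp: root_shape_of_def in_shape_def)
qed

lemma root_constant:
  assumes j: "2 \<le> j" and s': "in_shape s' (root_shape_of j s)"
  shows "root_shape_of j s' = root_shape_of j s"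
proof (cases "root_level j s")
  case 0
  then have "root_level j s' = 0"
    using s' unfolding root_level_def[of j s'] by (intro Least_eq_0) (simp add: root_shape_of_def in_shape_def)
  then show ?thesis using 0 by (simp add: root_shape_of_def)
next
  case (Suc i)
  have p: "0 < real (j * 2 ^ i)" using j by simp
  have level: "root_level j s' = Suc i"
    if s2: "- real (j * 2 ^ Suc i) < s'" "s' \<le> real (j * 2 ^ Suc i)" and out: "real (j * 2 ^ i) < s' \<or> s' \<le> - real (j * 2 ^ i)"
    unfolding root_level_def
  proof (rule Least_equality)
    show "- real (j * 2 ^ Suc i) < s' \<and> s' \<le> real (j * 2 ^ Suc i)" using s2 by blast
    fix m assume m: "- real (j * 2 ^ m) < s' \<and> s' \<le> real (j * 2 ^ m)"
    show "Suc i \<le> m"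
    proof (rule ccontr)
      assume "\<not> Suc i \<le> m"
      then have "real (j * 2 ^ m) \<le> real (j * 2 ^ i)" by (simp add: mult_left_mono)
      then show False using m out by linarith
    qed
  qed
  have "(0 < s' \<longleftrightarrow> 0 < s) \<and> root_level j s' = Suc i"
  proof (cases "0 < s")
    case True
    then have "real (j * 2 ^ i) < s'" "s' \<le> real (j * 2 ^ Suc i)"
      using s' by (auto simp: root_shape_of_def in_shape_def Suc)
    then show ?thesis using True p level by simp
  next
    case False
    then have "- real (j * 2 ^ Suc i) < s'" "s' \<le> - real (j * 2 ^ i)"
      using s' by (auto simp: root_shape_of_def in_shape_def Suc)
    then show ?thesis using False p level by simp
  qed
  then show ?thesis using Suc by (simp add: root_shape_of_def)
qed

lemma countable_root: "countable (range (root_shape_of j))"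
proof (rule countable_subset)
  show "range (root_shape_of j) \<subseteq> (\<lambda>(i, b). root_shape j i b) ` UNIV" by (force simp: root_shape_of_def)
qed simp

lemma measure_root_box:
  assumes "2 \<le> j"
  shows "real j \<le> measure rho (cell_box (root_shape_of j s) x)"
proof -
  obtain k t r where e: "root_shape_of j s = (k, t, r)" by (cases "root_shape_of j s")
  have "0 \<le> k \<and> real j \<le> 2 * r"
  proof (cases "(j, root_level j s, 0 < s)" rule: root_shape.cases)
    case (1 j' b')
    then show ?thesis using e by (auto simp: root_shape_of_def)
  next
    case (2 j' i)
    have "real j * 1 \<le> real j * 2 ^ i" by (intro mult_left_mono) auto
    then show ?thesis using e 2 by (auto simp: root_shape_of_def)
  next
    case (3 j' i)
    have "real j * 1 \<le> real j * 2 ^ i" by (intro mult_left_mono) auto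
    then show ?thesis using e 3 by (auto simp: root_shape_of_def)
  qed
  then have k: "0 \<le> k" and r: "real j \<le> 2 * r" by auto
  have "(1 :: real) \<le> 2 powi k" using k by (simp add: one_le_power_int)
  then have "1 * real j \<le> (2 powi k) ^ CARD('a) * (2 * r)"
    using r by (intro mult_mono one_le_power) auto
  then show ?thesis using r assms by (simp add: e measure_box)
qed

lemma root_filtration:
  assumes "2 \<le> j"
  shows "dyadic_filtration rho S_set (cell_of (root_shape_of j) :: nat \<Rightarrow> (real^'n) \<times> real \<Rightarrow> _) (2 ^ CARD('n))"
proof (rule dyadic_filtration_boxes[OF order.refl countable_root])
  show "admissible (root_shape_of j s)" for s unfolding root_shape_of_def by (rule root_shape_admissible[OF assms])
  show "in_shape s (root_shape_of j s)" for s by (rule root_in_shape[OF assms])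
  show "root_shape_of j s' = root_shape_of j s" if "in_shape s' (root_shape_of j s)" for s s' by (rule root_constant[OF assms that])
qed (rule box_subset_S)

text \<open>Values of \<open>|f|\<close> up to \<open>l/2\<close> contribute at most \<open>l/2\<close> to any mean, and the larger ones have a finite
integral. Hence \<open>|f|\<close> has mean at most \<open>l\<close> over all sufficiently large cells, and the telescoping
decomposition can be started from a partition into such cells.\<close>

lemma H1_BMO_decomposition:
  fixes f :: "(real^'n) \<times> real \<Rightarrow> complex"
  assumes f: "f \<in> borel_measurable rho" and l: "0 < l"
  defines "B \<equiv> (\<Sum>k. \<integral>\<^sup>+y. ennreal (cmod (f y)) * indicator {y. ennreal (l * 2 ^ k / 2) < ennreal (cmod (f y))} y \<partial>rho)"
  assumes B: "B < \<infinity>"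
  obtains h g where "h \<in> H1" "g \<in> BMO" "f = (\<lambda>z. h z + g z)"
    "H1_norm h \<le> 6 * 2 ^ CARD('n) * enn2real B" "BMO_norm g \<le> 2 * 2 ^ CARD('n) * l"
proof -
  let ?N = "2 ^ CARD('n) :: real"
  have fm [measurable]: "f \<in> borel_measurable rho" by fact
  define A where "A = (\<integral>\<^sup>+y. ennreal (cmod (f y)) * indicator {y. ennreal (l / 2) < ennreal (cmod (f y))} y \<partial>rho)"
  have "A \<le> B"
    unfolding A_def B_def
    using sum_le_suminf[of "\<lambda>k. \<integral>\<^sup>+y. ennreal (cmod (f y)) * indicator {y. ennreal (l * 2 ^ k / 2) < ennreal (cmod (f y))} y \<partial>rho" "{0}"]
    by simp
  then have "A < \<infinity>" using B by (rule order.strict_trans1)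
  then obtain a where a: "A = ennreal a" "0 \<le> a" by (cases A) auto
  obtain j0 :: nat where j0: "2 * a / l \<le> real j0" using real_arch_simple by blast
  \<comment> \<open>For \<open>j \<ge> 2\<close> all starting intervals have radius at least \<open>1\<close>.\<close>
  define j where "j = max 2 j0"
  have j: "2 \<le> j" "2 * a / l \<le> real j" using j0 by (auto simp: j_def)
  interpret dyadic_filtration rho "S_set :: ((real^'n) \<times> real) set" "cell_of (root_shape_of j)" ?N
    by (rule root_filtration[OF j(1)])
  have ne: "(S_set :: ((real^'n) \<times> real) set) \<noteq> {}" by (auto simp: S_set_def intro: exI[of _ 1])
  have small: "\<forall>x\<in>S_set. \<not> big (\<lambda>z. ennreal (cmod (f z))) l (cell_of (root_shape_of j) 0 x)"
  proof
    fix x :: "(real^'n) \<times> real" assume x: "x \<in> S_set"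
    let ?R = "cell_of (root_shape_of j) 0 x"
    have [measurable]: "?R \<in> sets rho" using cell_sets[OF x] .
    have "real j \<le> measure rho ?R" using measure_root_box[OF j(1)] by (simp add: cell_of_def)
    then have "2 * a / l \<le> measure rho ?R" using j(2) by simp
    then have al: "a \<le> l / 2 * measure rho ?R" using l by (simp add: field_simps)
    have "(\<integral>\<^sup>+y\<in>?R. ennreal (cmod (f y)) \<partial>rho)
      \<le> (\<integral>\<^sup>+y. ennreal (cmod (f y)) * indicator {y. ennreal (l / 2) < ennreal (cmod (f y))} y + ennreal (l / 2) * indicator ?R y \<partial>rho)"
    proof (rule nn_integral_mono)
      fix y
      show "ennreal (cmod (f y)) * indicator ?R y
        \<le> ennreal (cmod (f y)) * indicator {y. ennreal (l / 2) < ennreal (cmod (f y))} y + ennreal (l / 2) * indicator ?R y"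
        by (cases "ennreal (l / 2) < ennreal (cmod (f y))") (auto simp: indicator_def not_less)
    qed
    also have "\<dots> = A + ennreal (l / 2) * emeasure rho ?R"
      unfolding A_def by (subst nn_integral_add) (auto simp: nn_integral_cmult_indicator)
    also have "\<dots> \<le> ennreal (l / 2 * measure rho ?R) + ennreal (l / 2) * emeasure rho ?R"
      unfolding a(1) using al by (intro add_right_mono ennreal_leI)
    also have "\<dots> = ennreal (l / 2 * measure rho ?R + l / 2 * measure rho ?R)"
    proof -
      have "ennreal (l / 2) * emeasure rho ?R = ennreal (l / 2 * measure rho ?R)"
        unfolding emeasure_cell[OF x] using l by (intro ennreal_mult[symmetric]) auto
      then show ?thesis using l by (simp only:) (intro ennreal_plus[symmetric], auto)
    qed
    also have "l / 2 * measure rho ?R + l / 2 * measure rho ?R = l * measure rho ?R" by simp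
    also have "ennreal (l * measure rho ?R) = ennreal l * emeasure rho ?R"
      using l by (simp add: emeasure_cell[OF x] ennreal_mult)
    finally show "\<not> big (\<lambda>z. ennreal (cmod (f z))) l ?R" by (simp add: big_def not_less)
  qed
  obtain g u \<beta> R where g: "g \<in> borel_measurable rho" "AE x in rho. x \<in> S_set \<longrightarrow> cmod (g x) \<le> ?N * l"
    and "\<forall>i. u i \<in> borel_measurable rho \<and> (\<exists>n. \<exists>x\<in>S_set. R i = cell_of (root_shape_of j) n x) \<and> (\<forall>x. x \<notin> R i \<longrightarrow> u i x = 0) \<and>
       (AE x in rho. cmod (u i x) \<le> \<beta> i) \<and> 0 \<le> \<beta> i \<and> (LINT x|rho. u i x) = 0"
    and su: "(\<Sum>i. ennreal (\<beta> i * measure rho (R i))) \<le> ennreal (6 * ?N) * B"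
    and s: "AE x in rho. x \<in> S_set \<longrightarrow> (\<lambda>i::nat. u i x) sums (f x - g x)"
    using calderon_zygmund_telescoping[OF f ne l small B[unfolded B_def], folded B_def]
    by (elim exE conjE) (rule that)
  then have u: "u i \<in> borel_measurable rho" "\<exists>n. \<exists>x\<in>S_set. R i = cell_of (root_shape_of j) n x" "z \<notin> R i \<Longrightarrow> u i z = 0"
      "AE x in rho. cmod (u i x) \<le> \<beta> i" "0 \<le> \<beta> i" "(LINT x|rho. u i x) = 0" for i z by blast+
  define h where "h z = f z - g z" for z
  have hm [measurable]: "h \<in> borel_measurable rho" unfolding h_def using g(1) by measurable
  have "h \<in> H1 \<and> H1_norm h \<le> 6 * ?N * enn2real B"
  proof (rule H1I[OF hm u(1) _ u(3,4,5,6)])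
    show "\<exists>\<sigma> x. admissible \<sigma> \<and> R i = cell_box \<sigma> x" for i
    proof -
      obtain n x where "R i = cell_of (root_shape_of j) n x" using u(2)[of i] by blast
      moreover have "admissible (shape (root_shape_of j) n (ln (snd x)))"
        using root_shape_admissible[OF j(1)] root_in_shape[OF j(1)] root_constant[OF j(1)]
        by (intro shape_props(1)) (simp_all only: root_shape_of_def)
      ultimately show ?thesis unfolding cell_of_def by blast
    qed
    have "ennreal (6 * ?N) * B = ennreal (6 * ?N * enn2real B)"
      using B by (subst ennreal_mult) auto
    then show "(\<Sum>i. ennreal (\<beta> i * measure rho (R i))) \<le> ennreal (6 * ?N * enn2real B)" using su by simp
    show "AE z in rho. (\<lambda>i. u i z) sums h z"
      using s AE_space[of rho, unfolded space_rho] unfolding h_def by eventually_elim blast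
  qed simp_all
  moreover have gb: "AE z in rho. cmod (g z) \<le> ?N * l"
    using g(2) AE_space[of rho, unfolded space_rho] by eventually_elim blast
  moreover have "g \<in> BMO" "BMO_norm g \<le> 2 * (?N * l)"
    using bounded_BMO[OF g(1) gb] l by auto
  ultimately show ?thesis using that[of h g] by (auto simp: h_def mult.assoc)
qed

abbreviation Kf :: "real \<Rightarrow> ((real^'n) \<times> real \<Rightarrow> complex) \<Rightarrow> real" where
  "Kf \<equiv> K_functional star_rel H1 H1_norm BMO BMO_norm"

lemma BMO_norm_nonneg: "0 \<le> BMO_norm g"
  by (simp add: BMO_norm_def)

lemma K_le:
  assumes "h \<in> H1" "g \<in> BMO" "(f, (\<lambda>z. h z + g z)) \<in> star_rel" and t: "0 \<le> t"
  shows "Kf t f \<le> H1_norm h + t * BMO_norm g"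
  unfolding K_functional_def
proof (rule cInf_lower)
  show "bdd_below {H1_norm x0 + t * BMO_norm x1 |x0 x1. x0 \<in> H1 \<and> x1 \<in> BMO \<and> (f, \<lambda>z. x0 z + x1 z) \<in> star_rel}"
    using t by (intro bdd_belowI[of _ 0]) (auto intro!: add_nonneg_nonneg mult_nonneg_nonneg H1_L1(2) BMO_norm_nonneg)
qed (use assms in blast)

lemma K_nonneg:
  assumes "f \<in> couple_sum star_rel H1 BMO" and t: "0 \<le> t"
  shows "0 \<le> Kf t f"
  unfolding K_functional_def
  using assms by (intro cInf_greatest) (auto simp: couple_sum_def intro!: add_nonneg_nonneg mult_nonneg_nonneg H1_L1(2) BMO_norm_nonneg)

lemma star_rel_refl: "f \<in> L1_loc \<Longrightarrow> (f, f) \<in> star_rel"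
  using equiv_star_rel by (meson equivE refl_onD)

lemma H1_BMO_L1_loc: "h \<in> H1 \<Longrightarrow> g \<in> BMO \<Longrightarrow> (\<lambda>z. h z + g z) \<in> L1_loc"
  using H1_L1(3)[of h] by (auto simp: BMO_def L1_loc_def intro!: set_integral_add(1) borel_measurable_add)

section \<open>The interpolation integral of functions in \<open>L\<^sup>q\<close>\<close>

lemma Lp_nn_integral:
  assumes "f \<in> Lp q"
  shows "f \<in> borel_measurable rho" "(\<integral>\<^sup>+z. ennreal (cmod (f z) powr q) \<partial>rho) = ennreal (LINT z|rho. cmod (f z) powr q)"
  using assms by (auto simp: Lp_def nn_integral_eq_integral)

lemma Lp_L1_loc:
  assumes f: "f \<in> Lp q" and q: "1 \<le> q"
  shows "f \<in> L1_loc"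
proof (rule L1_locI)
  show [measurable]: "f \<in> borel_measurable rho" using Lp_nn_integral(1)[OF f] .
  fix K :: "((real^'a) \<times> real) set" assume K: "compact K" "K \<subseteq> S_set"
  have [measurable]: "K \<in> sets rho" using compact_sets_rho[OF K] .
  have "(\<integral>\<^sup>+z\<in>K. ennreal (cmod (f z)) \<partial>rho) \<le> (\<integral>\<^sup>+z. indicator K z + ennreal (cmod (f z) powr q) \<partial>rho)"
  proof (rule nn_integral_mono)
    fix z
    have "cmod (f z) \<le> 1 + cmod (f z) powr q"
    proof (cases "cmod (f z) \<le> 1")
      case False
      then have "cmod (f z) powr 1 \<le> cmod (f z) powr q" using q by (intro powr_mono) auto
      then show ?thesis using False by simp
    qed (use powr_ge_zero[of "cmod (f z)" q] in linarith)
    then have "ennreal (cmod (f z)) \<le> 1 + ennreal (cmod (f z) powr q)"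
      by (simp add: ennreal_leI flip: ennreal_1 ennreal_plus)
    then show "ennreal (cmod (f z)) * indicator K z \<le> indicator K z + ennreal (cmod (f z) powr q)"
      by (auto split: split_indicator)
  qed
  also have "\<dots> = emeasure rho K + (\<integral>\<^sup>+z. ennreal (cmod (f z) powr q) \<partial>rho)"
    by (subst nn_integral_add) auto
  also have "\<dots> < \<infinity>" using rho_compact_finite[OF K] by (simp add: Lp_nn_integral(2)[OF f])
  finally show "(\<integral>\<^sup>+z\<in>K. ennreal (cmod (f z)) \<partial>rho) < \<infinity>" .
qed

definition upper_mass :: "'a measure \<Rightarrow> ('a \<Rightarrow> complex) \<Rightarrow> int \<Rightarrow> ennreal" where
  "upper_mass M f k = (\<integral>\<^sup>+z. ennreal (cmod (f z)) * indicator {z. 2 powr real_of_int k < cmod (f z)} z \<partial>M)"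

definition upper_masses :: "'a measure \<Rightarrow> ('a \<Rightarrow> complex) \<Rightarrow> int \<Rightarrow> ennreal" where
  "upper_masses M f j = (\<Sum>i. upper_mass M f (j + int i))"

text \<open>The sum over \<open>k\<close> is exchanged with the integral; for fixed \<open>z\<close> it is a geometric series that ends
at \<open>2\<^sup>k < |f z|\<close>.\<close>

lemma sum_upper_mass:
  assumes f [measurable]: "f \<in> borel_measurable M" and s: "0 < s"
  shows "(\<integral>\<^sup>+k. ennreal (2 powr (real_of_int k * s)) * upper_mass M f k \<partial>count_space UNIV)
    \<le> ennreal (1 / (1 - 2 powr (- s))) * (\<integral>\<^sup>+z. ennreal (cmod (f z) powr (s + 1)) \<partial>M)"
proof -
  have lt: "2 powr (- s) < 1" using powr_less_mono[of "- s" 0 2] s by simp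
  have "(\<integral>\<^sup>+k. ennreal (2 powr (real_of_int k * s)) * upper_mass M f k \<partial>count_space UNIV)
    = (\<integral>\<^sup>+k. (\<integral>\<^sup>+z. ennreal (cmod (f z)) * (ennreal (2 powr (real_of_int k * s)) * indicator {k. 2 powr real_of_int k < cmod (f z)} k) \<partial>M) \<partial>count_space UNIV)"
    unfolding upper_mass_def
    by (intro nn_integral_cong, subst nn_integral_cmult[symmetric])
       (auto intro!: nn_integral_cong simp: indicator_def mult_ac)
  also have "\<dots> = (\<integral>\<^sup>+z. (\<integral>\<^sup>+k. ennreal (cmod (f z)) * (ennreal (2 powr (real_of_int k * s)) * indicator {k. 2 powr real_of_int k < cmod (f z)} k) \<partial>count_space UNIV) \<partial>M)"
    by (rule nn_integral_count_space_nn_integral[symmetric]) (auto simp: indicator_def)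
  also have "\<dots> \<le> (\<integral>\<^sup>+z. ennreal (1 / (1 - 2 powr (- s))) * ennreal (cmod (f z) powr (s + 1)) \<partial>M)"
  proof (rule nn_integral_mono)
    fix z
    let ?v = "cmod (f z)"
    have "(\<integral>\<^sup>+k. ennreal ?v * (ennreal (2 powr (real_of_int k * s)) * indicator {k. 2 powr real_of_int k < ?v} k) \<partial>count_space UNIV)
      = ennreal ?v * (\<integral>\<^sup>+k. ennreal (2 powr (real_of_int k * s)) * indicator {k. 2 powr real_of_int k < ?v} k \<partial>count_space UNIV)"
      by (rule nn_integral_cmult) simp
    also have "\<dots> \<le> ennreal ?v * ennreal (?v powr s / (1 - 2 powr (- s)))"
      by (intro mult_left_mono dyadic_sum_below s) auto
    also have "\<dots> = ennreal (?v * (?v powr s / (1 - 2 powr (- s))))"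
      using lt by (intro ennreal_mult[symmetric]) auto
    also have "?v * (?v powr s / (1 - 2 powr (- s))) = 1 / (1 - 2 powr (- s)) * ?v powr (s + 1)"
      by (cases "?v = 0") (simp_all add: powr_add)
    also have "ennreal \<dots> = ennreal (1 / (1 - 2 powr (- s))) * ennreal (?v powr (s + 1))"
      using lt by (intro ennreal_mult) auto
    finally show "(\<integral>\<^sup>+k. ennreal ?v * (ennreal (2 powr (real_of_int k * s)) * indicator {k. 2 powr real_of_int k < ?v} k) \<partial>count_space UNIV)
      \<le> ennreal (1 / (1 - 2 powr (- s))) * ennreal (?v powr (s + 1))" .
  qed
  also have "\<dots> = ennreal (1 / (1 - 2 powr (- s))) * (\<integral>\<^sup>+z. ennreal (cmod (f z) powr (s + 1)) \<partial>M)"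
    by (rule nn_integral_cmult) simp
  finally show ?thesis .
qed

lemma sum_upper_masses:
  assumes f [measurable]: "f \<in> borel_measurable M" and s: "0 < s"
  shows "(\<integral>\<^sup>+j. ennreal (2 powr (real_of_int j * s)) * upper_masses M f j \<partial>count_space UNIV)
    \<le> ennreal (1 / (1 - 2 powr (- s)) * (1 / (1 - 2 powr (- s)))) * (\<integral>\<^sup>+z. ennreal (cmod (f z) powr (s + 1)) \<partial>M)"
proof -
  have lt: "2 powr (- s) < 1" using powr_less_mono[of "- s" 0 2] s by simp
  let ?T = "\<integral>\<^sup>+k. ennreal (2 powr (real_of_int k * s)) * upper_mass M f k \<partial>count_space UNIV"
  have "(\<integral>\<^sup>+j. ennreal (2 powr (real_of_int j * s)) * upper_masses M f j \<partial>count_space UNIV)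
    = (\<integral>\<^sup>+j. (\<Sum>i. ennreal (2 powr (real_of_int j * s)) * upper_mass M f (j + int i)) \<partial>count_space UNIV)"
    unfolding upper_masses_def by simp
  also have "\<dots> = (\<Sum>i. \<integral>\<^sup>+j. ennreal (2 powr (real_of_int j * s)) * upper_mass M f (j + int i) \<partial>count_space UNIV)"
    by (rule nn_integral_suminf) simp
  also have "\<dots> = (\<Sum>i. ennreal ((2 powr (- s)) ^ i) * ?T)"
  proof (rule suminf_cong)
    fix i
    have "(\<integral>\<^sup>+j. ennreal (2 powr (real_of_int j * s)) * upper_mass M f (j + int i) \<partial>count_space UNIV)
      = (\<integral>\<^sup>+j. ennreal ((2 powr (- s)) ^ i) * (ennreal (2 powr (real_of_int (j + int i) * s)) * upper_mass M f (j + int i)) \<partial>count_space UNIV)"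
    proof (rule nn_integral_cong)
      fix j
      have "2 powr (real_of_int j * s) = (2 powr (- s)) ^ i * 2 powr (real_of_int (j + int i) * s)"
        by (simp add: powr_realpow[symmetric] powr_powr powr_add[symmetric] algebra_simps)
      then have "ennreal (2 powr (real_of_int j * s)) = ennreal ((2 powr (- s)) ^ i) * ennreal (2 powr (real_of_int (j + int i) * s))"
        by (simp only:) (rule ennreal_mult, auto)
      then show "ennreal (2 powr (real_of_int j * s)) * upper_mass M f (j + int i) =
          ennreal ((2 powr (- s)) ^ i) * (ennreal (2 powr (real_of_int (j + int i) * s)) * upper_mass M f (j + int i))"
        by (simp only: mult.assoc)
    qed
    also have "\<dots> = ennreal ((2 powr (- s)) ^ i) * (\<integral>\<^sup>+j. ennreal (2 powr (real_of_int (j + int i) * s)) * upper_mass M f (j + int i) \<partial>count_space UNIV)"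
      by (rule nn_integral_cmult) simp
    also have "(\<integral>\<^sup>+j. ennreal (2 powr (real_of_int (j + int i) * s)) * upper_mass M f (j + int i) \<partial>count_space UNIV) = ?T"
      by (rule nn_integral_bij_count_space[where g = "\<lambda>j. j + int i"])
         (rule bij_betwI[where g = "\<lambda>j. j - int i"], auto)
    finally show "(\<integral>\<^sup>+j. ennreal (2 powr (real_of_int j * s)) * upper_mass M f (j + int i) \<partial>count_space UNIV) = ennreal ((2 powr (- s)) ^ i) * ?T" .
  qed
  also have "\<dots> = (\<Sum>i. ennreal ((2 powr (- s)) ^ i)) * ?T" by simp
  also have "(\<Sum>i. ennreal ((2 powr (- s)) ^ i)) = ennreal (1 / (1 - 2 powr (- s)))"
    using lt by (intro suminf_ennreal_eq geometric_sums) auto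
  also have "\<dots> * ?T \<le> ennreal (1 / (1 - 2 powr (- s))) * (ennreal (1 / (1 - 2 powr (- s))) * (\<integral>\<^sup>+z. ennreal (cmod (f z) powr (s + 1)) \<partial>M))"
    by (intro mult_left_mono sum_upper_mass f s) auto
  also have "\<dots> = ennreal (1 / (1 - 2 powr (- s)) * (1 / (1 - 2 powr (- s)))) * (\<integral>\<^sup>+z. ennreal (cmod (f z) powr (s + 1)) \<partial>M)"
    using lt by (subst ennreal_mult) (auto simp: mult.assoc)
  finally show ?thesis .
qed

lemma upper_masses_finite:
  assumes f: "f \<in> borel_measurable M" and s: "0 < s" and fin: "(\<integral>\<^sup>+z. ennreal (cmod (f z) powr (s + 1)) \<partial>M) < \<infinity>"
  shows "upper_masses M f j < \<infinity>"
proof -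
  have "ennreal (2 powr (real_of_int j * s)) * upper_masses M f j
    \<le> (\<integral>\<^sup>+j. ennreal (2 powr (real_of_int j * s)) * upper_masses M f j \<partial>count_space UNIV)"
    by (rule nn_integral_ge_point) simp
  also have "\<dots> < \<infinity>"
    using le_less_trans[OF sum_upper_masses[OF f s]] fin by (simp add: ennreal_mult_less_top)
  finally show ?thesis by (auto simp: ennreal_mult_less_top)
qed

lemma upper_masses_antimono: "i \<le> j \<Longrightarrow> upper_masses M f j \<le> upper_masses M f i"
  unfolding upper_masses_def
proof (intro suminf_le allI)
  fix n assume "i \<le> j"
  then have le: "2 powr real_of_int (i + int n) \<le> 2 powr real_of_int (j + int n)" by simp
  show "upper_mass M f (j + int n) \<le> upper_mass M f (i + int n)"
    unfolding upper_mass_def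
  proof (intro nn_integral_mono mult_left_mono)
    fix z
    have "2 powr real_of_int (j + int n) < cmod (f z) \<Longrightarrow> 2 powr real_of_int (i + int n) < cmod (f z)"
      using le by (rule le_less_trans)
    then show "indicator {z. 2 powr real_of_int (j + int n) < cmod (f z)} z
        \<le> (indicator {z. 2 powr real_of_int (i + int n) < cmod (f z)} z :: ennreal)"
      by (auto simp: indicator_def)
  qed auto
qed auto

text \<open>The height \<open>2\<^sup>j\<^sup>+\<^sup>1\<close> compensates the factor \<open>1/2\<close> that the truncated weak type estimate
introduces.\<close>

lemma upper_masses_eq:
  "upper_masses M f j = (\<Sum>k. \<integral>\<^sup>+y. ennreal (cmod (f y)) *
     indicator {y. ennreal (2 powr (real_of_int j + 1) * 2 ^ k / 2) < ennreal (cmod (f y))} y \<partial>M)"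
proof -
  have "2 powr (real_of_int j + 1) * 2 ^ k / 2 = 2 powr real_of_int (j + int k)" for k
    by (simp add: powr_add powr_realpow)
  then have "{y. ennreal (2 powr (real_of_int j + 1) * 2 ^ k / 2) < ennreal (cmod (f y))} = {y. 2 powr real_of_int (j + int k) < cmod (f y)}" for k
    by (simp add: ennreal_less_iff)
  then show ?thesis by (simp add: upper_masses_def upper_mass_def)
qed

lemma K_le_upper_masses:
  fixes f :: "(real^'n) \<times> real \<Rightarrow> complex"
  assumes f: "f \<in> L1_loc" and fin: "upper_masses rho f j < \<infinity>" and t: "0 < t"
  shows "f \<in> couple_sum star_rel H1 BMO"
    "Kf t f \<le> 6 * 2 ^ CARD('n) * (enn2real (upper_masses rho f j) + 2 powr real_of_int j * t)"
proof -
  let ?N = "2 ^ CARD('n) :: real"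
  have fm: "f \<in> borel_measurable rho" using f by (simp add: L1_loc_def)
  have l: "0 < 2 powr (real_of_int j + 1)" by simp
  obtain h g where hg: "h \<in> H1" "g \<in> BMO" and e: "f = (\<lambda>z. h z + g z)"
    and n: "H1_norm h \<le> 6 * ?N * enn2real (upper_masses rho f j)" "BMO_norm g \<le> 2 * ?N * 2 powr (real_of_int j + 1)"
    unfolding upper_masses_eq by (rule H1_BMO_decomposition[OF fm l fin[unfolded upper_masses_eq]])
  have r: "(f, (\<lambda>z. h z + g z)) \<in> star_rel" using star_rel_refl[OF f] e by simp
  then show "f \<in> couple_sum star_rel H1 BMO" using hg unfolding couple_sum_def by blast
  have "Kf t f \<le> H1_norm h + t * BMO_norm g" using K_le[OF hg r] t by simp
  also have "\<dots> \<le> 6 * ?N * enn2real (upper_masses rho f j) + t * (2 * ?N * 2 powr (real_of_int j + 1))"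
    using n t by (intro add_mono mult_left_mono) auto
  also have "t * (2 * ?N * 2 powr (real_of_int j + 1)) = 4 * (?N * (2 powr real_of_int j * t))" by (simp add: powr_add)
  also have "\<dots> \<le> 6 * (?N * (2 powr real_of_int j * t))" using t by (intro mult_right_mono) auto
  finally show "Kf t f \<le> 6 * ?N * (enn2real (upper_masses rho f j) + 2 powr real_of_int j * t)"
    by (simp add: algebra_simps)
qed

text \<open>Take the least \<open>j\<close> for which the sum of the masses is at most \<open>2\<^sup>j t\<close>. Then \<open>K(t, f) / t\<close> is at most a
multiple of \<open>2\<^sup>j\<close>, while \<open>j - 1\<close> belongs to the index set on the right, so a single term of the sum is already
large enough. If there is no least \<open>j\<close>, the bounds for \<open>j\<close> tending to minus infinity show \<open>K(t, f) = 0\<close>.\<close>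

lemma K_powr_le:
  fixes f :: "(real^'n) \<times> real \<Rightarrow> complex"
  assumes f: "f \<in> L1_loc" and fin: "\<And>j. upper_masses rho f j < \<infinity>" and t: "0 < t" and q: "0 < q"
  shows "ennreal ((Kf t f / t) powr q) \<le> ennreal ((24 * 2 ^ CARD('n)) powr q) *
    (\<integral>\<^sup>+j. ennreal (2 powr (real_of_int j * q)) * indicator {j. ennreal (2 powr real_of_int j * t) < upper_masses rho f j} j \<partial>count_space UNIV)"
    (is "?L \<le> ?R")
proof -
  let ?N = "2 ^ CARD('n) :: real"
  define J where "J = {j. upper_masses rho f j \<le> ennreal (2 powr real_of_int j * t)}"
  have K0: "0 \<le> Kf t f" by (rule K_nonneg[OF K_le_upper_masses(1)[OF f fin t] less_imp_le[OF t]])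
  have J: "Kf t f / t \<le> 12 * ?N * 2 powr real_of_int j" if "j \<in> J" for j
  proof -
    have "enn2real (upper_masses rho f j) \<le> 2 powr real_of_int j * t"
      using that t enn2real_mono[of "upper_masses rho f j" "ennreal (2 powr real_of_int j * t)"] by (simp add: J_def)
    then have "6 * ?N * (enn2real (upper_masses rho f j) + 2 powr real_of_int j * t) \<le> 6 * ?N * (2 powr real_of_int j * t + 2 powr real_of_int j * t)"
      by (intro mult_left_mono add_right_mono) auto
    also have "\<dots> = 12 * ?N * 2 powr real_of_int j * t" by simp
    finally have "Kf t f \<le> 12 * ?N * 2 powr real_of_int j * t"
      by (rule order.trans[OF K_le_upper_masses(2)[OF f fin t]])
    then show ?thesis using t by (simp add: field_simps)
  qed
  obtain j0 where j0: "j0 \<in> J"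
  proof -
    obtain c where c: "upper_masses rho f 0 = ennreal c" "0 \<le> c" using fin[of 0] by (cases "upper_masses rho f 0") auto
    obtain n :: nat where n: "c / t < 2 ^ n" using real_arch_pow[of 2 "c / t"] by auto
    have "upper_masses rho f (int n) \<le> ennreal c" using upper_masses_antimono[of 0 "int n" rho f] c by simp
    also have "\<dots> \<le> ennreal (2 powr real_of_int (int n) * t)"
      using n t by (intro ennreal_leI) (simp add: field_simps powr_realpow)
    finally show ?thesis using that[of "int n"] by (simp add: J_def)
  qed
  show ?thesis
  proof (cases "\<forall>j\<in>J. j - 1 \<in> J")
    case True
    have "j0 - int n \<in> J" for n
    proof (induction n)
      case (Suc n)
      then show ?case using True[rule_format, OF Suc] by (simp add: algebra_simps)
    qed (simp add: j0)
    then have le: "Kf t f / t \<le> 12 * ?N * 2 powr (real_of_int j0 - real n)" for n using J[of "j0 - int n"] by simp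
    have "Kf t f / t \<le> 0"
    proof (rule ccontr)
      assume "\<not> Kf t f / t \<le> 0"
      then have p: "0 < Kf t f / t" by simp
      obtain n :: nat where n: "12 * ?N * 2 powr real_of_int j0 / (Kf t f / t) < 2 ^ n" using real_arch_pow[of 2] by auto
      then have "12 * ?N * 2 powr real_of_int j0 < 2 ^ n * (Kf t f / t)" unfolding pos_divide_less_eq[OF p] .
      then have "12 * ?N * 2 powr real_of_int j0 < (Kf t f / t) * 2 ^ n" by (simp only: mult.commute)
      moreover have "(Kf t f / t) * 2 ^ n \<le> 12 * ?N * 2 powr (real_of_int j0 - real n) * 2 ^ n"
        using le[of n] by (intro mult_right_mono) auto
      moreover have "2 powr (real_of_int j0 - real n) * 2 ^ n = 2 powr real_of_int j0"
        by (simp add: powr_diff powr_realpow)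
      ultimately show False by (simp add: mult.assoc)
    qed
    then have "Kf t f / t = 0" using K0 t by (auto simp: divide_le_0_iff)
    then have "(Kf t f / t) powr q = 0" using q by (simp only: powr_zero_eq_one powr_0 refl)
    then show ?thesis by (simp only: ennreal_0 zero_le)
  next
    case False
    then obtain j where j: "j \<in> J" "j - 1 \<notin> J" by blast
    have "(Kf t f / t) powr q \<le> (12 * ?N * 2 powr real_of_int j) powr q"
      using J[OF j(1)] K0 t q by (intro powr_mono2) auto
    also have "12 * ?N * 2 powr real_of_int j = 24 * ?N * 2 powr real_of_int (j - 1)" by (simp add: powr_diff)
    also have "\<dots> powr q = (24 * ?N) powr q * 2 powr (real_of_int (j - 1) * q)" by (simp add: powr_mult powr_powr)
    finally have "?L \<le> ennreal ((24 * ?N) powr q) * ennreal (2 powr (real_of_int (j - 1) * q))"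
      by (simp add: ennreal_leI flip: ennreal_mult)
    also have "ennreal (2 powr (real_of_int (j - 1) * q)) = ennreal (2 powr (real_of_int (j - 1) * q)) *
      indicator {j. ennreal (2 powr real_of_int j * t) < upper_masses rho f j} (j - 1)"
      using j(2) by (simp add: J_def not_le)
    also have "ennreal ((24 * ?N) powr q) * \<dots> \<le> ?R"
      by (intro mult_left_mono nn_integral_ge_point) auto
    finally show ?thesis .
  qed
qed

lemma interp_integral_eq:
  fixes f :: "(real^'n) \<times> real \<Rightarrow> complex"
  assumes f: "f \<in> couple_sum star_rel H1 BMO" and q: "1 < q" "1 / q = 1 - \<psi>"
  shows "interp_integral star_rel H1 H1_norm BMO BMO_norm \<psi> q f
    = (\<integral>\<^sup>+t\<in>{0<..}. ennreal ((Kf t f / t) powr q) \<partial>lborel)"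
  unfolding interp_integral_def
proof (rule nn_integral_cong)
  fix t :: real
  have "q * (1 - \<psi>) = 1" unfolding q(2)[symmetric] using q(1) by simp
  then have pq: "\<psi> * q = q - 1" by (simp add: algebra_simps)
  have "(t powr (- \<psi>) * Kf t f) powr q / t = (Kf t f / t) powr q" if t: "0 < t"
  proof -
    have K: "0 \<le> Kf t f" using K_nonneg[OF f] t by simp
    have "t powr (- (q - 1)) / t powr 1 = t powr (- q)" unfolding powr_diff[symmetric] by simp
    then have e: "t powr (- (q - 1)) / t = t powr (- q)" using t by simp
    have "(t powr (- \<psi>) * Kf t f) powr q / t = Kf t f powr q * (t powr (- (q - 1)) / t)"
      using t K by (simp add: powr_mult powr_powr pq)
    also have "\<dots> = (Kf t f / t) powr q" unfolding e using t K by (simp add: powr_divide powr_minus_divide)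
    finally show ?thesis .
  qed
  then show "ennreal ((t powr (- \<psi>) * Kf t f) powr q / t) * indicator {0<..} t
      = ennreal ((Kf t f / t) powr q) * indicator {0<..} t"
    by (auto split: split_indicator)
qed

lemma interp_integral_le_Lp:
  fixes f :: "(real^'n) \<times> real \<Rightarrow> complex"
  assumes f: "f \<in> Lp q" and q: "1 < q" "1 / q = 1 - \<psi>"
  shows "f \<in> couple_sum star_rel H1 BMO"
    "interp_integral star_rel H1 H1_norm BMO BMO_norm \<psi> q f \<le>
      ennreal ((24 * 2 ^ CARD('n)) powr q * (1 / (1 - 2 powr (- (q - 1))) * (1 / (1 - 2 powr (- (q - 1)))))) *
      (\<integral>\<^sup>+z. ennreal (cmod (f z) powr q) \<partial>rho)"
proof -
  have fm [measurable]: "f \<in> borel_measurable rho" using Lp_nn_integral(1)[OF f] .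
  have loc: "f \<in> L1_loc" using Lp_L1_loc[OF f] q by simp
  have s: "0 < q - 1" using q by simp
  have fin: "upper_masses rho f j < \<infinity>" for j
    using Lp_nn_integral(2)[OF f] by (intro upper_masses_finite[OF fm s]) simp
  show cs: "f \<in> couple_sum star_rel H1 BMO" using K_le_upper_masses(1)[OF loc fin, of 1] by simp
  let ?C = "ennreal ((24 * 2 ^ CARD('n)) powr q)"
  have "interp_integral star_rel H1 H1_norm BMO BMO_norm \<psi> q f
      = (\<integral>\<^sup>+t\<in>{0<..}. ennreal ((Kf t f / t) powr q) \<partial>lborel)"
    by (rule interp_integral_eq[OF cs q])
  also have "\<dots> \<le> (\<integral>\<^sup>+t. (\<integral>\<^sup>+j. ?C * (ennreal (2 powr (real_of_int j * q)) *
      indicator {0<..<enn2real (upper_masses rho f j) / 2 powr real_of_int j} t) \<partial>count_space UNIV) \<partial>lborel)"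
  proof (rule nn_integral_mono)
    fix t :: real
    have "{j. ennreal (2 powr real_of_int j * t) < upper_masses rho f j} = {j. t \<in> {0<..<enn2real (upper_masses rho f j) / 2 powr real_of_int j}}" if t: "0 < t"
    proof (intro Collect_cong)
      fix j
      obtain c where c: "upper_masses rho f j = ennreal c" "0 \<le> c" using fin[of j] by (cases "upper_masses rho f j") auto
      show "ennreal (2 powr real_of_int j * t) < upper_masses rho f j \<longleftrightarrow> t \<in> {0<..<enn2real (upper_masses rho f j) / 2 powr real_of_int j}"
        using t c by (simp add: ennreal_less_iff pos_less_divide_eq mult.commute)
    qed
    then have "indicator {j. ennreal (2 powr real_of_int j * t) < upper_masses rho f j} j = (indicator {0<..<enn2real (upper_masses rho f j) / 2 powr real_of_int j} t :: ennreal)"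
      if "0 < t" for j using that by (auto simp: indicator_def)
    then show "ennreal ((Kf t f / t) powr q) * indicator {0<..} t \<le> (\<integral>\<^sup>+j. ?C * (ennreal (2 powr (real_of_int j * q)) *
      indicator {0<..<enn2real (upper_masses rho f j) / 2 powr real_of_int j} t) \<partial>count_space UNIV)"
      using K_powr_le[OF loc fin, of t q] q by (cases "0 < t") (auto simp: nn_integral_cmult)
  qed
  also have "\<dots> = (\<integral>\<^sup>+j. (\<integral>\<^sup>+t. ?C * (ennreal (2 powr (real_of_int j * q)) *
      indicator {0<..<enn2real (upper_masses rho f j) / 2 powr real_of_int j} t) \<partial>lborel) \<partial>count_space UNIV)"
    by (rule nn_integral_count_space_nn_integral) auto
  also have "\<dots> = (\<integral>\<^sup>+j. ?C * (ennreal (2 powr (real_of_int j * (q - 1))) * upper_masses rho f j) \<partial>count_space UNIV)"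
  proof (rule nn_integral_cong)
    fix j
    obtain c where c: "upper_masses rho f j = ennreal c" "0 \<le> c" using fin[of j] by (cases "upper_masses rho f j") auto
    have "(\<integral>\<^sup>+t. ?C * (ennreal (2 powr (real_of_int j * q)) * indicator {0<..<enn2real (upper_masses rho f j) / 2 powr real_of_int j} t) \<partial>lborel)
      = ?C * (ennreal (2 powr (real_of_int j * q)) * ennreal (c / 2 powr real_of_int j))"
      using c by (simp add: nn_integral_cmult nn_integral_cmult_indicator)
    also have "ennreal (2 powr (real_of_int j * q)) * ennreal (c / 2 powr real_of_int j) = ennreal (2 powr (real_of_int j * q) * (c / 2 powr real_of_int j))"
      using c by (intro ennreal_mult[symmetric]) auto
    also have "2 powr (real_of_int j * q) * (c / 2 powr real_of_int j) = 2 powr (real_of_int j * (q - 1)) * c"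
      by (simp add: right_diff_distrib powr_diff)
    also have "ennreal \<dots> = ennreal (2 powr (real_of_int j * (q - 1))) * upper_masses rho f j"
      unfolding c(1) using c(2) by (intro ennreal_mult) auto
    finally show "(\<integral>\<^sup>+t. ?C * (ennreal (2 powr (real_of_int j * q)) * indicator {0<..<enn2real (upper_masses rho f j) / 2 powr real_of_int j} t) \<partial>lborel)
      = ?C * (ennreal (2 powr (real_of_int j * (q - 1))) * upper_masses rho f j)" .
  qed
  also have "\<dots> = ?C * (\<integral>\<^sup>+j. ennreal (2 powr (real_of_int j * (q - 1))) * upper_masses rho f j \<partial>count_space UNIV)"
    by (rule nn_integral_cmult) simp
  also have "\<dots> \<le> ?C * (ennreal (1 / (1 - 2 powr (- (q - 1))) * (1 / (1 - 2 powr (- (q - 1))))) * (\<integral>\<^sup>+z. ennreal (cmod (f z) powr (q - 1 + 1)) \<partial>rho))"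
    by (intro mult_left_mono sum_upper_masses[OF fm s]) auto
  also have "\<dots> = ennreal ((24 * 2 ^ CARD('n)) powr q * (1 / (1 - 2 powr (- (q - 1))) * (1 / (1 - 2 powr (- (q - 1)))))) *
      (\<integral>\<^sup>+z. ennreal (cmod (f z) powr q) \<partial>rho)"
    by (subst ennreal_mult[of "(24 * 2 ^ CARD('n)) powr q"]) (auto simp: mult.assoc)
  finally show "interp_integral star_rel H1 H1_norm BMO BMO_norm \<psi> q f \<le>
      ennreal ((24 * 2 ^ CARD('n)) powr q * (1 / (1 - 2 powr (- (q - 1))) * (1 / (1 - 2 powr (- (q - 1)))))) *
      (\<integral>\<^sup>+z. ennreal (cmod (f z) powr q) \<partial>rho)" .
qed

section \<open>Oscillation over a cell and the K-functional\<close>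

lemma deviation_add:
  assumes f: "f \<in> L1_loc" and g: "g \<in> L1_loc" and R: "R \<in> CZ_sets"
  shows "(\<integral>\<^sup>+z\<in>R. ennreal (cmod (f z + g z - avg (\<lambda>z. f z + g z) R)) \<partial>rho)
    \<le> (\<integral>\<^sup>+z\<in>R. ennreal (cmod (f z - avg f R)) \<partial>rho) + (\<integral>\<^sup>+z\<in>R. ennreal (cmod (g z - avg g R)) \<partial>rho)"
proof -
  have [measurable]: "f \<in> borel_measurable rho" "g \<in> borel_measurable rho" "R \<in> sets rho"
    using f g CZ_sets_rho[OF R] by (auto simp: L1_loc_def)
  have av: "avg (\<lambda>z. f z + g z) R = avg f R + avg g R"
    unfolding avg_def using set_integral_add(2)[OF L1_loc_CZ(1)[OF f R] L1_loc_CZ(1)[OF g R]] by (simp add: scaleR_add_right)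
  have "(\<integral>\<^sup>+z\<in>R. ennreal (cmod (f z + g z - avg (\<lambda>z. f z + g z) R)) \<partial>rho)
      \<le> (\<integral>\<^sup>+z. ennreal (cmod (f z - avg f R)) * indicator R z + ennreal (cmod (g z - avg g R)) * indicator R z \<partial>rho)"
  proof (rule nn_integral_mono)
    fix z
    have "cmod (f z + g z - (avg f R + avg g R)) \<le> cmod (f z - avg f R) + cmod (g z - avg g R)"
      using norm_triangle_ineq[of "f z - avg f R" "g z - avg g R"] by (simp add: algebra_simps)
    then have "ennreal (cmod (f z + g z - (avg f R + avg g R))) \<le> ennreal (cmod (f z - avg f R)) + ennreal (cmod (g z - avg g R))"
      by (simp add: ennreal_leI flip: ennreal_plus)
    then show "ennreal (cmod (f z + g z - avg (\<lambda>z. f z + g z) R)) * indicator R z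
      \<le> ennreal (cmod (f z - avg f R)) * indicator R z + ennreal (cmod (g z - avg g R)) * indicator R z"
      unfolding av by (auto split: split_indicator)
  qed
  also have "\<dots> = (\<integral>\<^sup>+z\<in>R. ennreal (cmod (f z - avg f R)) \<partial>rho) + (\<integral>\<^sup>+z\<in>R. ennreal (cmod (g z - avg g R)) \<partial>rho)"
    by (rule nn_integral_add) measurable
  finally show ?thesis .
qed

text \<open>Membership in \<open>star_rel\<close> gives \<open>f = d + h + g\<close> with a function \<open>d\<close> of seminorm zero, and the mean
deviation is subadditive.\<close>

lemma box_deviation_decomposition:
  assumes h: "h \<in> H1" and g: "g \<in> BMO" and r: "(f, (\<lambda>z. h z + g z)) \<in> star_rel" and a: "admissible \<sigma>"
  shows "(\<integral>\<^sup>+z\<in>cell_box \<sigma> x. ennreal (cmod (f z - avg f (cell_box \<sigma> x))) \<partial>rho)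
    \<le> 2 * (\<integral>\<^sup>+z\<in>cell_box \<sigma> x. ennreal (cmod (h z)) \<partial>rho) + ennreal (BMO_norm g) * emeasure rho (cell_box \<sigma> x)"
proof -
  let ?R = "closed_box \<sigma> x"
  have R: "?R \<in> CZ_sets" by (rule closed_box_CZ[OF a])
  have pos: "emeasure rho ?R \<noteq> 0" using box_emeasure_pos(1)[OF a] by (simp add: box_eq_closed_box(2)[OF a])
  have loc: "f \<in> L1_loc" "h \<in> L1_loc" "g \<in> L1_loc" using r H1_L1(3)[OF h] g by (auto simp: star_rel_def BMO_def)
  define d where "d z = f z - (h z + g z)" for z
  have hg: "(\<lambda>z. h z + g z) \<in> L1_loc" by (rule H1_BMO_L1_loc[OF h g])
  have d: "d \<in> L1_loc" unfolding d_def by (rule L1_loc_diff[OF loc(1) hg])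
  have d0: "star_norm d = 0" using r by (simp add: star_rel_def d_def[abs_def])
  have [measurable]: "h \<in> borel_measurable rho" "cell_box \<sigma> x \<in> sets rho" "?R \<in> sets rho"
    using loc box_sets[OF a] closed_box_sets[OF a] by (auto simp: L1_loc_def)
  have fe: "f = (\<lambda>z. d z + (h z + g z))" by (simp add: d_def fun_eq_iff)
  let ?D = "\<lambda>f. \<integral>\<^sup>+z\<in>?R. ennreal (cmod (f z - avg f ?R)) \<partial>rho"
  have "(\<integral>\<^sup>+z\<in>cell_box \<sigma> x. ennreal (cmod (f z - avg f (cell_box \<sigma> x))) \<partial>rho) = ?D f"
    using loc by (intro box_deviation a) (auto simp: L1_loc_def)
  also have "\<dots> \<le> ?D d + ?D (\<lambda>z. h z + g z)"
    by (subst (1 2) fe) (rule deviation_add[OF d hg R])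
  also have "\<dots> \<le> ?D d + (?D h + ?D g)" by (intro add_left_mono deviation_add loc R)
  also have "\<dots> \<le> 0 + (2 * (\<integral>\<^sup>+z\<in>?R. ennreal (cmod (h z)) \<partial>rho) + star_norm g * emeasure rho ?R)"
    using CZ_deviation_le_star_norm[OF R pos, of d] d0
    by (intro add_mono deviation_le_L1 loc R CZ_deviation_le_star_norm pos) simp
  also have "star_norm g = ennreal (BMO_norm g)" using g by (simp add: BMO_norm_def BMO_def)
  also have "(\<integral>\<^sup>+z\<in>?R. ennreal (cmod (h z)) \<partial>rho) = (\<integral>\<^sup>+z\<in>cell_box \<sigma> x. ennreal (cmod (h z)) \<partial>rho)"
    using box_eq_closed_box(3)[OF a, of x] by (intro nn_integral_cong_AE) (auto elim!: eventually_mono split: split_indicator)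
  finally show ?thesis by (simp add: box_eq_closed_box(2)[OF a])
qed

lemma box_filtration:
  assumes "admissible c"
  shows "dyadic_filtration rho (cell_box c (x :: real^'n)) (cell_of (\<lambda>_. c)) (2 ^ CARD('n))"
    "\<And>z. z \<in> cell_box c x \<Longrightarrow> cell_of (\<lambda>_. c) 0 z = cell_box c x"
    "\<And>z n. z \<in> cell_box c x \<Longrightarrow> admissible (shape (\<lambda>_. c) n (ln (snd z)))"
proof -
  obtain k t r where c: "c = (k, t, r)" by (cases c)
  have b: "in_shape (ln (snd z)) c \<and> cell_box c (fst z) = cell_box c x" if "z \<in> cell_box c x" for z
  proof -
    have "0 < snd z" using that box_subset_S[of c x] by (auto simp: S_set_def)
    then have "in_shape (ln (snd z)) c" using that in_exp_interval_iff[of "snd z" t r k] by (auto simp: c box_eq)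
    moreover have "dcube k (fst z) = dcube k x" using that by (auto simp: c box_eq dcube_def)
    ultimately show ?thesis by (simp add: c box_eq)
  qed
  show "dyadic_filtration rho (cell_box c x) (cell_of (\<lambda>_. c)) (2 ^ CARD('n))"
    using b assms by (intro dyadic_filtration_boxes box_subset_S) auto
  show "cell_of (\<lambda>_. c) 0 z = cell_box c x" if "z \<in> cell_box c x" for z using b[OF that] by (simp add: cell_of_def)
  show "admissible (shape (\<lambda>_. c) n (ln (snd z)))" if "z \<in> cell_box c x" for z n
    using b[OF that] assms by (intro shape_props(1)) auto
qed

text \<open>Dividing a simple function below \<open>C g\<close> by \<open>C\<close> gives one below \<open>g\<close>, so \<open>g\<close> may fail to be measurable.
The lemma is applied to the K-functional, as a function of \<open>t\<close>.\<close>

lemma nn_integral_cmult_le: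
  fixes C :: real
  assumes C: "0 < C"
  shows "(\<integral>\<^sup>+x. ennreal C * g x \<partial>M) \<le> ennreal C * (\<integral>\<^sup>+x. g x \<partial>M)"
  unfolding nn_integral_def[of M "\<lambda>x. ennreal C * g x"]
proof (rule SUP_least)
  fix s assume "s \<in> {s. simple_function M s \<and> s \<le> (\<lambda>x. ennreal C * g x)}"
  then have s: "simple_function M s" "\<And>x. s x \<le> ennreal C * g x" by (auto simp: le_fun_def)
  have inv: "ennreal (1 / C) * ennreal C = 1" "ennreal C * ennreal (1 / C) = 1"
    using C by (simp_all flip: ennreal_mult)
  have s': "simple_function M (\<lambda>x. ennreal (1 / C) * s x)" using s(1) by simp
  have "integral\<^sup>S M s = ennreal C * (\<integral>\<^sup>Sx. ennreal (1 / C) * s x \<partial>M)"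
    using s(1) by (simp add: simple_integral_mult mult.assoc[symmetric] inv)
  also have "(\<integral>\<^sup>Sx. ennreal (1 / C) * s x \<partial>M) = (\<integral>\<^sup>+x. ennreal (1 / C) * s x \<partial>M)"
    by (rule nn_integral_eq_simple_integral[OF s', symmetric])
  also have "\<dots> \<le> (\<integral>\<^sup>+x. g x \<partial>M)"
  proof (rule nn_integral_mono)
    fix x
    have "ennreal (1 / C) * s x \<le> ennreal (1 / C) * (ennreal C * g x)" using s(2) by (intro mult_left_mono) auto
    then show "ennreal (1 / C) * s x \<le> g x" by (simp add: mult.assoc[symmetric] inv)
  qed
  finally show "integral\<^sup>S M s \<le> ennreal C * (\<integral>\<^sup>+x. g x \<partial>M)" by (simp add: mult_left_mono)
qed

text \<open>The constant of the sharp maximal estimate for \<open>N = 2\<^sup>d\<close> and \<open>m = d + 1\<close>, for which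
\<open>N + 1 \<le> 2\<^sup>m\<close>.\<close>

definition sharp_gap :: "nat \<Rightarrow> real \<Rightarrow> real" where
  "sharp_gap d q = 2 powr (- (real (Suc d) * q) - 1)"

definition sharp_const :: "nat \<Rightarrow> real \<Rightarrow> real" where
  "sharp_const d q = 2 * 2 powr (q * (real (Suc d) + 1)) * (2 * ((4 / sharp_gap d q) powr q / (1 - 2 powr (- q))))"

text \<open>Let \<open>W k\<close> be the set where the sharp maximal function exceeds \<open>\<gamma> 2\<^sup>k\<close>. If \<open>t\<close> is less than half the
measure of \<open>W k\<close>, then \<open>K(t, f) > \<gamma> 2\<^sup>k t / 4\<close>: otherwise some decomposition \<open>f = h + b\<close> has
norm of \<open>b\<close> below \<open>\<gamma> 2\<^sup>k / 2\<close> and norm of \<open>h\<close> below \<open>\<gamma> 2\<^sup>k t / 2\<close>, so \<open>W k\<close> is contained in the set where the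
maximal function of \<open>|h|\<close> exceeds \<open>\<gamma> 2\<^sup>k / 4\<close>, and the weak type estimate bounds its measure by \<open>2 t\<close>.
Writing the measures of the \<open>W k\<close> as integrals over \<open>t\<close> turns the sum in the sharp maximal estimate into
the interpolation integral.\<close>

lemma box_oscillation_le_interp:
  fixes f :: "(real^'n) \<times> real \<Rightarrow> complex"
  assumes f: "f \<in> couple_sum star_rel H1 BMO" and q: "1 < q" "1 / q = 1 - \<psi>" and c: "admissible c"
  shows "(\<integral>\<^sup>+z\<in>cell_box c x. ennreal (cmod (f z - avg f (cell_box c x)) powr q) \<partial>rho)
    \<le> ennreal (sharp_const CARD('n) q) * interp_integral star_rel H1 H1_norm BMO BMO_norm \<psi> q f"
proof -
  let ?N = "2 ^ CARD('n) :: real" and ?m = "Suc CARD('n)" and ?g = "sharp_gap CARD('n) q"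
  have g: "0 < ?g" by (simp add: sharp_gap_def)
  have lt: "2 powr (- q) < 1" using powr_less_mono[of "- q" 0 2] q by simp
  obtain h0 g0 where "h0 \<in> H1" "g0 \<in> BMO" "(f, (\<lambda>z. h0 z + g0 z)) \<in> star_rel" using f by (auto simp: couple_sum_def)
  then have loc: "f \<in> L1_loc" by (simp add: star_rel_def)
  have fm: "f \<in> borel_measurable rho" using loc by (simp add: L1_loc_def)
  interpret dyadic_filtration rho "cell_box c x" "cell_of (\<lambda>_. c)" ?N by (rule box_filtration(1)[OF c])
  have mean_avg: "mean = avg" by (simp add: fun_eq_iff mean_def avg_def)
  have fi: "set_integrable rho (cell_box c x) f"
    using L1_loc_CZ(1)[OF loc closed_box_CZ[OF c]] box_sets[OF c] closed_box_null(1)[OF c] by (rule set_integrable_subset)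
  define W where "W k = reach (osc f (?g * 2 powr real_of_int k))" for k :: int
  have Wfin: "emeasure rho (W k) = ennreal (measure rho (W k))" for k
  proof -
    have "emeasure rho (W k) \<le> emeasure rho (cell_box c x)"
      unfolding W_def using reach_subset by (intro emeasure_mono) auto
    then show ?thesis using box_emeasure_pos(3)[OF c, of x] by (intro emeasure_eq_ennreal_measure) (auto simp: top_unique)
  qed
  have K0: "0 \<le> Kf t f" if "0 < t" for t using K_nonneg[OF f] that by simp
  have level: "2 powr real_of_int k < 4 * Kf t f / (?g * t)" if t: "0 < t" "t < measure rho (W k) / 2" for k t
  proof (rule ccontr)
    let ?l = "?g * 2 powr real_of_int k"
    have l: "0 < ?l" using g by simp
    assume "\<not> 2 powr real_of_int k < 4 * Kf t f / (?g * t)"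
    then have "4 * Kf t f \<le> ?l * t" using t g by (simp add: not_less field_simps)
    moreover have "0 < ?l * t" using l t by simp
    ultimately have "Kf t f < ?l * t / 2" by linarith
    moreover have "{H1_norm x0 + t * BMO_norm x1 |x0 x1. x0 \<in> H1 \<and> x1 \<in> BMO \<and> (f, \<lambda>z. x0 z + x1 z) \<in> star_rel} \<noteq> {}"
      using f by (auto simp: couple_sum_def)
    ultimately have "\<exists>s\<in>{H1_norm x0 + t * BMO_norm x1 |x0 x1. x0 \<in> H1 \<and> x1 \<in> BMO \<and> (f, \<lambda>z. x0 z + x1 z) \<in> star_rel}. s < ?l * t / 2"
      unfolding K_functional_def by (intro cInf_lessD)
    then obtain h b where hb: "h \<in> H1" "b \<in> BMO" "(f, (\<lambda>z. h z + b z)) \<in> star_rel"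
      and s: "H1_norm h + t * BMO_norm b < ?l * t / 2" by blast
    have "t * BMO_norm b < t * (?l / 2)" using s H1_L1(2)[OF hb(1)] by (simp add: mult.commute)
    then have b: "BMO_norm b < ?l / 2" using t by (simp only: mult_less_cancel_left_pos)
    have h: "H1_norm h < ?l * t / 2" using s t BMO_norm_nonneg[of b] mult_nonneg_nonneg[of t "BMO_norm b"] by linarith
    have hm [measurable]: "(\<lambda>z. ennreal (cmod (h z))) \<in> borel_measurable rho"
      using H1_L1(3)[OF hb(1)] by (auto simp: L1_loc_def)
    have "W k \<subseteq> reach (big (\<lambda>z. ennreal (cmod (h z))) (?l / 4))"
    proof
      fix z assume "z \<in> W k"
      then obtain n where z: "z \<in> cell_box c x" and n: "osc f ?l (cell_of (\<lambda>_. c) n z)" by (auto simp: W_def reach_def)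
      let ?R = "cell_of (\<lambda>_. c) n z"
      have "dev f ?R \<le> 2 * (\<integral>\<^sup>+z\<in>?R. ennreal (cmod (h z)) \<partial>rho) + ennreal (BMO_norm b) * emeasure rho ?R"
        unfolding dev_def mean_avg cell_of_def
        by (rule box_deviation_decomposition[OF hb box_filtration(3)[OF c z]])
      also have "\<dots> \<le> 2 * (\<integral>\<^sup>+z\<in>?R. ennreal (cmod (h z)) \<partial>rho) + ennreal (?l / 2) * emeasure rho ?R"
        using b by (intro add_left_mono mult_right_mono ennreal_leI) auto
      finally have dev: "dev f ?R \<le> 2 * (\<integral>\<^sup>+z\<in>?R. ennreal (cmod (h z)) \<partial>rho) + ennreal (?l / 2) * emeasure rho ?R" .
      have "big (\<lambda>z. ennreal (cmod (h z))) (?l / 4) ?R"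
      proof (rule ccontr)
        assume "\<not> big (\<lambda>z. ennreal (cmod (h z))) (?l / 4) ?R"
        then have "(\<integral>\<^sup>+z\<in>?R. ennreal (cmod (h z)) \<partial>rho) \<le> ennreal (?l / 4) * emeasure rho ?R" by (simp add: big_def not_less)
        then have "dev f ?R \<le> 2 * (ennreal (?l / 4) * emeasure rho ?R) + ennreal (?l / 2) * emeasure rho ?R"
          by (intro order.trans[OF dev] add_right_mono mult_left_mono) auto
        also have "\<dots> = (ennreal (?l / 4) + ennreal (?l / 4) + ennreal (?l / 2)) * emeasure rho ?R"
          by (simp add: mult_2 distrib_right)
        also have "ennreal (?l / 4) + ennreal (?l / 4) + ennreal (?l / 2) = ennreal (?l / 4 + ?l / 4 + ?l / 2)"
          using l by (simp only: ennreal_plus add_nonneg_nonneg divide_nonneg_pos less_imp_le zero_less_numeral)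
        also have "?l / 4 + ?l / 4 + ?l / 2 = ?l" by simp
        finally show False using n by (simp add: osc_def)
      qed
      then show "z \<in> reach (big (\<lambda>z. ennreal (cmod (h z))) (?l / 4))" using z by (auto intro: reachI)
    qed
    then have "ennreal (?l / 4) * emeasure rho (W k) \<le> ennreal (?l / 4) * emeasure rho (reach (big (\<lambda>z. ennreal (cmod (h z))) (?l / 4)))"
      by (intro mult_left_mono emeasure_mono) auto
    also have "\<dots> \<le> (\<integral>\<^sup>+z\<in>reach (big (\<lambda>z. ennreal (cmod (h z))) (?l / 4)). ennreal (cmod (h z)) \<partial>rho)"
      by (rule weak_type[OF hm])
    also have "\<dots> \<le> (\<integral>\<^sup>+z. ennreal (cmod (h z)) \<partial>rho)"
      by (intro nn_integral_mono) (auto split: split_indicator)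
    also have "\<dots> \<le> ennreal (H1_norm h)" by (rule H1_L1(1)[OF hb(1)])
    also have "\<dots> \<le> ennreal (?l * t / 2)" using h by (intro ennreal_leI) simp
    finally have "ennreal (?l / 4 * measure rho (W k)) \<le> ennreal (?l * t / 2)"
      unfolding Wfin using l by (simp only: ennreal_mult' less_imp_le divide_pos_pos zero_less_numeral)
    then have "?l / 4 * measure rho (W k) \<le> ?l * t / 2" using l t by simp
    then have "?l * (measure rho (W k) / 4) \<le> ?l * (t / 2)" by (simp only: times_divide_eq_right times_divide_eq_left)
    then have "measure rho (W k) / 4 \<le> t / 2" using l by (simp only: mult_le_cancel_left_pos)
    then show False using t by simp
  qed
  have "(\<integral>\<^sup>+k. ennreal (2 powr (real_of_int k * q)) * emeasure rho (W k) \<partial>count_space UNIV)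
    = (\<integral>\<^sup>+k. (\<integral>\<^sup>+t. 2 * (ennreal (2 powr (real_of_int k * q)) * indicator {0<..<measure rho (W k) / 2} t) \<partial>lborel) \<partial>count_space UNIV)"
  proof (rule nn_integral_cong)
    fix k
    have "2 * ennreal (measure rho (W k) / 2) = ennreal (measure rho (W k))"
      using ennreal_mult[of 2 "measure rho (W k) / 2"] by simp
    then show "ennreal (2 powr (real_of_int k * q)) * emeasure rho (W k)
      = (\<integral>\<^sup>+t. 2 * (ennreal (2 powr (real_of_int k * q)) * indicator {0<..<measure rho (W k) / 2} t) \<partial>lborel)"
      by (simp add: nn_integral_cmult nn_integral_cmult_indicator Wfin mult.left_commute[of 2])
  qed
  also have "\<dots> = (\<integral>\<^sup>+t. (\<integral>\<^sup>+k. 2 * (ennreal (2 powr (real_of_int k * q)) * indicator {0<..<measure rho (W k) / 2} t) \<partial>count_space UNIV) \<partial>lborel)"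
    by (rule nn_integral_count_space_nn_integral[symmetric]) auto
  also have "\<dots> \<le> (\<integral>\<^sup>+t. ennreal (2 * ((4 / ?g) powr q / (1 - 2 powr (- q)))) * (ennreal ((Kf t f / t) powr q) * indicator {0<..} t) \<partial>lborel)"
  proof (rule nn_integral_mono)
    fix t :: real
    show "(\<integral>\<^sup>+k. 2 * (ennreal (2 powr (real_of_int k * q)) * indicator {0<..<measure rho (W k) / 2} t) \<partial>count_space UNIV)
      \<le> ennreal (2 * ((4 / ?g) powr q / (1 - 2 powr (- q)))) * (ennreal ((Kf t f / t) powr q) * indicator {0<..} t)"
    proof (cases "0 < t")
      case True
      let ?v = "4 * Kf t f / (?g * t)"
      have v: "0 \<le> ?v" using K0[OF True] g True by simp
      have "(\<integral>\<^sup>+k. 2 * (ennreal (2 powr (real_of_int k * q)) * indicator {0<..<measure rho (W k) / 2} t) \<partial>count_space UNIV)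
        \<le> (\<integral>\<^sup>+k. 2 * (ennreal (2 powr (real_of_int k * q)) * indicator {k. 2 powr real_of_int k < ?v} k) \<partial>count_space UNIV)"
        using level[OF True] by (intro nn_integral_mono mult_left_mono) (auto split: split_indicator)
      also have "\<dots> = 2 * (\<integral>\<^sup>+k. ennreal (2 powr (real_of_int k * q)) * indicator {k. 2 powr real_of_int k < ?v} k \<partial>count_space UNIV)"
        by (rule nn_integral_cmult) simp
      also have "\<dots> \<le> 2 * ennreal (?v powr q / (1 - 2 powr (- q)))"
        using q by (intro mult_left_mono dyadic_sum_below v) auto
      also have "\<dots> = ennreal (2 * (?v powr q / (1 - 2 powr (- q))))"
        using lt by (subst ennreal_mult) auto
      also have "?v powr q = (4 / ?g) powr q * (Kf t f / t) powr q"
        using K0[OF True] True g by (simp add: powr_mult[symmetric])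
      also have "2 * ((4 / ?g) powr q * (Kf t f / t) powr q / (1 - 2 powr (- q))) = 2 * ((4 / ?g) powr q / (1 - 2 powr (- q))) * (Kf t f / t) powr q"
        by simp
      also have "ennreal \<dots> = ennreal (2 * ((4 / ?g) powr q / (1 - 2 powr (- q)))) * ennreal ((Kf t f / t) powr q)"
        using lt by (intro ennreal_mult) auto
      finally show ?thesis using True by simp
    qed simp
  qed
  also have "\<dots> \<le> ennreal (2 * ((4 / ?g) powr q / (1 - 2 powr (- q)))) * interp_integral star_rel H1 H1_norm BMO BMO_norm \<psi> q f"
    unfolding interp_integral_eq[OF f q] using lt g by (intro nn_integral_cmult_le) simp
  finally have S: "(\<integral>\<^sup>+k. ennreal (2 powr (real_of_int k * q)) * emeasure rho (W k) \<partial>count_space UNIV)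
    \<le> ennreal (2 * ((4 / ?g) powr q / (1 - 2 powr (- q)))) * interp_integral star_rel H1 H1_norm BMO BMO_norm \<psi> q f" .
  have m: "?N + 1 \<le> 2 ^ ?m" using one_le_power[of "2 :: real" "CARD('n)"] by simp
  have "(\<integral>\<^sup>+z\<in>cell_box c x. ennreal (cmod (f z - avg f (cell_box c x)) powr q) \<partial>rho)
    \<le> ennreal (2 * 2 powr (q * (real ?m + 1))) * (\<integral>\<^sup>+k. ennreal (2 powr (real_of_int k * q)) * emeasure rho (W k) \<partial>count_space UNIV)"
    using sharp_maximal_estimate[OF fm fi box_filtration(2)[OF c] _ m, of q] q unfolding mean_avg W_def sharp_gap_def by simp
  also have "\<dots> \<le> ennreal (2 * 2 powr (q * (real ?m + 1))) * (ennreal (2 * ((4 / ?g) powr q / (1 - 2 powr (- q)))) * interp_integral star_rel H1 H1_norm BMO BMO_norm \<psi> q f)"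
    by (rule mult_left_mono[OF S]) simp
  also have "\<dots> = ennreal (sharp_const CARD('n) q) * interp_integral star_rel H1 H1_norm BMO BMO_norm \<psi> q f"
    unfolding sharp_const_def using lt by (subst (3) ennreal_mult) (auto simp: mult.assoc)
  finally show ?thesis .
qed

section \<open>Exhausting the orthants\<close>

text \<open>The point selects the dyadic cubes with a vertex at the origin; \<open>-1\<close> lies in the cube on the negative side for
every side length of at least \<open>1\<close>.\<close>

definition orthant_point :: "'n set \<Rightarrow> real^'n" where
  "orthant_point P = (\<chi> i. if i \<in> P then 0 else - 1)"

definition orthant_box :: "'n set \<Rightarrow> nat \<Rightarrow> ((real^'n) \<times> real) set" where
  "orthant_box P n = cell_box (4 * int (Suc n), 0, real (Suc n)) (orthant_point P)"

definition orthant :: "(real^'n) \<times> real \<Rightarrow> 'n set" where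
  "orthant z = {i. 0 \<le> fst z $ i}"

lemma orthant_box_admissible: "admissible (4 * int (Suc n), 0, real (Suc n))"
  by (rule admissible_large) auto

text \<open>The set \<open>P\<close> lists the nonnegative coordinates. The cells for fixed \<open>P\<close> increase to the part of the group
over one orthant.\<close>

lemma orthant_box_iff:
  "z \<in> orthant_box P n \<longleftrightarrow> orthant z = P \<and> (\<forall>i. - (16 ^ Suc n) \<le> fst z $ i \<and> fst z $ i < 16 ^ Suc n) \<and>
     exp (- real (Suc n)) < snd z \<and> snd z \<le> exp (real (Suc n))"
proof -
  let ?L = "16 ^ Suc n :: real"
  have i: "4 * int (Suc n) = int (4 * Suc n)" by simp
  have L: "2 powi (4 * int (Suc n)) = ?L" unfolding i power_int_of_nat power_mult by simp
  have L1: "1 \<le> ?L" by (rule one_le_power) simp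
  have f: "\<lfloor>orthant_point P $ i / ?L\<rfloor> = (if i \<in> P then 0 else - 1)" for i
  proof (cases "i \<in> P")
    case False
    have "\<lfloor>- 1 / ?L\<rfloor> = - 1" unfolding floor_eq_iff using L1 by (simp add: field_simps)
    then show ?thesis using False by (simp add: orthant_point_def)
  qed (simp add: orthant_point_def)
  have "(?L * of_int (if i \<in> P then 0 else - 1) \<le> y \<and> y < ?L * (of_int (if i \<in> P then 0 else - 1) + 1))
      \<longleftrightarrow> (0 \<le> y \<longleftrightarrow> i \<in> P) \<and> - ?L \<le> y \<and> y < ?L" for y :: real and i
    using L1 by (cases "i \<in> P") auto
  then have "fst z \<in> dcube (4 * int (Suc n)) (orthant_point P) \<longleftrightarrow> (\<forall>i. (0 \<le> fst z $ i \<longleftrightarrow> i \<in> P) \<and> - ?L \<le> fst z $ i \<and> fst z $ i < ?L)"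
    unfolding dcube_eq L f mem_Collect_eq by simp
  also have "\<dots> \<longleftrightarrow> orthant z = P \<and> (\<forall>i. - ?L \<le> fst z $ i \<and> fst z $ i < ?L)"
    by (auto simp: orthant_def)
  finally show ?thesis by (cases z) (simp add: orthant_box_def box_eq del: power_Suc)
qed

lemma incseq_orthant_box: "incseq (orthant_box P)"
proof (rule incseq_SucI, rule subsetI)
  fix n z assume z: "z \<in> orthant_box P n"
  have p: "(16 :: real) ^ Suc n \<le> 16 ^ Suc (Suc n)" by (rule power_increasing) auto
  have e: "exp (- real (Suc (Suc n))) \<le> exp (- real (Suc n))" "exp (real (Suc n)) \<le> exp (real (Suc (Suc n)))" by simp_all
  have "- (16 ^ Suc (Suc n)) \<le> fst z $ i \<and> fst z $ i < 16 ^ Suc (Suc n)" for i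
  proof -
    have "- (16 ^ Suc n) \<le> fst z $ i \<and> fst z $ i < 16 ^ Suc n" using z unfolding orthant_box_iff by blast
    then show ?thesis using p by linarith
  qed
  moreover have "exp (- real (Suc (Suc n))) < snd z \<and> snd z \<le> exp (real (Suc (Suc n)))"
    using z e unfolding orthant_box_iff by linarith
  ultimately show "z \<in> orthant_box P (Suc n)" using z unfolding orthant_box_iff by blast
qed

lemma orthant_box_covers:
  assumes "z \<in> S_set"
  shows "\<exists>n. z \<in> orthant_box (orthant z) n"
proof -
  have a: "0 < snd z" using assms by (auto simp: S_set_def)
  obtain n0 :: nat where n0: "(\<Sum>i\<in>UNIV. \<bar>fst z $ i\<bar>) + \<bar>ln (snd z)\<bar> < real n0" using reals_Archimedean2 by blast
  let ?n = "Suc n0"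
  have "real n0 < 2 ^ n0" by (rule of_nat_less_two_power)
  also have "(2 :: real) ^ n0 \<le> 16 ^ n0" by (rule power_mono) auto
  also have "(16 :: real) ^ n0 \<le> 16 ^ ?n" by (rule power_increasing) auto
  finally have p: "real n0 < 16 ^ ?n" .
  have s0: "0 \<le> (\<Sum>i\<in>UNIV. \<bar>fst z $ i\<bar>)" by (rule sum_nonneg) simp
  have 1: "- (16 ^ ?n) \<le> fst z $ i \<and> fst z $ i < 16 ^ ?n" for i
  proof -
    have "\<bar>fst z $ i\<bar> \<le> (\<Sum>i\<in>UNIV. \<bar>fst z $ i\<bar>)" by (rule member_le_sum) auto
    then have "\<bar>fst z $ i\<bar> < 16 ^ ?n" using n0 p abs_ge_zero[of "ln (snd z)"] by linarith
    then show ?thesis unfolding abs_less_iff by linarith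
  qed
  have "- real ?n < ln (snd z)" "ln (snd z) \<le> real ?n" using n0 s0 by linarith+
  then have "exp (- real ?n) < exp (ln (snd z)) \<and> exp (ln (snd z)) \<le> exp (real ?n)"
    by (simp only: exp_less_cancel_iff exp_le_cancel_iff simp_thms)
  then have 2: "exp (- real ?n) < snd z \<and> snd z \<le> exp (real ?n)" using a by simp
  show ?thesis unfolding orthant_box_iff using 1 2 by blast
qed

lemma measure_orthant_box: "real (Suc n) \<le> measure rho (orthant_box P n)"
proof -
  have "(1 :: real) \<le> 2 powi (4 * int (Suc n))" by (rule one_le_power_int) auto
  then have "1 * real (Suc n) \<le> (2 powi (4 * int (Suc n))) ^ CARD('a) * (2 * real (Suc n))"
    by (intro mult_mono one_le_power) auto
  then show ?thesis unfolding orthant_box_def by (subst measure_box) auto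
qed

lemma orthant_box_sets [measurable]: "orthant_box P n \<in> sets rho"
  unfolding orthant_box_def by (rule box_sets[OF orthant_box_admissible])

lemma emeasure_orthant_box: "emeasure rho (orthant_box P n) = ennreal (measure rho (orthant_box P n))"
  using box_emeasure_pos(3)[OF orthant_box_admissible, of n "orthant_point P"] unfolding orthant_box_def
  by (intro emeasure_eq_ennreal_measure) auto

lemma orthant_region_sets [measurable]: "{z \<in> S_set. orthant z = P} \<in> sets rho"
proof -
  have "{z \<in> S_set. orthant z = P} = (\<Union>n. orthant_box P n)"
  proof (intro set_eqI iffI)
    fix z assume "z \<in> {z \<in> S_set. orthant z = P}"
    then show "z \<in> (\<Union>n. orthant_box P n)" using orthant_box_covers[of z] by auto
  next
    fix z assume "z \<in> (\<Union>n. orthant_box P n)"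
    then obtain n where n: "z \<in> orthant_box P n" by auto
    then have "orthant z = P" unfolding orthant_box_iff by blast
    moreover have "z \<in> S_set" using n box_subset_S unfolding orthant_box_def by blast
    ultimately show "z \<in> {z \<in> S_set. orthant z = P}" by simp
  qed
  then show ?thesis by auto
qed

lemma powr_norm_add_le:
  assumes "0 < q"
  shows "ennreal (cmod (u + v) powr q) \<le> ennreal (2 powr q) * (ennreal (cmod u powr q) + ennreal (cmod v powr q))"
proof -
  have "cmod (u + v) \<le> 2 * max (cmod u) (cmod v)" using norm_triangle_ineq[of u v] by linarith
  then have "cmod (u + v) powr q \<le> (2 * max (cmod u) (cmod v)) powr q" using assms by (intro powr_mono2) auto
  also have "\<dots> = 2 powr q * max (cmod u) (cmod v) powr q" by (simp add: powr_mult)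
  also have "\<dots> \<le> 2 powr q * (cmod u powr q + cmod v powr q)"
    by (intro mult_left_mono) (auto simp: max_def)
  finally have "ennreal (cmod (u + v) powr q) \<le> ennreal (2 powr q * (cmod u powr q + cmod v powr q))" by (rule ennreal_leI)
  then show ?thesis by (simp add: ennreal_mult)
qed

text \<open>Comparing \<open>f\<close> on a cell with its means over that cell and a larger one shows that the means form a Cauchy
sequence, since the measure of the cells tends to infinity. Their limit is the constant, by Fatou's lemma.\<close>

lemma orthant_constant:
  fixes f :: "(real^'n) \<times> real \<Rightarrow> complex"
  assumes fm [measurable]: "f \<in> borel_measurable rho" and q: "1 < q"
    and osc: "\<And>n. (\<integral>\<^sup>+z\<in>orthant_box P n. ennreal (cmod (f z - avg f (orthant_box P n)) powr q) \<partial>rho) \<le> ennreal B"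
    and B: "0 \<le> B"
  obtains c where "(\<integral>\<^sup>+z\<in>{z \<in> S_set. orthant z = P}. ennreal (cmod (f z - c) powr q) \<partial>rho) \<le> ennreal B"
proof -
  define c where "c n = avg f (orthant_box P n)" for n
  define D where "D = 2 powr q * (B + B)"
  have D: "0 \<le> D" using B by (simp add: D_def)
  have close: "cmod (c n - c m) powr q * real (Suc n) \<le> D" if nm: "n \<le> m" for n m
  proof -
    let ?R = "orthant_box P n"
    have sub: "?R \<subseteq> orthant_box P m" using incseq_orthant_box nm by (auto simp: incseq_def)
    have osc_m: "(\<integral>\<^sup>+z\<in>?R. ennreal (cmod (f z - c m) powr q) \<partial>rho) \<le> ennreal B"
    proof -
      have "(\<integral>\<^sup>+z\<in>?R. ennreal (cmod (f z - c m) powr q) \<partial>rho) \<le> (\<integral>\<^sup>+z\<in>orthant_box P m. ennreal (cmod (f z - c m) powr q) \<partial>rho)"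
        using sub by (intro nn_integral_mono) (auto split: split_indicator)
      then show ?thesis using osc[of m] unfolding c_def by (rule order.trans)
    qed
    have "ennreal (cmod (c n - c m) powr q) * emeasure rho ?R = (\<integral>\<^sup>+z\<in>?R. ennreal (cmod (c n - c m) powr q) \<partial>rho)"
      by (simp add: nn_integral_cmult_indicator)
    also have "\<dots> \<le> (\<integral>\<^sup>+z. ennreal (2 powr q) * (ennreal (cmod (f z - c n) powr q) * indicator ?R z + ennreal (cmod (f z - c m) powr q) * indicator ?R z) \<partial>rho)"
    proof (rule nn_integral_mono)
      fix z
      have "cmod ((c n - f z) + (f z - c m)) = cmod (c n - c m)" by simp
      then show "ennreal (cmod (c n - c m) powr q) * indicator ?R z
        \<le> ennreal (2 powr q) * (ennreal (cmod (f z - c n) powr q) * indicator ?R z + ennreal (cmod (f z - c m) powr q) * indicator ?R z)"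
        using powr_norm_add_le[of q "c n - f z" "f z - c m"] q by (auto simp: norm_minus_commute split: split_indicator)
    qed
    also have "\<dots> = ennreal (2 powr q) * ((\<integral>\<^sup>+z\<in>?R. ennreal (cmod (f z - c n) powr q) \<partial>rho) + (\<integral>\<^sup>+z\<in>?R. ennreal (cmod (f z - c m) powr q) \<partial>rho))"
      by (simp add: nn_integral_cmult nn_integral_add)
    also have "\<dots> \<le> ennreal (2 powr q) * (ennreal B + ennreal B)"
      using osc[of n] osc_m unfolding c_def by (intro mult_left_mono add_mono) auto
    also have "\<dots> = ennreal D" unfolding D_def using B by (simp only: ennreal_mult powr_ge_zero add_nonneg_nonneg ennreal_plus)
    finally have "cmod (c n - c m) powr q * measure rho ?R \<le> D"
      using D by (simp add: emeasure_orthant_box flip: ennreal_mult)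
    moreover have "cmod (c n - c m) powr q * real (Suc n) \<le> cmod (c n - c m) powr q * measure rho ?R"
      by (intro mult_left_mono measure_orthant_box) simp
    ultimately show ?thesis by simp
  qed
  have "Cauchy c"
  proof (rule metric_CauchyI)
    fix e :: real assume e: "0 < e"
    obtain N :: nat where N: "D / (e / 2) powr q < real N" using reals_Archimedean2 by blast
    have ep: "0 < (e / 2) powr q" using e by simp
    have near: "dist (c N) (c m) < e / 2" if "N \<le> m" for m
    proof (rule ccontr)
      assume "\<not> dist (c N) (c m) < e / 2"
      then have "(e / 2) powr q \<le> cmod (c N - c m) powr q" using q e by (intro powr_mono2) (auto simp: dist_norm)
      then have "(e / 2) powr q * real (Suc N) \<le> cmod (c N - c m) powr q * real (Suc N)" by (intro mult_right_mono) auto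
      also have "\<dots> \<le> D" by (rule close[OF that])
      finally have "real (Suc N) \<le> D / (e / 2) powr q" unfolding pos_le_divide_eq[OF ep] by (simp only: mult.commute)
      then show False using N by simp
    qed
    show "\<exists>M. \<forall>m\<ge>M. \<forall>n\<ge>M. dist (c m) (c n) < e"
    proof (intro exI allI impI)
      fix m n assume "N \<le> m" "N \<le> n"
      then show "dist (c m) (c n) < e" using dist_triangle_half_r[OF near near] by blast
    qed
  qed
  then obtain c0 where c0: "c \<longlonglongrightarrow> c0" by (auto simp: Cauchy_convergent_iff convergent_def)
  let ?O = "{z \<in> S_set. orthant z = P}"
  have "(\<integral>\<^sup>+z\<in>?O. ennreal (cmod (f z - c0) powr q) \<partial>rho)
    \<le> (\<integral>\<^sup>+z. liminf (\<lambda>n. ennreal (cmod (f z - c n) powr q) * indicator (orthant_box P n) z) \<partial>rho)"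
  proof (rule nn_integral_mono)
    fix z
    show "ennreal (cmod (f z - c0) powr q) * indicator ?O z \<le> liminf (\<lambda>n. ennreal (cmod (f z - c n) powr q) * indicator (orthant_box P n) z)"
    proof (cases "z \<in> ?O")
      case True
      then obtain n0 where "z \<in> orthant_box P n0" using orthant_box_covers[of z] by auto
      then have ev: "\<forall>\<^sub>F n in sequentially. z \<in> orthant_box P n"
        unfolding eventually_sequentially using incseq_orthant_box[of P] unfolding incseq_def by blast
      have "(\<lambda>n. cmod (f z - c n) powr q) \<longlonglongrightarrow> cmod (f z - c0) powr q"
        using q by (intro tendsto_powr' tendsto_norm tendsto_diff tendsto_const c0) auto
      then have "(\<lambda>n. ennreal (cmod (f z - c n) powr q)) \<longlonglongrightarrow> ennreal (cmod (f z - c0) powr q)" by (rule tendsto_ennrealI)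
      then have "(\<lambda>n. ennreal (cmod (f z - c n) powr q) * indicator (orthant_box P n) z) \<longlonglongrightarrow> ennreal (cmod (f z - c0) powr q)"
        by (rule Lim_transform_eventually) (use ev in \<open>auto elim!: eventually_mono\<close>)
      then show ?thesis using True by (simp add: lim_imp_Liminf)
    qed simp
  qed
  also have "\<dots> \<le> liminf (\<lambda>n. \<integral>\<^sup>+z\<in>orthant_box P n. ennreal (cmod (f z - c n) powr q) \<partial>rho)"
    by (rule nn_integral_liminf) measurable
  also have "\<dots> \<le> liminf (\<lambda>n. ennreal B)"
    using osc unfolding c_def by (intro Liminf_mono always_eventually allI)
  also have "\<dots> = ennreal B" by (simp add: Liminf_const)
  finally show ?thesis by (rule that)
qed

text \<open>Otherwise the constant would be in \<open>L\<^sup>q\<close> of a set of infinite measure.\<close>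

lemma orthant_constant_zero:
  fixes f :: "(real^'n) \<times> real \<Rightarrow> complex"
  assumes fm [measurable]: "f \<in> borel_measurable rho" and q: "0 < q"
    and 1: "(\<integral>\<^sup>+z\<in>{z \<in> S_set. orthant z = P}. ennreal (cmod (f z - c) powr q) \<partial>rho) < \<infinity>"
    and 2: "(\<integral>\<^sup>+z. ennreal (cmod (f z) powr q) \<partial>rho) < \<infinity>"
  shows "c = 0"
proof (rule ccontr)
  assume c: "c \<noteq> 0"
  let ?O = "{z \<in> S_set. orthant z = P}"
  have "ennreal (2 powr q) * ((\<integral>\<^sup>+z\<in>?O. ennreal (cmod (f z - c) powr q) \<partial>rho) + (\<integral>\<^sup>+z. ennreal (cmod (f z) powr q) \<partial>rho)) < \<infinity>"
    using 1 2 by (simp add: ennreal_mult_less_top)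
  then obtain A where A: "ennreal (2 powr q) * ((\<integral>\<^sup>+z\<in>?O. ennreal (cmod (f z - c) powr q) \<partial>rho) + (\<integral>\<^sup>+z. ennreal (cmod (f z) powr q) \<partial>rho)) = ennreal A" "0 \<le> A"
    by (cases "ennreal (2 powr q) * ((\<integral>\<^sup>+z\<in>?O. ennreal (cmod (f z - c) powr q) \<partial>rho) + (\<integral>\<^sup>+z. ennreal (cmod (f z) powr q) \<partial>rho))") auto
  have le: "cmod c powr q * real (Suc n) \<le> A" for n
  proof -
    let ?R = "orthant_box P n"
    have RO: "?R \<subseteq> ?O"
      using box_subset_S[of _ "orthant_point P"] orthant_box_iff[of _ P n] unfolding orthant_box_def by blast
    have "ennreal (cmod c powr q) * emeasure rho ?R = (\<integral>\<^sup>+z\<in>?R. ennreal (cmod c powr q) \<partial>rho)"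
      by (simp add: nn_integral_cmult_indicator)
    also have "\<dots> \<le> (\<integral>\<^sup>+z. ennreal (2 powr q) * (ennreal (cmod (f z - c) powr q) * indicator ?O z + ennreal (cmod (f z) powr q)) \<partial>rho)"
    proof (rule nn_integral_mono)
      fix z
      have "ennreal (cmod ((c - f z) + f z) powr q) \<le> ennreal (2 powr q) * (ennreal (cmod (c - f z) powr q) + ennreal (cmod (f z) powr q))"
        by (rule powr_norm_add_le[OF q])
      then show "ennreal (cmod c powr q) * indicator ?R z \<le> ennreal (2 powr q) * (ennreal (cmod (f z - c) powr q) * indicator ?O z + ennreal (cmod (f z) powr q))"
        using RO by (cases "z \<in> ?R") (auto simp: norm_minus_commute)
    qed
    also have "\<dots> = ennreal A" unfolding A(1)[symmetric] by (simp add: nn_integral_cmult nn_integral_add)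
    finally have "cmod c powr q * measure rho ?R \<le> A"
      using A(2) by (simp add: emeasure_orthant_box flip: ennreal_mult)
    moreover have "cmod c powr q * real (Suc n) \<le> cmod c powr q * measure rho ?R"
      by (intro mult_left_mono measure_orthant_box) simp
    ultimately show ?thesis by simp
  qed
  have cp: "0 < cmod c powr q" using c by simp
  obtain n :: nat where "A / cmod c powr q < real n" using reals_Archimedean2 by blast
  then have "A < real n * cmod c powr q" unfolding pos_divide_less_eq[OF cp] .
  also have "\<dots> \<le> cmod c powr q * real (Suc n)" using cp by (simp add: algebra_simps)
  finally show False using le[of n] by simp
qed

text \<open>Dyadic cubes do not cross the coordinate hyperplanes.\<close>

lemma CZ_in_orthant:
  assumes R: "R \<in> CZ_sets" and z: "z \<in> R" "w \<in> R"
  shows "orthant z = orthant w"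
proof -
  obtain Q :: "(real^'a) set" and L a r where R': "R = Q \<times> {a * exp (- r)..a * exp r}" "dyadic_cube Q L"
    using R unfolding CZ_sets_def by blast
  then obtain k :: int and m :: "'a \<Rightarrow> int" where L: "L = 2 powi k"
    and Q: "Q = {x. \<forall>i. L * of_int (m i) \<le> x $ i \<and> x $ i < L * (of_int (m i) + 1)}"
    unfolding dyadic_cube_def by blast
  have L0: "0 < L" by (simp add: L)
  have "0 \<le> y $ i \<longleftrightarrow> 0 \<le> m i" if "y \<in> Q" for y i
  proof -
    have y: "L * of_int (m i) \<le> y $ i" "y $ i < L * (of_int (m i) + 1)" using that by (auto simp: Q)
    show ?thesis
    proof (cases "0 \<le> m i")
      case True
      then have "0 \<le> L * of_int (m i)" using L0 by simp
      then show ?thesis using True y by linarith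
    next
      case False
      then have "real_of_int (m i) + 1 \<le> 0" by linarith
      then have "L * (of_int (m i) + 1) \<le> 0" using L0 by (simp add: mult_le_0_iff)
      then show ?thesis using False y by linarith
    qed
  qed
  then show ?thesis using z R'(1) by (auto simp: orthant_def)
qed

lemma orthant_step_measurable [measurable]:
  "(\<lambda>z. c (orthant z) :: complex) \<in> borel_measurable (rho :: ((real^'n) \<times> real) measure)"
proof (rule measurableI)
  fix A :: "complex set"
  have "(\<lambda>z. c (orthant z)) -` A \<inter> space rho = (\<Union>P\<in>{P :: 'n set. c P \<in> A}. {z \<in> S_set. orthant z = P})"
    by (auto simp: space_rho)
  also have "\<dots> \<in> sets rho" by (intro sets.finite_UN) auto
  finally show "(\<lambda>z. c (orthant z)) -` A \<inter> space rho \<in> sets rho" .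
qed simp

lemma star_norm_orthant_step:
  fixes c :: "('n::finite) set \<Rightarrow> complex"
  shows "star_norm (\<lambda>z :: (real^'n) \<times> real. c (orthant z)) = 0"
proof -
  have "(\<integral>\<^sup>+z\<in>R. ennreal (cmod (c (orthant z) - avg (\<lambda>z. c (orthant z)) R)) \<partial>rho) / emeasure rho R = 0"
    if R: "R \<in> CZ_sets" for R :: "((real^'n) \<times> real) set"
  proof (cases "emeasure rho R = 0 \<or> R = {}")
    case True
    then have "emeasure rho R = 0" by auto
    then have "(\<integral>\<^sup>+z\<in>R. ennreal (cmod (c (orthant z) - avg (\<lambda>z. c (orthant z)) R)) \<partial>rho) = 0"
      using CZ_sets_rho[OF R] by (intro nn_integral_null_set) (auto simp: null_sets_def)
    then show ?thesis by simp
  next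
    case False
    then obtain w where w: "w \<in> R" by auto
    have cz: "c (orthant z) = c (orthant w)" if "z \<in> R" for z using CZ_in_orthant[OF R that w] by simp
    have m: "measure rho R \<noteq> 0" using False CZ_finite[OF R] by (auto simp: measure_def enn2real_eq_0_iff)
    have "(LINT z:R|rho. c (orthant z)) = (LINT z:R|rho. c (orthant w))"
      unfolding set_lebesgue_integral_def using cz
      by (intro Bochner_Integration.integral_cong refl) (auto split: split_indicator)
    also have "\<dots> = measure rho R *\<^sub>R c (orthant w)"
      using CZ_finite[OF R] CZ_sets_rho[OF R] by (simp add: set_lebesgue_integral_def)
    finally have "avg (\<lambda>z. c (orthant z)) R = c (orthant w)" using m by (simp add: avg_def)
    then have "ennreal (cmod (c (orthant z) - avg (\<lambda>z. c (orthant z)) R)) * indicator R z = 0" for z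
      using cz by (cases "z \<in> R") auto
    then have "(\<lambda>z. ennreal (cmod (c (orthant z) - avg (\<lambda>z. c (orthant z)) R)) * indicator R z) = (\<lambda>z. 0)"
      by (rule ext)
    then show ?thesis by (simp only:) simp
  qed
  then show ?thesis unfolding star_norm_def by (intro antisym SUP_least) auto
qed

lemma interp_orthant_constants:
  fixes f :: "(real^'n) \<times> real \<Rightarrow> complex"
  assumes f: "f \<in> interp_space star_rel H1 H1_norm BMO BMO_norm \<psi> q" and q: "1 < q" "1 / q = 1 - \<psi>"
  obtains c where "\<forall>P. (\<integral>\<^sup>+z\<in>{z \<in> S_set. orthant z = P}. ennreal (cmod (f z - c P) powr q) \<partial>rho)
    \<le> ennreal (sharp_const CARD('n) q) * interp_integral star_rel H1 H1_norm BMO BMO_norm \<psi> q f"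
proof -
  let ?I = "interp_integral star_rel H1 H1_norm BMO BMO_norm \<psi> q f"
  have cs: "f \<in> couple_sum star_rel H1 BMO" and fin: "?I < \<infinity>" using f by (auto simp: interp_space_def)
  have fm: "f \<in> borel_measurable rho" using cs by (auto simp: couple_sum_def star_rel_def L1_loc_def)
  have "ennreal (sharp_const CARD('n) q) * ?I < \<infinity>" using fin by (simp add: ennreal_mult_less_top)
  then obtain B where B: "ennreal (sharp_const CARD('n) q) * ?I = ennreal B" "0 \<le> B"
    by (cases "ennreal (sharp_const CARD('n) q) * ?I") auto
  have "\<exists>c. (\<integral>\<^sup>+z\<in>{z \<in> S_set. orthant z = P}. ennreal (cmod (f z - c) powr q) \<partial>rho) \<le> ennreal B" for P
  proof (rule orthant_constant[OF fm q(1) _ B(2)])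
    show "(\<integral>\<^sup>+z\<in>orthant_box P n. ennreal (cmod (f z - avg f (orthant_box P n)) powr q) \<partial>rho) \<le> ennreal B" for n
      unfolding B(1)[symmetric] orthant_box_def by (rule box_oscillation_le_interp[OF cs q orthant_box_admissible])
  qed blast
  then have "\<forall>P. \<exists>c. (\<integral>\<^sup>+z\<in>{z \<in> S_set. orthant z = P}. ennreal (cmod (f z - c) powr q) \<partial>rho) \<le> ennreal B" by blast
  from choice[OF this] show ?thesis using that unfolding B(1) by blast
qed

lemma nn_integral_orthants:
  fixes G :: "(real^'n) \<times> real \<Rightarrow> ennreal"
  assumes [measurable]: "G \<in> borel_measurable rho"
    and le: "\<And>P. (\<integral>\<^sup>+z\<in>{z \<in> S_set. orthant z = P}. G z \<partial>rho) \<le> B"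
  shows "(\<integral>\<^sup>+z. G z \<partial>rho) \<le> ennreal (2 ^ CARD('n)) * B"
proof -
  have "(\<integral>\<^sup>+z. G z \<partial>rho) = (\<integral>\<^sup>+z. (\<Sum>P\<in>UNIV. G z * indicator {z \<in> S_set. orthant z = P} z) \<partial>rho)"
  proof (rule nn_integral_cong)
    fix z assume "z \<in> space (rho :: ((real^'n) \<times> real) measure)"
    then have "(\<Sum>P\<in>UNIV. G z * indicator {z \<in> S_set. orthant z = P} z) = (\<Sum>P\<in>UNIV. if P = orthant z then G z else 0)"
      by (intro sum.cong refl) (auto simp: space_rho indicator_def)
    then show "G z = (\<Sum>P\<in>UNIV. G z * indicator {z \<in> S_set. orthant z = P} z)" by simp
  qed
  also have "\<dots> = (\<Sum>P\<in>UNIV. \<integral>\<^sup>+z\<in>{z \<in> S_set. orthant z = P}. G z \<partial>rho)"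
    by (rule nn_integral_sum) auto
  also have "\<dots> \<le> (\<Sum>P\<in>(UNIV :: 'n set set). B)" by (intro sum_mono le)
  also have "\<dots> = ennreal (2 ^ CARD('n)) * B" 
    using card_Pow[of "UNIV :: 'n set"] ennreal_of_nat_eq_real_of_nat[of "2 ^ CARD('n)"] by simp
  finally show ?thesis .
qed

section \<open>Identification of the interpolation space\<close>

lemma interp_representative:
  fixes f :: "(real^'n) \<times> real \<Rightarrow> complex"
  assumes f: "f \<in> interp_space star_rel H1 H1_norm BMO BMO_norm \<psi> q" and q: "1 < q" "1 / q = 1 - \<psi>"
  obtains g where "g \<in> Lp q" "(f, g) \<in> star_rel"
proof -
  let ?I = "interp_integral star_rel H1 H1_norm BMO BMO_norm \<psi> q f"
  obtain c where c: "\<forall>P. (\<integral>\<^sup>+z\<in>{z \<in> S_set. orthant z = P}. ennreal (cmod (f z - c P) powr q) \<partial>rho)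
    \<le> ennreal (sharp_const CARD('n) q) * ?I" by (rule interp_orthant_constants[OF f q])
  have loc: "f \<in> L1_loc" and fin: "?I < \<infinity>" using f by (auto simp: interp_space_def couple_sum_def star_rel_def)
  have [measurable]: "f \<in> borel_measurable rho" using loc by (simp add: L1_loc_def)
  define g where "g z = f z - c (orthant z)" for z
  have gm [measurable]: "g \<in> borel_measurable rho" unfolding g_def by measurable
  have "(\<integral>\<^sup>+z\<in>{z \<in> S_set. orthant z = P}. ennreal (cmod (g z) powr q) \<partial>rho) \<le> ennreal (sharp_const CARD('n) q) * ?I" for P
  proof -
    have "(\<integral>\<^sup>+z\<in>{z \<in> S_set. orthant z = P}. ennreal (cmod (g z) powr q) \<partial>rho)
      = (\<integral>\<^sup>+z\<in>{z \<in> S_set. orthant z = P}. ennreal (cmod (f z - c P) powr q) \<partial>rho)"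
      by (intro nn_integral_cong) (auto simp: g_def split: split_indicator)
    then show ?thesis using spec[OF c, of P] by simp
  qed
  then have "(\<integral>\<^sup>+z. ennreal (cmod (g z) powr q) \<partial>rho) \<le> ennreal (2 ^ CARD('n)) * (ennreal (sharp_const CARD('n) q) * ?I)"
    by (intro nn_integral_orthants) measurable
  also have "\<dots> < \<infinity>" using fin by (simp add: ennreal_mult_less_top)
  finally have gi: "(\<integral>\<^sup>+z. ennreal (cmod (g z) powr q) \<partial>rho) < \<infinity>" .
  then have gLp: "g \<in> Lp q" unfolding Lp_def using gm by (auto intro!: integrableI_bounded)
  have "(\<lambda>z. f z - g z) = (\<lambda>z. c (orthant z))" by (simp add: g_def)
  then have "star_norm (\<lambda>z. f z - g z) = 0" using star_norm_orthant_step[of c] by simp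
  then have "(f, g) \<in> star_rel" using loc Lp_L1_loc[OF gLp] q by (simp add: star_rel_def)
  then show ?thesis using that gLp by blast
qed

lemma Lp_le_interp_integral:
  fixes g :: "(real^'n) \<times> real \<Rightarrow> complex"
  assumes g: "g \<in> interp_space star_rel H1 H1_norm BMO BMO_norm \<psi> q" "g \<in> Lp q" and q: "1 < q" "1 / q = 1 - \<psi>"
  shows "(\<integral>\<^sup>+z. ennreal (cmod (g z) powr q) \<partial>rho)
    \<le> ennreal (2 ^ CARD('n)) * (ennreal (sharp_const CARD('n) q) * interp_integral star_rel H1 H1_norm BMO BMO_norm \<psi> q g)"
proof -
  let ?I = "interp_integral star_rel H1 H1_norm BMO BMO_norm \<psi> q g"
  obtain c where c: "\<forall>P. (\<integral>\<^sup>+z\<in>{z \<in> S_set. orthant z = P}. ennreal (cmod (g z - c P) powr q) \<partial>rho)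
    \<le> ennreal (sharp_const CARD('n) q) * ?I" by (rule interp_orthant_constants[OF g(1) q])
  have gm [measurable]: "g \<in> borel_measurable rho" using Lp_nn_integral(1)[OF g(2)] .
  have fin: "ennreal (sharp_const CARD('n) q) * ?I < \<infinity>" using g(1) by (simp add: interp_space_def ennreal_mult_less_top)
  have c0: "c P = 0" for P
  proof (rule orthant_constant_zero[OF gm])
    show "0 < q" using q by simp
    show "(\<integral>\<^sup>+z\<in>{z \<in> S_set. orthant z = P}. ennreal (cmod (g z - c P) powr q) \<partial>rho) < \<infinity>"
      using spec[OF c, of P] fin by (rule order.strict_trans1)
    show "(\<integral>\<^sup>+z. ennreal (cmod (g z) powr q) \<partial>rho) < \<infinity>" by (simp add: Lp_nn_integral(2)[OF g(2)])
  qed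
  have "(\<integral>\<^sup>+z\<in>{z \<in> S_set. orthant z = P}. ennreal (cmod (g z) powr q) \<partial>rho) \<le> ennreal (sharp_const CARD('n) q) * ?I" for P
    using spec[OF c, of P] by (simp add: c0)
  then show ?thesis by (intro nn_integral_orthants) measurable
qed

lemma interp_integral_star_rel:
  assumes "(f, g) \<in> star_rel"
  shows "interp_integral star_rel H1 H1_norm BMO BMO_norm \<psi> q f = interp_integral star_rel H1 H1_norm BMO BMO_norm \<psi> q g"
proof -
  have "(f, u) \<in> star_rel \<longleftrightarrow> (g, u) \<in> star_rel" for u
    using assms equiv_star_rel by (meson equivE symE transE)
  then show ?thesis by (simp add: interp_integral_def K_functional_def)
qed

lemma Lp_interp_space:
  fixes f :: "(real^'n) \<times> real \<Rightarrow> complex"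
  assumes f: "f \<in> Lp q" and q: "1 < q" "1 / q = 1 - \<psi>"
  shows "f \<in> interp_space star_rel H1 H1_norm BMO BMO_norm \<psi> q"
  unfolding interp_space_def
  using interp_integral_le_Lp[OF f q] Lp_nn_integral(2)[OF f]
  by (auto intro: le_less_trans simp: ennreal_mult_less_top)

theorem corollary5p7:
  fixes q \<psi> :: real
  assumes "1 < q" and "0 < \<psi>" and "\<psi> < 1" and "1 / q = 1 - \<psi>"
  shows "interp_space star_rel H1 H1_norm BMO BMO_norm \<psi> q // star_rel
           = (Lp q :: ((real^'n) \<times> real \<Rightarrow> complex) set) // star_rel \<and>
         (\<exists>c C. 0 < c \<and> 0 < C \<and>
           (\<forall>f \<in> interp_space star_rel H1 H1_norm BMO BMO_norm \<psi> q.
            \<forall>g \<in> (Lp q :: ((real^'n) \<times> real \<Rightarrow> complex) set).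
              (f, g) \<in> star_rel \<longrightarrow>
                c * Lp_norm q g \<le> interp_norm star_rel H1 H1_norm BMO BMO_norm \<psi> q f \<and>
                interp_norm star_rel H1 H1_norm BMO BMO_norm \<psi> q f \<le> C * Lp_norm q g))"
proof (intro conjI)
  note q = assms(1,4)
  let ?X = "interp_space star_rel H1 H1_norm BMO BMO_norm \<psi> q :: ((real^'n) \<times> real \<Rightarrow> complex) set"
  let ?Y = "Lp q :: ((real^'n) \<times> real \<Rightarrow> complex) set"
  show "?X // star_rel = ?Y // star_rel"
  proof (intro subset_antisym subsetI)
    fix Z assume "Z \<in> ?X // star_rel"
    then obtain f where f: "f \<in> ?X" "Z = star_rel `` {f}" by (rule quotientE)
    obtain g where g: "g \<in> ?Y" "(f, g) \<in> star_rel" by (rule interp_representative[OF f(1) q])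
    have "Z = star_rel `` {g}" using f(2) equiv_class_eq[OF equiv_star_rel g(2)] by simp
    then show "Z \<in> ?Y // star_rel" using g(1) by (auto intro: quotientI)
  next
    fix Z assume "Z \<in> ?Y // star_rel"
    then obtain f where f: "f \<in> ?Y" "Z = star_rel `` {f}" by (rule quotientE)
    then show "Z \<in> ?X // star_rel" using Lp_interp_space[OF f(1) q] by (auto intro: quotientI)
  qed
  define A where "A = (24 * 2 ^ CARD('n)) powr q * (1 / (1 - 2 powr (- (q - 1))) * (1 / (1 - 2 powr (- (q - 1)))))"
  define D where "D = 2 ^ CARD('n) * sharp_const CARD('n) q"
  have l1: "2 powr (- (q - 1)) < 1" using powr_less_mono[of "- (q - 1)" 0 2] q by simp
  have l2: "2 powr (- q) < 1" using powr_less_mono[of "- q" 0 2] q by simp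
  have A: "0 < A" using l1 by (simp add: A_def)
  have sc: "0 < sharp_const CARD('n) q" using l2 by (simp add: sharp_const_def sharp_gap_def)
  then have D: "0 < D" by (simp add: D_def)
  have q0: "0 \<le> 1 / q" using q(1) by simp
  show "\<exists>c C. 0 < c \<and> 0 < C \<and> (\<forall>f\<in>?X. \<forall>g\<in>?Y. (f, g) \<in> star_rel \<longrightarrow>
     c * Lp_norm q g \<le> interp_norm star_rel H1 H1_norm BMO BMO_norm \<psi> q f \<and>
     interp_norm star_rel H1 H1_norm BMO BMO_norm \<psi> q f \<le> C * Lp_norm q g)"
  proof (rule exI[of _ "(1 / D) powr (1 / q)"], rule exI[of _ "A powr (1 / q)"], intro conjI ballI impI)
    show "0 < (1 / D) powr (1 / q)" "0 < A powr (1 / q)" using A D by auto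
    fix f g assume f: "f \<in> ?X" and g: "g \<in> ?Y" and fg: "(f, g) \<in> star_rel"
    let ?I = "interp_integral star_rel H1 H1_norm BMO BMO_norm \<psi> q f"
    let ?J = "LINT z|rho. cmod (g z) powr q"
    have e: "?I = interp_integral star_rel H1 H1_norm BMO BMO_norm \<psi> q g" by (rule interp_integral_star_rel[OF fg])
    have J0: "0 \<le> ?J" by simp
    obtain i where i: "?I = ennreal i" "0 \<le> i" using f by (cases ?I) (auto simp: interp_space_def)
    have gX: "g \<in> ?X" by (rule Lp_interp_space[OF g q])
    have "ennreal i \<le> ennreal A * ennreal ?J"
      using interp_integral_le_Lp(2)[OF g q] unfolding e[symmetric] i(1) Lp_nn_integral(2)[OF g] A_def .
    then have up: "i \<le> A * ?J" using A J0 by (simp flip: ennreal_mult)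
    have "ennreal ?J \<le> ennreal (2 ^ CARD('n)) * (ennreal (sharp_const CARD('n) q) * ennreal i)"
      using Lp_le_interp_integral[OF gX g q] unfolding e[symmetric] i(1) Lp_nn_integral(2)[OF g] .
    also have "ennreal (2 ^ CARD('n)) * (ennreal (sharp_const CARD('n) q) * ennreal i) = ennreal (D * i)"
      using sc i(2) by (simp add: D_def ennreal_mult mult.assoc)
    finally have lo: "?J \<le> D * i" using D i(2) by simp
    have n: "interp_norm star_rel H1 H1_norm BMO BMO_norm \<psi> q f = i powr (1 / q)"
      using i by (simp add: interp_norm_def)
    show "interp_norm star_rel H1 H1_norm BMO BMO_norm \<psi> q f \<le> A powr (1 / q) * Lp_norm q g"
    proof -
      have "i powr (1 / q) \<le> (A * ?J) powr (1 / q)" using up i(2) q0 by (intro powr_mono2)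
      then show ?thesis unfolding n Lp_norm_def using A J0 by (simp add: powr_mult)
    qed
    show "(1 / D) powr (1 / q) * Lp_norm q g \<le> interp_norm star_rel H1 H1_norm BMO BMO_norm \<psi> q f"
    proof -
      have "1 / D * ?J \<le> i" using lo D by (simp add: field_simps)
      then have "(1 / D * ?J) powr (1 / q) \<le> i powr (1 / q)" using J0 D q0 by (intro powr_mono2) auto
      moreover have "(1 / D * ?J) powr (1 / q) = (1 / D) powr (1 / q) * ?J powr (1 / q)" by (rule powr_mult)
      ultimately show ?thesis unfolding n Lp_norm_def by simp
    qed
  qed
qed

end
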